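(* Let $\rho,\tilde\rho$ be probability measures on $\mathbb{S}$. Let $\mathcal{J}$ be a cover of $I$, let $(w_J)_{J\in\mathcal{J}}$ be a family of strictly positive weights, and let $(\gamma^J,\tilde\gamma^J,Q^J,\hat Q^J)_{J\in\mathcal{J}}$ be a coupled update rule for $(\rho,\tilde\rho)$. Define for $i,j\in I$ $$W_{ij}:=\mathbf{1}_{i=j}\sum_{J\in\mathcal{J}:i\in J}w_J,\qquad R_{ij}:=\sup_{x,z\in\mathbb{S}:\,x^{I\setminus\{j\}}=z^{I\setminus\{j\}}}\frac{1}{\eta_j(x_j,z_j)}\sum_{J\in\mathcal{J}:i\in J}w_J\,Q^J_{x,z}\eta_i,$$ $$a_j:=\sum_{J\in\mathcal{J}:j\in J}w_J\int^{*}\tilde\rho(dx)\,\hat Q^J_x\eta_j .$$ Assume that $\gamma^J$ is quasilocal for every $J\in\mathcal{J}$, and that $$W_{ii}\le 1\quad\text{and}\quad \lim_{n\to\infty}\sum_{j\in I}(\mathrm{Id}-W+R)^n_{ij}\,(\rho\otimes\tilde\rho)\eta_j=0\quad\text{for all } i\in I.$$ Then $$|\rho f-\tilde\rho f|\le\sum_{i,j\in I}\delta_if\,D_{ij}\,W_{jj}^{-1}a_j\qquad\text{where}\qquad D:=\sum_{n=0}^\infty(W^{-1}R)^n,$$ for any bounded and measurable quasilocal function $f:\mathbb{S}\to\mathbb{R}$ such that $\delta_if<\infty$ for all $i\in I$.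
   Context: Sites and configurations. $I$ is a finite or countably infinite set (of sites); $\mathcal{I}$ is the set of finite subsets of $I$. To each $i\in I$ is associated a measurable space $\mathbb{S}^i$ with a metric $\eta_i$ that is measurable as a function on $\mathbb{S}^i\times\mathbb{S}^i$. $\mathbb{S}^J:=\prod_{i\in J}\mathbb{S}^i$ for $J\subseteq I$, and $\mathbb{S}:=\mathbb{S}^I$ (product $\sigma$-algebras). For $x\in\mathbb{S}$, $x^J:=(x_i)_{i\in J}$; for disjoint $J,K$, $x^Jy^K$ is the element of $\mathbb{S}^{J\cup K}$ with coordinates $x^J$ on $J$ and $y^K$ on $K$. A cover of $I$ is a collection $\mathcal{J}\subseteq\mathcal{I}$ of finite subsets such that every $i\in I$ lies in at least one $J\in\mathcal{J}$. Functions. For $f:\mathbb{S}\to\mathbb{R}$, $J\in\mathcal{I}$, $x\in\mathbb{S}$ let $f^J_x(z):=f(z^Jx^{I\setminus J})$. $f$ is quasilocal if $\lim_{J\in\mathcal{I}}|f^J_x(z)-f(z)|=0$ for all $x,z\in\mathbb{S}$, the limit being that of the net indexed by $\mathcal{I}$ directed by inclusion (equivalently, $f_x^{J_k}(z)\to f(z)$ along every increasing sequence of finite sets $J_k$ with $\bigcup_kJ_k=I$). Quasilocality of functions on $\mathbb{S}^{K}$, $K\subseteq I$, is defined in the same way with index set $K$. Define $$\delta_if:=\sup_{x,z\in\mathbb{S}:\,x^{I\setminus\{i\}}=z^{I\setminus\{i\}}}\frac{|f(x)-f(z)|}{\eta_i(x_i,z_i)}.$$ Suprema of ratios of this type are over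 pairs that differ exactly at the indicated site (so that the denominator is positive), and equal $0$ if there are no such pairs. Matrices. Matrices indexed by $I$ have entries in $[0,\infty]$, are multiplied in the usual way with the convention $\infty\cdot0=0$, and $A^0=\mathrm{Id}:=(\mathbf{1}_{i=j})_{i,j\in I}$. Kernels. A transition kernel $\gamma$ from $\Omega$ to $\Omega'$ is a map $\omega\mapsto\gamma_\omega$ into probability measures on $\Omega'$ with $\omega\mapsto\gamma_\omega(A)$ measurable for each measurable $A$; $(\gamma f)(\omega)=\int\gamma_\omega(d\omega')f(\omega')$. A kernel between product spaces is quasilocal if $\gamma f$ is quasilocal for every bounded measurable quasilocal $f$. For a transition kernel $\gamma^J$ from $\mathbb{S}$ to $\mathbb{S}^J$ ($J\in\mathcal{I}$), a probability $\mu$ on $\mathbb{S}$ is $\gamma^J$-invariant if $\int\mu(dx)f(x)=\int\mu(dx)\gamma^J_x(dz^J)f(z^Jx^{I\setminus J})$ for every bounded measurable $f$. Update rules. A local update rule for $\rho$ is a collection $(\gamma^J)_{J\in\mathcal{J}}$ where $\mathcal{J}$ is a cover of $I$, $\gamma^J$ is a transition kernel from $\mathbb{S}$ to $\mathbb{S}^J$, and $\rho$ is $\gamma^J$-invariant for every $J\in\mathcal{J}$. A coupled update rule for $(\rho,\tilde\rho)$ is a collection $(\gamma^J,\tilde\gamma^J,Q^J,\hat Q^J)_{J\in\mathcal{J}}$, with $\mathcal{J}$ a cover of $I$, such that: (1) $(\gamma^J)_{J\in\mathcal{J}}$ and $(\tilde\gamma^J)_{J\in\mathcal{J}}$ are local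 update rules for $\rho$ and $\tilde\rho$, respectively; (2) $Q^J_{x,z}$ is a coupling of $\gamma^J_x,\gamma^J_z$ (a probability on $\mathbb{S}^J\times\mathbb{S}^J$ with these marginals) for every $J\in\mathcal{J}$ and $x,z\in\mathbb{S}$ with $\operatorname{card}\{i:x_i\ne z_i\}=1$; (3) $\hat Q^J_x$ is a coupling of $\gamma^J_x,\tilde\gamma^J_x$ for every $J\in\mathcal{J}$, $x\in\mathbb{S}$. The couplings need not depend measurably on $x,z$. Other notation. $\mu f=\int f\,d\mu$. For a probability $Q$ on $\mathbb{S}^J\times\mathbb{S}^J$ and $i\in J$, $Q\eta_i:=\int\eta_i(\omega_i,\omega_i')\,Q(d\omega,d\omega')\in[0,\infty]$; $(\rho\otimes\tilde\rho)\eta_j:=\int\eta_j(x_j,z_j)\,\rho(dx)\,\tilde\rho(dz)$. $\int^{*}f(x)\,\rho(dx):=\inf\{\int g\,d\rho: f\le g,\ g\text{ measurable}\}$ is the outer integral. *)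

theory Defs
  imports "HOL-Probability.Probability"
begin

text \<open>
  The site set is \<open>I\<close>, the local space at site \<open>i\<close> is the measurable space \<open>M i\<close>, and the space of
  configurations over \<open>K \<subseteq> I\<close> is \<open>PiM K M\<close>. The configuration that agrees with \<open>z\<close> on \<open>J\<close> and with
  \<open>x\<close> on \<open>K - J\<close> is \<open>merge J (K - J) (z, x)\<close>. Quantities with values in \<open>[0, \<infinity>]\<close> are of type
  \<^typ>\<open>ennreal\<close>, where \<open>\<infinity> * 0 = 0\<close>, every sum converges and the supremum of the empty set is 0.
\<close>

definition quasilocal :: "'i set \<Rightarrow> ('i \<Rightarrow> 'a measure) \<Rightarrow> (('i \<Rightarrow> 'a) \<Rightarrow> real) \<Rightarrow> bool" where
  "quasilocal K M f \<longleftrightarrow>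
    (\<forall>x \<in> space (PiM K M). \<forall>z \<in> space (PiM K M).
      ((\<lambda>J. \<bar>f (merge J (K - J) (z, x)) - f z\<bar>) \<longlongrightarrow> 0) (finite_subsets_at_top K))"

definition bounded_measurable :: "'b measure \<Rightarrow> ('b \<Rightarrow> real) \<Rightarrow> bool" where
  "bounded_measurable N f \<longleftrightarrow> f \<in> borel_measurable N \<and> bounded (f ` space N)"

definition differ_only_at ::
    "'i set \<Rightarrow> ('i \<Rightarrow> 'a measure) \<Rightarrow> 'i \<Rightarrow> (('i \<Rightarrow> 'a) \<times> ('i \<Rightarrow> 'a)) set" where
  "differ_only_at I M i =
    {(x, z). x \<in> space (PiM I M) \<and> z \<in> space (PiM I M) \<and>
             restrict x (I - {i}) = restrict z (I - {i}) \<and> x i \<noteq> z i}"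

definition delta ::
    "'i set \<Rightarrow> ('i \<Rightarrow> 'a measure) \<Rightarrow> ('i \<Rightarrow> 'a \<Rightarrow> 'a \<Rightarrow> real) \<Rightarrow> 'i \<Rightarrow> (('i \<Rightarrow> 'a) \<Rightarrow> real) \<Rightarrow> ennreal" where
  "delta I M \<eta> i f =
    (SUP (x, z) \<in> differ_only_at I M i. ennreal (\<bar>f x - f z\<bar> / \<eta> i (x i) (z i)))"

text \<open>Matrices are functions \<open>'i \<Rightarrow> 'i \<Rightarrow> ennreal\<close>, of which only the entries in \<open>I \<times> I\<close> matter.\<close>

definition mat_id :: "'i \<Rightarrow> 'i \<Rightarrow> ennreal" where
  "mat_id i j = (if i = j then 1 else 0)"

definition mat_mult ::
    "'i set \<Rightarrow> ('i \<Rightarrow> 'i \<Rightarrow> ennreal) \<Rightarrow> ('i \<Rightarrow> 'i \<Rightarrow> ennreal) \<Rightarrow> 'i \<Rightarrow> 'i \<Rightarrow> ennreal" where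
  "mat_mult I A B i j = (\<Sum>\<^sub>\<infinity>k\<in>I. A i k * B k j)"

primrec mat_pow :: "'i set \<Rightarrow> ('i \<Rightarrow> 'i \<Rightarrow> ennreal) \<Rightarrow> nat \<Rightarrow> 'i \<Rightarrow> 'i \<Rightarrow> ennreal" where
  "mat_pow I A 0 = mat_id"
| "mat_pow I A (Suc n) = mat_mult I (mat_pow I A n) A"

text \<open>
  A transition kernel from \<open>N\<close> to \<open>N'\<close> is an element of \<open>N \<rightarrow>\<^sub>M prob_algebra N'\<close>.
\<close>

definition quasilocal_kernel ::
    "'i set \<Rightarrow> 'i set \<Rightarrow> ('i \<Rightarrow> 'a measure) \<Rightarrow> (('i \<Rightarrow> 'a) \<Rightarrow> ('i \<Rightarrow> 'a) measure) \<Rightarrow> bool" where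
  "quasilocal_kernel I J M \<gamma> \<longleftrightarrow>
    (\<forall>f. bounded_measurable (PiM J M) f \<and> quasilocal J M f \<longrightarrow>
         quasilocal I M (\<lambda>x. \<integral>y. f y \<partial>\<gamma> x))"

definition kernel_invariant ::
    "'i set \<Rightarrow> 'i set \<Rightarrow> ('i \<Rightarrow> 'a measure) \<Rightarrow> (('i \<Rightarrow> 'a) \<Rightarrow> ('i \<Rightarrow> 'a) measure) \<Rightarrow>
     ('i \<Rightarrow> 'a) measure \<Rightarrow> bool" where
  "kernel_invariant I J M \<gamma> \<mu> \<longleftrightarrow>
    (\<forall>f. bounded_measurable (PiM I M) f \<longrightarrow>
         (\<integral>x. f x \<partial>\<mu>) = (\<integral>x. (\<integral>z. f (merge J (I - J) (z, x)) \<partial>\<gamma> x) \<partial>\<mu>))"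

definition finite_cover :: "'i set \<Rightarrow> 'i set set \<Rightarrow> bool" where
  "finite_cover I \<J> \<longleftrightarrow> (\<forall>J\<in>\<J>. finite J \<and> J \<subseteq> I) \<and> (\<forall>i\<in>I. \<exists>J\<in>\<J>. i \<in> J)"

definition local_update_rule ::
    "'i set \<Rightarrow> ('i \<Rightarrow> 'a measure) \<Rightarrow> 'i set set \<Rightarrow> ('i set \<Rightarrow> ('i \<Rightarrow> 'a) \<Rightarrow> ('i \<Rightarrow> 'a) measure) \<Rightarrow>
     ('i \<Rightarrow> 'a) measure \<Rightarrow> bool" where
  "local_update_rule I M \<J> \<gamma> \<rho> \<longleftrightarrow>
    finite_cover I \<J> \<and>
    (\<forall>J\<in>\<J>. \<gamma> J \<in> PiM I M \<rightarrow>\<^sub>M prob_algebra (PiM J M) \<and> kernel_invariant I J M (\<gamma> J) \<rho>)"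

definition is_coupling :: "('b \<times> 'b) measure \<Rightarrow> 'b measure \<Rightarrow> 'b measure \<Rightarrow> bool" where
  "is_coupling Q \<mu> \<nu> \<longleftrightarrow>
    prob_space Q \<and> sets Q = sets (\<mu> \<Otimes>\<^sub>M \<nu>) \<and> distr Q \<mu> fst = \<mu> \<and> distr Q \<nu> snd = \<nu>"

definition coupled_update_rule ::
    "'i set \<Rightarrow> ('i \<Rightarrow> 'a measure) \<Rightarrow> 'i set set \<Rightarrow>
     ('i set \<Rightarrow> ('i \<Rightarrow> 'a) \<Rightarrow> ('i \<Rightarrow> 'a) measure) \<Rightarrow>
     ('i set \<Rightarrow> ('i \<Rightarrow> 'a) \<Rightarrow> ('i \<Rightarrow> 'a) measure) \<Rightarrow>
     ('i set \<Rightarrow> ('i \<Rightarrow> 'a) \<Rightarrow> ('i \<Rightarrow> 'a) \<Rightarrow> (('i \<Rightarrow> 'a) \<times> ('i \<Rightarrow> 'a)) measure) \<Rightarrow>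
     ('i set \<Rightarrow> ('i \<Rightarrow> 'a) \<Rightarrow> (('i \<Rightarrow> 'a) \<times> ('i \<Rightarrow> 'a)) measure) \<Rightarrow>
     ('i \<Rightarrow> 'a) measure \<Rightarrow> ('i \<Rightarrow> 'a) measure \<Rightarrow> bool" where
  "coupled_update_rule I M \<J> \<gamma> \<gamma>' Q Q' \<rho> \<rho>' \<longleftrightarrow>
    finite_cover I \<J> \<and>
    local_update_rule I M \<J> \<gamma> \<rho> \<and>
    local_update_rule I M \<J> \<gamma>' \<rho>' \<and>
    (\<forall>J\<in>\<J>. \<forall>x \<in> space (PiM I M). \<forall>z \<in> space (PiM I M).
        card {i \<in> I. x i \<noteq> z i} = 1 \<longrightarrow> is_coupling (Q J x z) (\<gamma> J x) (\<gamma> J z)) \<and>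
    (\<forall>J\<in>\<J>. \<forall>x \<in> space (PiM I M). is_coupling (Q' J x) (\<gamma> J x) (\<gamma>' J x))"

text \<open>\<open>mean_dist \<eta> i Q\<close> is \<open>Q\<eta>\<^sub>i\<close>.\<close>

definition mean_dist ::
    "('i \<Rightarrow> 'a \<Rightarrow> 'a \<Rightarrow> real) \<Rightarrow> 'i \<Rightarrow> (('i \<Rightarrow> 'a) \<times> ('i \<Rightarrow> 'a)) measure \<Rightarrow> ennreal" where
  "mean_dist \<eta> i Q = (\<integral>\<^sup>+(\<omega>, \<omega>'). ennreal (\<eta> i (\<omega> i) (\<omega>' i)) \<partial>Q)"

definition outer_integral :: "'b measure \<Rightarrow> ('b \<Rightarrow> ennreal) \<Rightarrow> ennreal" where
  "outer_integral N f =
    (INF g \<in> {g \<in> borel_measurable N. \<forall>x \<in> space N. f x \<le> g x}. \<integral>\<^sup>+x. g x \<partial>N)"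

definition W_mat :: "'i set set \<Rightarrow> ('i set \<Rightarrow> real) \<Rightarrow> 'i \<Rightarrow> 'i \<Rightarrow> ennreal" where
  "W_mat \<J> w i j = (if i = j then (\<Sum>\<^sub>\<infinity>J\<in>{J\<in>\<J>. i \<in> J}. ennreal (w J)) else 0)"

text \<open>The inverse of a diagonal matrix whose diagonal entries on \<open>I\<close> lie in \<open>(0, \<infinity>)\<close>.\<close>

definition diag_inverse :: "('i \<Rightarrow> 'i \<Rightarrow> ennreal) \<Rightarrow> 'i \<Rightarrow> 'i \<Rightarrow> ennreal" where
  "diag_inverse W i j = (if i = j then inverse (W i i) else 0)"

definition R_mat ::
    "'i set \<Rightarrow> ('i \<Rightarrow> 'a measure) \<Rightarrow> ('i \<Rightarrow> 'a \<Rightarrow> 'a \<Rightarrow> real) \<Rightarrow> 'i set set \<Rightarrow> ('i set \<Rightarrow> real) \<Rightarrow>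
     ('i set \<Rightarrow> ('i \<Rightarrow> 'a) \<Rightarrow> ('i \<Rightarrow> 'a) \<Rightarrow> (('i \<Rightarrow> 'a) \<times> ('i \<Rightarrow> 'a)) measure) \<Rightarrow> 'i \<Rightarrow> 'i \<Rightarrow> ennreal" where
  "R_mat I M \<eta> \<J> w Q i j =
    (SUP (x, z) \<in> differ_only_at I M j.
      ennreal (1 / \<eta> j (x j) (z j)) *
      (\<Sum>\<^sub>\<infinity>J\<in>{J\<in>\<J>. i \<in> J}. ennreal (w J) * mean_dist \<eta> i (Q J x z)))"

definition a_vec ::
    "('i \<Rightarrow> 'a \<Rightarrow> 'a \<Rightarrow> real) \<Rightarrow> 'i set set \<Rightarrow> ('i set \<Rightarrow> real) \<Rightarrow>
     ('i set \<Rightarrow> ('i \<Rightarrow> 'a) \<Rightarrow> (('i \<Rightarrow> 'a) \<times> ('i \<Rightarrow> 'a)) measure) \<Rightarrow> ('i \<Rightarrow> 'a) measure \<Rightarrow> 'i \<Rightarrow> ennreal" where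
  "a_vec \<eta> \<J> w Q' \<rho>' j =
    (\<Sum>\<^sub>\<infinity>J\<in>{J\<in>\<J>. j \<in> J}. ennreal (w J) * outer_integral \<rho>' (\<lambda>x. mean_dist \<eta> j (Q' J x)))"

text \<open>
  \<open>Id - W + R\<close>. Subtraction in \<^typ>\<open>ennreal\<close> is truncated at 0, so this is the intended matrix only
  when the diagonal entries of \<open>W\<close> are at most 1.
\<close>

definition iter_mat ::
    "('i \<Rightarrow> 'i \<Rightarrow> ennreal) \<Rightarrow> ('i \<Rightarrow> 'i \<Rightarrow> ennreal) \<Rightarrow> 'i \<Rightarrow> 'i \<Rightarrow> ennreal" where
  "iter_mat W R i j = mat_id i j - W i j + R i j"

definition D_mat ::
    "'i set \<Rightarrow> ('i \<Rightarrow> 'i \<Rightarrow> ennreal) \<Rightarrow> ('i \<Rightarrow> 'i \<Rightarrow> ennreal) \<Rightarrow> 'i \<Rightarrow> 'i \<Rightarrow> ennreal" where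
  "D_mat I W R i j = (\<Sum>n. mat_pow I (mat_mult I (diag_inverse W) R) n i j)"

end

theory Submission
  imports Defs "HOL-Library.Diagonal_Subsequence"
begin

text \<open>
  Write \<open>\<langle>x, v\<rangle> = \<Sum>\<^sub>i x\<^sub>i v\<^sub>i\<close> for a row \<open>x\<close> and a column \<open>v\<close> with entries in \<open>[0, \<infinity>]\<close>, and put
  \<open>B = Id - W + R\<close>, \<open>S = \<Sum>\<^sub>k B\<^sup>k a\<close>, \<open>u\<^sub>j = (\<rho> \<otimes> \<rho>')\<eta>\<^sub>j\<close> and \<open>err f = \<bar>\<rho>f - \<rho>'f\<bar>\<close>. The column
  \<open>s = D W\<^sup>-\<^sup>1 a\<close> solves \<open>s = a + B s\<close>, and \<open>S\<close> is the least solution of this equation. It is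
  therefore enough to prove \<open>err f \<le> \<langle>\<delta> f, S\<rangle>\<close>. The measures enter through three facts only.

  \<^item> A function changes by at most \<open>\<Sum>\<^sub>i \<delta>\<^sub>i f \<eta>\<^sub>i(x\<^sub>i, z\<^sub>i)\<close> between two configurations, because it
    can be changed one site at a time and quasilocality disposes of the remaining sites. Hence
    \<open>err f \<le> \<langle>\<delta> f, u\<rangle>\<close> (\<open>integral_diff_le_dot_mean_dist\<close>).
  \<^item> Let \<open>g\<close> be the average of \<open>f\<close> and of its updates in the blocks of a finite set \<open>\<K>\<close>, with weights
    \<open>\<theta> w\<^sub>J\<close> whose sum is at most 1. By invariance \<open>\<rho>g = \<rho>f\<close>; the couplings \<open>Q'\<close> bound
    \<open>\<bar>\<rho>'g - \<rho>'f\<bar>\<close> by \<open>\<theta>\<langle>\<delta> f, a\<rangle>\<close>, and the couplings \<open>Q\<close> bound \<open>\<delta> g\<close> by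
    \<open>(Id - \<theta>W\<^sub>\<K> + \<theta>R)\<close> applied to the row \<open>\<delta> f\<close>. The function \<open>g\<close> is again quasilocal
    (\<open>quasilocal_block_update\<close>).
  \<^item> Freezing all coordinates outside a large finite set changes \<open>\<rho>f\<close> and \<open>\<rho>'f\<close> as little as desired
    and removes the oscillation at the frozen sites (\<open>localization\<close>).

  Iterating the second fact would give \<open>err f \<le> \<langle>\<delta> f, \<Sum>\<^bsub>k<n\<^esub> B\<^sup>k a\<rangle> + \<langle>\<delta> f, B\<^sup>n u\<rangle>\<close> if one could update
  all blocks at once. The total weight of the blocks may be infinite, so this is not possible, and
  the iteration is replaced by a variational argument. Call a column \<open>v\<close> an estimate if
  \<open>err f \<le> \<langle>\<delta> f, v\<rangle>\<close> for all \<open>f\<close> with \<open>\<delta> f\<close> dominated by a multiple of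
  \<open>y = \<Sum>\<^sub>k r\<^sup>k x B\<^sup>k\<close>, where \<open>0 < r < 1\<close>. Pointwise limits of estimates with bounded \<open>\<langle>y, v\<rangle>\<close> are
  estimates, so some estimate \<open>v\<close> minimizes \<open>\<langle>y, v\<rangle>\<close>. An average over \<open>\<K>\<close> turns \<open>v\<close> into the estimate \<open>v + \<theta>(R v + a - W\<^sub>\<K> v)\<close>;
  minimality gives \<open>\<langle>y, W\<^sub>\<K> v\<rangle> \<le> \<langle>y, R v + a\<rangle>\<close>, an inequality that does not contain \<open>\<theta>\<close>, so that \<open>\<K>\<close> may
  exhaust all blocks. The result \<open>\<langle>y, v\<rangle> \<le> \<langle>y, B v + a\<rangle>\<close> and \<open>y = x + r y B\<close> imply
  \<open>\<langle>x, v\<rangle> \<le> (1 - r)/r \<langle>y, v\<rangle> + \<langle>x, S\<rangle>\<close> (\<open>resolvent_bound\<close>). Since \<open>u\<close> is an estimate,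
  \<open>\<langle>y, v\<rangle> \<le> \<langle>y, u\<rangle> = \<Sum>\<^sub>k r\<^sup>k \<langle>x, B\<^sup>k u\<rangle>\<close>. If all \<open>\<langle>x, B\<^sup>k u\<rangle>\<close> are finite, then \<open>1 - r\<close> times this sum is
  an Abel mean of a null sequence, and \<open>r \<rightarrow> 1\<close> finishes the proof.

  The hypothesis gives \<open>\<langle>x, B\<^sup>k u\<rangle> \<rightarrow> 0\<close>, but these numbers may be infinite for finitely many \<open>k\<close>. An
  induction on an index from which they are finite (\<open>err_le_dot_S_level\<close>) removes this obstacle. After localization
  \<open>x\<close> has finite support, and updating one block at each site of the support pushes the oscillation at
  least one step of \<open>B\<close> further, at a cost of at most a constant times \<open>\<langle>\<delta> f, S\<rangle>\<close>. The induction
  hypothesis applies to the function obtained, hence a multiple of \<open>S\<close> is an estimate, and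
  the variational argument with this estimate in place of \<open>u\<close> improves the multiple to 1.
\<close>


section \<open>Sums over countable sets\<close>

lemma finite_exhaustion:
  assumes "countable I"
  obtains L :: "nat \<Rightarrow> 'i set" where "\<And>n. finite (L n)" "\<And>n. L n \<subseteq> I" "incseq L" "(\<Union>n. L n) = I"
proof
  let ?L = "\<lambda>n. {i \<in> I. to_nat_on I i \<le> n}"
  show "finite (?L n)" for n
  proof (rule finite_imageD)
    show "finite (to_nat_on I ` ?L n)" by (rule finite_subset[of _ "{..n}"]) auto
    show "inj_on (to_nat_on I) (?L n)"
      by (rule inj_on_subset[OF inj_on_to_nat_on[OF assms]]) auto
  qed
  show "?L n \<subseteq> I" for n by auto
  show "incseq ?L" by (auto simp: incseq_def)
  show "(\<Union>n. ?L n) = I" by auto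
qed

lemma nn_integral_count_space_sum_le:
  assumes "finite F" "F \<subseteq> A"
  shows "(\<Sum>i\<in>F. g i) \<le> (\<integral>\<^sup>+i. g i \<partial>count_space A)"
proof -
  have "(\<Sum>i\<in>F. g i) = (\<integral>\<^sup>+i. g i * indicator F i \<partial>count_space A)"
    using assms by (subst nn_integral_count_space'[of F]) (auto simp: indicator_def)
  also have "\<dots> \<le> (\<integral>\<^sup>+i. g i \<partial>count_space A)"
    by (intro nn_integral_mono) (auto simp: indicator_def)
  finally show ?thesis .
qed

lemma nn_integral_count_space_SUP_exhaustion:
  assumes L: "\<And>n. finite (L n)" "\<And>n. L n \<subseteq> A" "incseq L" "(\<Union>n. L n) = A"
  shows "(\<integral>\<^sup>+i. g i \<partial>count_space A) = (SUP n. \<Sum>i\<in>L n. g i)"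
proof -
  have *: "(\<Sum>i\<in>L n. g i) = (\<integral>\<^sup>+i. g i * indicator (L n) i \<partial>count_space A)" for n
    using L by (subst nn_integral_count_space'[of "L n"]) (auto simp: indicator_def)
  have "(\<integral>\<^sup>+i. g i \<partial>count_space A) = (\<integral>\<^sup>+i. (SUP n. g i * indicator (L n) i) \<partial>count_space A)"
  proof (rule nn_integral_cong)
    fix i assume "i \<in> space (count_space A)"
    then obtain n where "i \<in> L n" using L by auto
    then show "g i = (SUP n. g i * indicator (L n) i)"
      by (intro antisym SUP_least SUP_upper2[of n]) (auto simp: indicator_def)
  qed
  also have "\<dots> = (SUP n. \<integral>\<^sup>+i. g i * indicator (L n) i \<partial>count_space A)"
    using L(3) by (intro nn_integral_monotone_convergence_SUP)
      (auto simp: incseq_def le_fun_def indicator_def)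
  finally show ?thesis using * by simp
qed

lemma nn_integral_count_space_le_finite_sums:
  assumes "countable A" "\<And>F. finite F \<Longrightarrow> F \<subseteq> A \<Longrightarrow> (\<Sum>i\<in>F. g i) \<le> (c :: ennreal)"
  shows "(\<integral>\<^sup>+i. g i \<partial>count_space A) \<le> c"
proof -
  obtain L where L: "\<And>n. finite (L n)" "\<And>n. L n \<subseteq> A" "incseq L" "(\<Union>n. L n) = A"
    using finite_exhaustion[OF assms(1)] by metis
  show ?thesis unfolding nn_integral_count_space_SUP_exhaustion[OF L]
    by (intro SUP_least assms(2) L)
qed

lemma infsum_eq_nn_integral_count_space:
  assumes "countable A"
  shows "(\<Sum>\<^sub>\<infinity>i\<in>A. g i) = (\<integral>\<^sup>+i. (g i :: ennreal) \<partial>count_space A)"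
proof -
  have "(\<Sum>\<^sub>\<infinity>i\<in>A. g i) = (SUP F\<in>{F. finite F \<and> F \<subseteq> A}. sum g F)"
    by (rule nonneg_infsum_complete) auto
  also have "\<dots> = (\<integral>\<^sup>+i. g i \<partial>count_space A)"
    by (intro antisym SUP_least nn_integral_count_space_sum_le
          nn_integral_count_space_le_finite_sums[OF assms]) (auto intro: SUP_upper)
  finally show ?thesis .
qed

lemma sum_le_infsum_ennreal:
  assumes "countable A" "finite F" "F \<subseteq> A"
  shows "(\<Sum>i\<in>F. g i) \<le> (\<Sum>\<^sub>\<infinity>i\<in>A. (g i :: ennreal))"
  unfolding infsum_eq_nn_integral_count_space[OF assms(1)]
  by (rule nn_integral_count_space_sum_le[OF assms(2,3)])

lemma nn_integral_count_space_Times: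
  assumes "countable A" "countable B"
  shows "(\<integral>\<^sup>+p. g p \<partial>count_space (A \<times> B)) = (\<integral>\<^sup>+i. \<integral>\<^sup>+j. g (i, j) \<partial>count_space B \<partial>count_space A)"
proof -
  interpret B: sigma_finite_measure "count_space B"
    by (rule sigma_finite_measure_count_space_countable[OF assms(2)])
  have "(\<integral>\<^sup>+p. g p \<partial>count_space (A \<times> B)) = (\<integral>\<^sup>+p. g p \<partial>(count_space A \<Otimes>\<^sub>M count_space B))"
    using assms by (simp add: pair_measure_countable)
  also have "\<dots> = (\<integral>\<^sup>+i. \<integral>\<^sup>+j. g (i, j) \<partial>count_space B \<partial>count_space A)"
    by (rule B.nn_integral_fst[symmetric]) (simp add: pair_measure_countable assms)
  finally show ?thesis .
qed

lemma countable_finite_cover: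
  assumes "countable I" "finite_cover I \<J>"
  shows "countable \<J>"
  by (rule countable_subset[OF _ countable_Collect_finite_subset[OF assms(1)]])
     (use assms(2) in \<open>auto simp: finite_cover_def\<close>)

section \<open>Rows, columns and matrices with entries in \<open>[0, \<infinity>]\<close>\<close>

text \<open>
  All sums over sites are integrals with respect to the counting measure, so that the convergence
  theorems for \<open>\<integral>\<^sup>+\<close> apply to them. Rows and columns are both functions on sites.
\<close>

definition dot :: "'i set \<Rightarrow> ('i \<Rightarrow> ennreal) \<Rightarrow> ('i \<Rightarrow> ennreal) \<Rightarrow> ennreal" where
  "dot I x v = (\<integral>\<^sup>+i. x i * v i \<partial>count_space I)"

definition row_act :: "'i set \<Rightarrow> ('i \<Rightarrow> ennreal) \<Rightarrow> ('i \<Rightarrow> 'i \<Rightarrow> ennreal) \<Rightarrow> 'i \<Rightarrow> ennreal" where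
  "row_act I x A j = (\<integral>\<^sup>+i. x i * A i j \<partial>count_space I)"

definition col_act :: "'i set \<Rightarrow> ('i \<Rightarrow> 'i \<Rightarrow> ennreal) \<Rightarrow> ('i \<Rightarrow> ennreal) \<Rightarrow> 'i \<Rightarrow> ennreal" where
  "col_act I A v i = (\<integral>\<^sup>+j. A i j * v j \<partial>count_space I)"

definition row_pow :: "'i set \<Rightarrow> ('i \<Rightarrow> 'i \<Rightarrow> ennreal) \<Rightarrow> nat \<Rightarrow> ('i \<Rightarrow> ennreal) \<Rightarrow> 'i \<Rightarrow> ennreal" where
  "row_pow I A k x = ((\<lambda>z. row_act I z A) ^^ k) x"

definition col_pow :: "'i set \<Rightarrow> ('i \<Rightarrow> 'i \<Rightarrow> ennreal) \<Rightarrow> nat \<Rightarrow> ('i \<Rightarrow> ennreal) \<Rightarrow> 'i \<Rightarrow> ennreal" where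
  "col_pow I A k v = (col_act I A ^^ k) v"

lemma dot_mono: "(\<And>i. i \<in> I \<Longrightarrow> x i \<le> x' i) \<Longrightarrow> (\<And>i. i \<in> I \<Longrightarrow> v i \<le> v' i) \<Longrightarrow> dot I x v \<le> dot I x' v'"
  unfolding dot_def by (intro nn_integral_mono mult_mono) auto

lemma dot_cong: "(\<And>i. i \<in> I \<Longrightarrow> x i * v i = x' i * v' i) \<Longrightarrow> dot I x v = dot I x' v'"
  unfolding dot_def by (intro nn_integral_cong) auto

lemma dot_add_left: "dot I (\<lambda>i. x i + x' i) v = dot I x v + dot I x' v"
  unfolding dot_def by (subst nn_integral_add[symmetric]) (auto simp: distrib_right)

lemma dot_add_right: "dot I x (\<lambda>i. v i + v' i) = dot I x v + dot I x v'"
  unfolding dot_def by (subst nn_integral_add[symmetric]) (auto simp: distrib_left)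

lemma dot_cmult_left: "dot I (\<lambda>i. c * x i) v = c * dot I x v"
  unfolding dot_def by (subst nn_integral_cmult[symmetric]) (auto simp: mult_ac)

lemma dot_cmult_right: "dot I x (\<lambda>i. c * v i) = c * dot I x v"
  unfolding dot_def by (subst nn_integral_cmult[symmetric]) (auto simp: mult_ac)

lemma dot_sum_left: "dot I (\<lambda>i. \<Sum>k\<in>K. x k i) v = (\<Sum>k\<in>K. dot I (x k) v)"
  unfolding dot_def by (subst nn_integral_sum[symmetric]) (auto simp: sum_distrib_right)

lemma dot_suminf_left: "dot I (\<lambda>i. \<Sum>k. x k i) v = (\<Sum>k. dot I (x k) v)"
  unfolding dot_def by (subst nn_integral_suminf[symmetric]) (auto simp: ennreal_suminf_multc)

lemma dot_suminf_right: "dot I x (\<lambda>i. \<Sum>k. v k i) = (\<Sum>k. dot I x (v k))"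
  unfolding dot_def by (subst nn_integral_suminf[symmetric]) (auto simp: ennreal_suminf_cmult)

lemma dot_finite_support:
  assumes "finite L" "L \<subseteq> I" "\<And>i. i \<in> I \<Longrightarrow> i \<notin> L \<Longrightarrow> x i = 0"
  shows "dot I x v = (\<Sum>i\<in>L. x i * v i)"
  unfolding dot_def using assms by (subst nn_integral_count_space'[of L]) auto

lemma dot_point_le: "i \<in> I \<Longrightarrow> x i * v i \<le> dot I x v"
  unfolding dot_def using nn_integral_count_space_sum_le[of "{i}" I "\<lambda>i. x i * v i"] by simp

lemma dot_row_act:
  assumes "countable I"
  shows "dot I (row_act I x A) v = dot I x (col_act I A v)"
proof -
  have "dot I (row_act I x A) v = (\<integral>\<^sup>+j. \<integral>\<^sup>+i. x i * A i j * v j \<partial>count_space I \<partial>count_space I)"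
    unfolding dot_def row_act_def by (subst nn_integral_multc) auto
  also have "\<dots> = (\<integral>\<^sup>+i. \<integral>\<^sup>+j. x i * A i j * v j \<partial>count_space I \<partial>count_space I)"
    by (rule nn_integral_count_space_nn_integral) (use assms in auto)
  also have "\<dots> = dot I x (col_act I A v)"
    unfolding dot_def col_act_def by (subst nn_integral_cmult[symmetric]) (auto simp: mult_ac)
  finally show ?thesis .
qed

lemma row_act_eq_dot: "row_act I x A j = dot I x (\<lambda>i. A i j)"
  by (simp add: row_act_def dot_def)

lemma col_act_eq_dot: "col_act I A v i = dot I (A i) v"
  by (simp add: col_act_def dot_def)

lemma row_pow_0 [simp]: "row_pow I A 0 x = x"
  by (simp add: row_pow_def)

lemma row_pow_Suc: "row_pow I A (Suc k) x = row_act I (row_pow I A k x) A"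
  by (simp add: row_pow_def)

lemma col_pow_0 [simp]: "col_pow I A 0 v = v"
  by (simp add: col_pow_def)

lemma col_pow_Suc: "col_pow I A (Suc k) v = col_act I A (col_pow I A k v)"
  by (simp add: col_pow_def)

lemma col_pow_Suc': "col_pow I A (Suc k) v = col_pow I A k (col_act I A v)"
  by (simp add: col_pow_def funpow_swap1)

lemma col_pow_add: "col_pow I A k (col_pow I A l v) = col_pow I A (k + l) v"
  by (simp add: col_pow_def funpow_add)

lemma dot_row_pow:
  assumes "countable I"
  shows "dot I (row_pow I A k x) v = dot I x (col_pow I A k v)"
  by (induction k arbitrary: v)
     (simp_all add: row_pow_Suc dot_row_act[OF assms] col_pow_Suc')

lemma row_act_mono: "(\<And>i. i \<in> I \<Longrightarrow> x i \<le> x' i) \<Longrightarrow> row_act I x A j \<le> row_act I x' A j"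
  unfolding row_act_eq_dot by (rule dot_mono) auto

lemma row_pow_mono: "(\<And>i. i \<in> I \<Longrightarrow> x i \<le> x' i) \<Longrightarrow> j \<in> I \<Longrightarrow> row_pow I A k x j \<le> row_pow I A k x' j"
  by (induction k arbitrary: j) (auto simp: row_pow_Suc intro!: row_act_mono)

lemma row_pow_cmult: "row_pow I A k (\<lambda>i. c * x i) j = c * row_pow I A k x j"
proof (induction k arbitrary: j)
  case (Suc k)
  have "row_pow I A k (\<lambda>i. c * x i) = (\<lambda>i. c * row_pow I A k x i)"
    using Suc.IH by (rule ext)
  then show ?case by (simp add: row_pow_Suc row_act_eq_dot dot_cmult_left)
qed simp

lemma col_act_mono: "(\<And>i. i \<in> I \<Longrightarrow> v i \<le> v' i) \<Longrightarrow> col_act I A v j \<le> col_act I A v' j"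
  unfolding col_act_eq_dot by (rule dot_mono) auto

lemma mat_pow_eq_row_pow:
  assumes "countable I"
  shows "mat_pow I A n i = row_pow I A n (mat_id i)"
proof (induction n)
  case (Suc n)
  have "mat_pow I A (Suc n) i = row_act I (mat_pow I A n i) A"
    by (rule ext) (simp add: mat_mult_def row_act_def infsum_eq_nn_integral_count_space[OF assms])
  then show ?case by (simp add: Suc row_pow_Suc)
qed simp

lemma dot_mat_pow:
  assumes "countable I" "i \<in> I"
  shows "dot I (mat_pow I A n i) v = col_pow I A n v i"
proof -
  have "dot I (mat_id i) v = (\<Sum>k\<in>{i}. mat_id i k * v k)" for v
    using assms(2) by (intro dot_finite_support) (auto simp: mat_id_def)
  then show ?thesis
    by (simp add: mat_pow_eq_row_pow[OF assms(1)] dot_row_pow[OF assms(1)] mat_id_def)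
qed

section \<open>Subsequences and discounted sums in \<open>[0, \<infinity>]\<close>\<close>

lemma subsequence_convergent_ennreal:
  fixes s :: "nat \<Rightarrow> ennreal"
  obtains \<sigma> :: "nat \<Rightarrow> nat" where "strict_mono \<sigma>" "convergent (s \<circ> \<sigma>)"
proof -
  obtain \<sigma> :: "nat \<Rightarrow> nat" where \<sigma>: "strict_mono \<sigma>" "monoseq (\<lambda>n. s (\<sigma> n))"
    using seq_monosub by blast
  then have "convergent (s \<circ> \<sigma>)"
    using LIMSEQ_SUP[of "s \<circ> \<sigma>"] LIMSEQ_INF[of "s \<circ> \<sigma>"]
    by (auto simp: convergent_def monoseq_iff comp_def)
  with \<sigma> that show ?thesis by blast
qed

text \<open>
  Sequential compactness of \<open>[0, \<infinity>]\<^sup>I\<close>. It yields the minimizing estimate.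
\<close>

lemma diagonal_subsequence_ennreal:
  fixes v :: "nat \<Rightarrow> 'i \<Rightarrow> ennreal"
  assumes "countable I"
  obtains \<sigma> u where "strict_mono (\<sigma> :: nat \<Rightarrow> nat)" "\<And>i. i \<in> I \<Longrightarrow> (\<lambda>n. v (\<sigma> n) i) \<longlonglongrightarrow> u i"
proof -
  define P where "P k \<sigma> \<longleftrightarrow> (\<forall>i\<in>I. to_nat_on I i = k \<longrightarrow> convergent (\<lambda>n. v (\<sigma> n) i))" for k \<sigma>
  interpret subseqs P
  proof
    fix k and s :: "nat \<Rightarrow> nat" assume "strict_mono s"
    show "\<exists>r'. strict_mono r' \<and> P k (s \<circ> r')"
    proof (cases "\<exists>i\<in>I. to_nat_on I i = k")
      case True
      then obtain i where i: "i \<in> I" "to_nat_on I i = k" by blast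
      obtain r' where "strict_mono r'" "convergent ((\<lambda>n. v (s n) i) \<circ> r')"
        using subsequence_convergent_ennreal by metis
      moreover have "j = i" if "j \<in> I" "to_nat_on I j = k" for j
        using i that inj_on_to_nat_on[OF assms] by (auto simp: inj_on_def)
      ultimately show ?thesis by (auto simp: P_def comp_def intro!: exI[of _ r'])
    next
      case False
      then show ?thesis by (auto simp: P_def intro!: exI[of _ id] strict_mono_id)
    qed
  qed
  have "convergent (\<lambda>n. v (diagseq n) i)" if "i \<in> I" for i
  proof -
    let ?k = "to_nat_on I i"
    have "P ?k (diagseq \<circ> ((+) (Suc ?k)))"
    proof (rule diagseq_holds)
      fix r s n assume "strict_mono (r :: nat \<Rightarrow> nat)" "P n s"
      then show "P n (s \<circ> r)"
        by (auto simp: P_def comp_def dest!: convergent_subseq_convergent[of _ r, unfolded comp_def] )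
    qed
    then have "convergent (\<lambda>n. v (diagseq (n + Suc ?k)) i)"
      using that by (simp add: P_def comp_def add.commute)
    then obtain l where "(\<lambda>n. v (diagseq (n + Suc ?k)) i) \<longlonglongrightarrow> l"
      by (auto simp: convergent_def)
    then have "(\<lambda>n. v (diagseq n) i) \<longlonglongrightarrow> l"
      by (rule LIMSEQ_offset)
    then show ?thesis by (auto simp: convergent_def)
  qed
  then show ?thesis using that[OF subseq_diagseq, of "\<lambda>i. lim (\<lambda>n. v (diagseq n) i)"]
    by (auto simp: convergent_LIMSEQ_iff)
qed

text \<open>
  Multiplication by \<open>\<infinity>\<close> is not continuous at 0, which is the reason for the second hypothesis.
\<close>

lemma tendsto_cmult_ennreal:
  fixes x t :: ennreal
  assumes s: "s \<longlonglongrightarrow> t" and "x = \<infinity> \<Longrightarrow> \<forall>n. s n = 0"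
  shows "(\<lambda>n. x * s n) \<longlonglongrightarrow> x * t"
proof (cases "x = \<infinity>")
  case True
  then have "s = (\<lambda>_. 0)" using assms(2) by auto
  then show ?thesis using s by (simp add: LIMSEQ_const_iff)
next
  case False
  then show ?thesis using s by (intro ennreal_tendsto_cmult) (auto simp: less_top)
qed

lemma eventually_finite_bound:
  fixes e :: "nat \<Rightarrow> ennreal"
  assumes "\<And>k. m \<le> k \<Longrightarrow> e k < \<infinity>" "e \<longlonglongrightarrow> 0"
  obtains C :: real where "0 \<le> C" "\<And>k. m \<le> k \<Longrightarrow> e k \<le> ennreal C"
proof -
  have "\<forall>\<^sub>F k in sequentially. e k < 1"
    using assms(2) by (rule order_tendstoD) simp
  then obtain N where N: "\<And>k. N \<le> k \<Longrightarrow> e k < 1"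
    by (auto simp: eventually_sequentially)
  define C where "C = 1 + (\<Sum>k\<in>{m..<N}. enn2real (e k))"
  have "0 \<le> C" by (auto simp: C_def intro!: add_nonneg_nonneg sum_nonneg)
  moreover have "e k \<le> ennreal C" if "m \<le> k" for k
  proof (cases "k < N")
    case True
    have "enn2real (e k) \<le> (\<Sum>k\<in>{m..<N}. enn2real (e k))"
      using True that by (intro member_le_sum) auto
    then have "ennreal (enn2real (e k)) \<le> ennreal C"
      by (intro ennreal_leI) (simp add: C_def)
    then show ?thesis using assms(1)[OF that] by simp
  next
    case False
    then have "e k \<le> 1" using N[of k] by simp
    also have "1 \<le> C" by (auto simp: C_def intro!: sum_nonneg)
    then have "1 \<le> ennreal C" by simp
    finally show ?thesis .
  qed
  ultimately show ?thesis using that by blast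
qed

lemma suminf_geometric_ennreal:
  assumes "0 < r" "r < 1"
  shows "(\<Sum>k. ennreal (r ^ k)) = ennreal (1 / (1 - r))"
  using assms by (subst suminf_ennreal_eq[where x = "1 / (1 - r)"]) (auto intro!: geometric_sums)

lemma suminf_discounted_le:
  assumes r: "0 < r" "r < 1" and "0 \<le> C" "\<And>k. e k \<le> ennreal C"
  shows "(\<Sum>k. ennreal (r ^ k) * e k) \<le> ennreal (C / (1 - r))"
proof -
  have "(\<Sum>k. ennreal (r ^ k) * e k) \<le> (\<Sum>k. ennreal (r ^ k) * ennreal C)"
    using assms by (intro suminf_le mult_left_mono) auto
  also have "\<dots> = ennreal (1 / (1 - r)) * ennreal C"
    using suminf_geometric_ennreal[OF r] by simp
  also have "\<dots> = ennreal (C / (1 - r))"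
    using assms by (subst ennreal_mult[symmetric]) auto
  finally show ?thesis .
qed

lemma discounted_tail_tendsto_0:
  assumes r: "0 < r" "r < 1" and e: "e \<longlonglongrightarrow> (0 :: ennreal)"
  shows "(\<lambda>m. \<Sum>k. ennreal (r ^ k) * e (k + m)) \<longlonglongrightarrow> 0"
proof (rule tendsto_zero_ennreal)
  fix \<epsilon> :: real assume \<epsilon>: "0 < \<epsilon>"
  have "\<forall>\<^sub>F m in sequentially. e m < ennreal (\<epsilon> / 2 * (1 - r))"
    using e \<epsilon> r by (intro order_tendstoD(2)[where y=0]) auto
  then obtain N where N: "\<And>m. N \<le> m \<Longrightarrow> e m < ennreal (\<epsilon> / 2 * (1 - r))"
    by (auto simp: eventually_sequentially)
  have "(\<Sum>k. ennreal (r ^ k) * e (k + m)) < ennreal \<epsilon>" if "N \<le> m" for m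
  proof -
    have "(\<Sum>k. ennreal (r ^ k) * e (k + m)) \<le> ennreal (\<epsilon> / 2 * (1 - r) / (1 - r))"
      using that \<epsilon> r N by (intro suminf_discounted_le) (auto intro!: less_imp_le)
    also have "\<epsilon> / 2 * (1 - r) / (1 - r) = \<epsilon> / 2"
      using r by (intro nonzero_mult_div_cancel_right) simp
    also have "ennreal (\<epsilon> / 2) < ennreal \<epsilon>" using \<epsilon> by (simp add: ennreal_less_iff)
    finally show ?thesis .
  qed
  then show "\<forall>\<^sub>F m in sequentially. (\<Sum>k. ennreal (r ^ k) * e (k + m)) < ennreal \<epsilon>"
    by (auto simp: eventually_sequentially)
qed

text \<open>
  The Abel means of a null sequence vanish as \<open>r \<rightarrow> 1\<close>: the terms before a fixed index contribute
  \<open>O(1 - r)\<close>, the later ones are small and have total weight at most \<open>1/r\<close>.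
\<close>

lemma abel_mean_small:
  assumes fin: "\<And>k. e k < \<infinity>" and e: "e \<longlonglongrightarrow> (0 :: ennreal)" and \<epsilon>: "0 < \<epsilon>"
  obtains r :: real where "0 < r" "r < 1" "(\<Sum>k. ennreal (r ^ k) * e k) < \<infinity>"
    "ennreal ((1 - r) / r) * (\<Sum>k. ennreal (r ^ k) * e k) \<le> ennreal \<epsilon>"
proof -
  have "\<forall>\<^sub>F m in sequentially. e m < ennreal (\<epsilon> / 4)"
    using e \<epsilon> by (intro order_tendstoD(2)[where y=0]) auto
  then obtain N where N: "\<And>m. N \<le> m \<Longrightarrow> e m < ennreal (\<epsilon> / 4)"
    by (auto simp: eventually_sequentially)
  define C where "C = (\<Sum>k<N. enn2real (e k))"
  have C: "0 \<le> C" by (auto simp: C_def intro!: sum_nonneg)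
  \<comment> \<open>\<open>r \<ge> 1/2\<close> controls the factor \<open>1/r\<close>, the other bound makes \<open>(1 - r) C\<close> at most \<open>\<epsilon>/4\<close>.\<close>
  define r where "r = max (1 / 2) (1 - \<epsilon> / (4 * (C + 1)))"
  have r: "1 / 2 \<le> r" "r < 1" using \<epsilon> C by (auto simp: r_def)
  have rC: "(1 - r) * C \<le> \<epsilon> / 4"
  proof -
    have "(1 - r) * C \<le> \<epsilon> / (4 * (C + 1)) * C"
      using C by (intro mult_right_mono) (auto simp: r_def)
    also have "\<dots> = \<epsilon> / 4 * (C / (C + 1))" using C by (simp add: field_simps)
    also have "\<dots> \<le> \<epsilon> / 4 * 1" using C \<epsilon> by (intro mult_left_mono) auto
    finally show ?thesis by simp
  qed
  have "(\<Sum>k. ennreal (r ^ k) * e k)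
      \<le> (\<Sum>k. (if k < N then e k else 0) + ennreal (\<epsilon> / 4) * ennreal (r ^ k))"
  proof (intro suminf_le allI)
    fix k
    have "ennreal (r ^ k) * e k \<le> 1 * e k"
      using r by (intro mult_right_mono) (auto simp: power_le_one simp flip: ennreal_1)
    moreover have "ennreal (r ^ k) * e k \<le> ennreal (r ^ k) * ennreal (\<epsilon> / 4)" if "\<not> k < N"
      using N[of k] that by (intro mult_left_mono) auto
    ultimately show "ennreal (r ^ k) * e k
        \<le> (if k < N then e k else 0) + ennreal (\<epsilon> / 4) * ennreal (r ^ k)"
      by (auto simp: mult.commute intro: add_increasing2)
  qed auto
  also have "\<dots> = (\<Sum>k. if k < N then e k else 0) + ennreal (\<epsilon> / 4) * (\<Sum>k. ennreal (r ^ k))"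
    by (subst suminf_add[symmetric]) auto
  also have "(\<Sum>k. if k < N then e k else 0) = (\<Sum>k<N. e k)"
    by (subst suminf_finite[of "{..<N}"]) auto
  also have "(\<Sum>k<N. e k) = ennreal C"
    unfolding C_def using fin by (subst sum_ennreal[symmetric]) auto
  also have "ennreal (\<epsilon> / 4) * (\<Sum>k. ennreal (r ^ k)) = ennreal (\<epsilon> / 4 * (1 / (1 - r)))"
    using r \<epsilon> by (subst suminf_geometric_ennreal) (auto simp flip: ennreal_mult)
  also have "ennreal C + \<dots> = ennreal (C + \<epsilon> / 4 * (1 / (1 - r)))"
    using C \<epsilon> r by (subst ennreal_plus) auto
  finally have *: "(\<Sum>k. ennreal (r ^ k) * e k) \<le> ennreal (C + \<epsilon> / 4 * (1 / (1 - r)))" .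
  have "ennreal ((1 - r) / r) * (\<Sum>k. ennreal (r ^ k) * e k)
      \<le> ennreal ((1 - r) / r) * ennreal (C + \<epsilon> / 4 * (1 / (1 - r)))"
    using * by (intro mult_left_mono) auto
  also have "\<dots> = ennreal ((1 - r) / r * (C + \<epsilon> / 4 * (1 / (1 - r))))"
    using r C \<epsilon> by (subst ennreal_mult) auto
  also have "(1 - r) / r * (C + \<epsilon> / 4 * (1 / (1 - r))) = ((1 - r) * C + \<epsilon> / 4) / r"
    using r by (simp add: field_simps)
  also have "ennreal \<dots> \<le> ennreal \<epsilon>"
  proof (rule ennreal_leI)
    have "\<epsilon> / 2 \<le> \<epsilon> * r" using r \<epsilon> mult_left_mono[of "1/2" r \<epsilon>] by simp
    then have "(1 - r) * C + \<epsilon> / 4 \<le> \<epsilon> * r" using rC by linarith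
    then show "((1 - r) * C + \<epsilon> / 4) / r \<le> \<epsilon>" using r by (simp add: field_simps)
  qed
  finally have "ennreal ((1 - r) / r) * (\<Sum>k. ennreal (r ^ k) * e k) \<le> ennreal \<epsilon>" .
  moreover have "(\<Sum>k. ennreal (r ^ k) * e k) < \<infinity>"
    using * by (rule le_less_trans) simp
  ultimately show ?thesis using that[of r] r by simp
qed

section \<open>Comparison systems\<close>

text \<open>
  An abstract form of the comparison problem. The elements of \<open>F\<close> stand for the test functions, \<open>\<delta>\<close> for
  the row of their oscillations and \<open>err\<close> for the difference of their two expectations. The
  assumptions \<open>err_le_dot\<close>, \<open>update\<close> and \<open>localize\<close> are the three facts about the measures.
\<close>

locale comparison_system =
  fixes I :: "'i set" and \<J> :: "'i set set" and w :: "'i set \<Rightarrow> real"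
    and R :: "'i \<Rightarrow> 'i \<Rightarrow> ennreal" and a u :: "'i \<Rightarrow> ennreal"
    and F :: "'f set" and \<delta> :: "'f \<Rightarrow> 'i \<Rightarrow> ennreal" and err :: "'f \<Rightarrow> ennreal"
  assumes countable_sites: "countable I"
    and cover: "finite_cover I \<J>"
    and weight_pos: "J \<in> \<J> \<Longrightarrow> 0 < w J"
    and site_weight_le_1: "i \<in> I \<Longrightarrow> W_mat \<J> w i i \<le> 1"
    and err_le_dot: "f \<in> F \<Longrightarrow> err f \<le> dot I (\<delta> f) u"
    and update: "f \<in> F \<Longrightarrow> finite \<K> \<Longrightarrow> \<K> \<subseteq> \<J> \<Longrightarrow> 0 \<le> \<theta> \<Longrightarrow> \<theta> * (\<Sum>J\<in>\<K>. w J) \<le> 1 \<Longrightarrow>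
      \<exists>g\<in>F. (\<forall>j\<in>I. \<delta> g j \<le> ennreal (1 - \<theta> * (\<Sum>J\<in>{J\<in>\<K>. j \<in> J}. w J)) * \<delta> f j
                            + ennreal \<theta> * row_act I (\<delta> f) R j) \<and>
            err f \<le> err g + ennreal \<theta> * dot I (\<delta> f) a"
    and localize: "f \<in> F \<Longrightarrow> 0 < \<epsilon> \<Longrightarrow>
      \<exists>L g. finite L \<and> L \<subseteq> I \<and> g \<in> F \<and> (\<forall>i\<in>I. \<delta> g i \<le> (if i \<in> L then \<delta> f i else 0)) \<and>
            err f \<le> err g + ennreal \<epsilon>"
begin

definition B :: "'i \<Rightarrow> 'i \<Rightarrow> ennreal" where
  "B = iter_mat (W_mat \<J> w) R"

definition S :: "'i \<Rightarrow> ennreal" where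
  "S i = (\<Sum>k. col_pow I B k a i)"

lemma weight_nonneg: "J \<in> \<J> \<Longrightarrow> 0 \<le> w J"
  using weight_pos by (rule less_imp_le)

lemma R_le_B: "R i j \<le> B i j"
  by (simp add: B_def iter_mat_def add_increasing)

lemma col_act_B:
  assumes "i \<in> I"
  shows "col_act I B v i = (1 - W_mat \<J> w i i) * v i + col_act I R v i"
proof -
  have "col_act I B v i = (\<integral>\<^sup>+j. (mat_id i j - W_mat \<J> w i j) * v j + R i j * v j \<partial>count_space I)"
    unfolding col_act_def by (intro nn_integral_cong) (simp add: B_def iter_mat_def distrib_right)
  also have "\<dots> = (\<integral>\<^sup>+j. (mat_id i j - W_mat \<J> w i j) * v j \<partial>count_space I) + col_act I R v i"
    unfolding col_act_def by (subst nn_integral_add) auto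
  also have "(\<integral>\<^sup>+j. (mat_id i j - W_mat \<J> w i j) * v j \<partial>count_space I) = (1 - W_mat \<J> w i i) * v i"
    using assms by (subst nn_integral_count_space'[of "{i}"]) (auto simp: mat_id_def W_mat_def)
  finally show ?thesis .
qed

lemma dot_S: "dot I x S = (\<Sum>k. dot I x (col_pow I B k a))"
  unfolding S_def by (rule dot_suminf_right)

lemma dot_row_pow_S: "dot I (row_pow I B k x) S = (\<Sum>l. dot I x (col_pow I B (l + k) a))"
  by (simp add: dot_S dot_row_pow[OF countable_sites] col_pow_add add.commute)

lemma dot_row_pow_S_le: "dot I (row_pow I B k x) S \<le> dot I x S"
proof -
  have "dot I x S = dot I (row_pow I B k x) S + (\<Sum>l<k. dot I x (col_pow I B l a))"
    unfolding dot_row_pow_S by (subst dot_S, subst suminf_offset[where i=k]) auto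
  then show ?thesis by simp
qed

text \<open>
  \<open>B\<^sup>k S\<close> is a tail of the series that defines \<open>S\<close>. This is the advantage of \<open>S\<close> over other
  solutions of \<open>s = a + B s\<close>: a multiple of it can take the place of \<open>u\<close> in the limiting argument.
\<close>

lemma dot_row_pow_S_tendsto_0:
  assumes "dot I x S < \<infinity>"
  shows "(\<lambda>k. dot I (row_pow I B k x) S) \<longlonglongrightarrow> 0"
proof -
  let ?s = "\<lambda>k. \<Sum>l<k. dot I x (col_pow I B l a)"
  have eq: "dot I (row_pow I B k x) S = dot I x S - ?s k" for k
  proof -
    have *: "dot I x S = dot I (row_pow I B k x) S + ?s k"
      unfolding dot_row_pow_S by (subst dot_S, subst suminf_offset[where i=k]) auto
    have "?s k \<noteq> \<top>"
      using assms unfolding * by (auto simp: less_top)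
    then show ?thesis unfolding * by (rule ennreal_add_diff_cancel_right[symmetric])
  qed
  have "?s \<longlonglongrightarrow> dot I x S"
    unfolding dot_S by (intro summable_LIMSEQ) auto
  then have "(\<lambda>k. dot I x S - ?s k) \<longlonglongrightarrow> dot I x S - dot I x S"
    using assms by (intro tendsto_diff_ennreal) auto
  then show ?thesis using assms by (simp add: eq)
qed

lemma dot_a_le_dot_S: "dot I x a \<le> dot I x S"
  unfolding dot_S using sum_le_suminf[of "\<lambda>k. dot I x (col_pow I B k a)" "{0}"] by simp

text \<open>
  The resolvent row \<open>x (Id - r B)\<^sup>-\<^sup>1\<close>.
\<close>

definition discounted :: "real \<Rightarrow> ('i \<Rightarrow> ennreal) \<Rightarrow> 'i \<Rightarrow> ennreal" where
  "discounted r x i = (\<Sum>k. ennreal (r ^ k) * row_pow I B k x i)"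

lemma dot_discounted: "dot I (discounted r x) v = (\<Sum>k. ennreal (r ^ k) * dot I (row_pow I B k x) v)"
  unfolding discounted_def by (simp add: dot_suminf_left dot_cmult_left)

lemma discounted_unfold:
  assumes "0 < r"
  shows "discounted r x i = x i + ennreal r * row_act I (discounted r x) B i"
proof -
  have "row_act I (discounted r x) B i = (\<Sum>k. ennreal (r ^ k) * row_pow I B (Suc k) x i)"
    by (simp add: row_act_eq_dot dot_discounted row_pow_Suc)
  then have "ennreal r * row_act I (discounted r x) B i
      = (\<Sum>k. ennreal (r ^ Suc k) * row_pow I B (Suc k) x i)"
    using assms by (simp only: ennreal_suminf_cmult[symmetric])
      (simp add: ennreal_mult mult.assoc del: ennreal_suminf_cmult)
  moreover have "discounted r x i
      = (\<Sum>k. ennreal (r ^ Suc k) * row_pow I B (Suc k) x i) + x i"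
    unfolding discounted_def by (subst suminf_offset[where i=1]) auto
  ultimately show ?thesis by (simp add: add.commute)
qed

text \<open>
  Restricting the test functions to those dominated by a multiple of \<open>y\<close> makes the set of estimates
  closed even where oscillations are infinite: if \<open>\<delta> f i = \<infinity>\<close>, then \<open>y i = \<infinity>\<close>, and every column with
  finite \<open>\<langle>y, v\<rangle>\<close> vanishes at \<open>i\<close>. For the rows \<open>y\<close> of interest the class is stable under averaging.
\<close>

definition admissible :: "('i \<Rightarrow> ennreal) \<Rightarrow> 'f \<Rightarrow> bool" where
  "admissible y f \<longleftrightarrow> (\<exists>c<\<infinity>. \<forall>i\<in>I. \<delta> f i \<le> c * y i)"

definition estimates :: "('i \<Rightarrow> ennreal) \<Rightarrow> ('i \<Rightarrow> ennreal) set" where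
  "estimates y = {v. \<forall>f\<in>F. admissible y f \<longrightarrow> err f \<le> dot I (\<delta> f) v}"

text \<open>
  After localization an estimate is tested against a finite sum, which passes to pointwise limits.
\<close>

lemma estimates_closed:
  assumes v: "\<And>n. v n \<in> estimates y" "\<And>n. dot I y (v n) < \<infinity>"
    and lim: "\<And>i. i \<in> I \<Longrightarrow> (\<lambda>n. v n i) \<longlonglongrightarrow> v' i"
  shows "v' \<in> estimates y"
  unfolding estimates_def
proof (safe)
  fix f assume f: "f \<in> F" "admissible y f"
  then obtain c where c: "c < \<infinity>" "\<And>i. i \<in> I \<Longrightarrow> \<delta> f i \<le> c * y i"
    by (auto simp: admissible_def)
  have vanish: "v n i = 0" if "i \<in> I" "\<delta> f i = \<infinity>" for n i
  proof (rule ccontr)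
    assume "v n i \<noteq> 0"
    moreover have "y i = \<infinity>" using c(1) c(2)[OF that(1)] that(2)
      by (auto simp: ennreal_mult_eq_top_iff top_unique)
    ultimately have "y i * v n i = \<infinity>" by (simp add: ennreal_mult_eq_top_iff)
    then show False using dot_point_le[OF that(1), of y "v n"] v(2)[of n] by (simp add: top_unique)
  qed
  show "err f \<le> dot I (\<delta> f) v'"
  proof (rule ennreal_le_epsilon)
    fix \<epsilon> :: real assume "0 < \<epsilon>"
    then obtain L g where L: "finite L" "L \<subseteq> I" and g: "g \<in> F"
      "\<And>i. i \<in> I \<Longrightarrow> \<delta> g i \<le> (if i \<in> L then \<delta> f i else 0)" and err: "err f \<le> err g + ennreal \<epsilon>"
      using localize[OF f(1)] by metis
    have g_le: "\<delta> g i \<le> \<delta> f i" if "i \<in> I" for i using g(2)[OF that] by (auto split: if_splits)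
    have "admissible y g" unfolding admissible_def
      using c g_le order_trans by blast
    then have le: "err g \<le> (\<Sum>i\<in>L. \<delta> f i * v n i)" for n
    proof -
      have "err g \<le> dot I (\<delta> g) (v n)"
        using v(1)[of n] \<open>admissible y g\<close> g(1) by (auto simp: estimates_def)
      also have "\<dots> = (\<Sum>i\<in>L. \<delta> g i * v n i)"
      proof (intro dot_finite_support L)
        show "\<delta> g i = 0" if "i \<in> I" "i \<notin> L" for i
          using g(2)[OF that(1)] that(2) by simp
      qed
      also have "\<dots> \<le> (\<Sum>i\<in>L. \<delta> f i * v n i)"
        using L g_le by (intro sum_mono mult_right_mono) auto
      finally show ?thesis .
    qed
    have "(\<lambda>n. \<Sum>i\<in>L. \<delta> f i * v n i) \<longlonglongrightarrow> (\<Sum>i\<in>L. \<delta> f i * v' i)"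
      using L lim vanish by (intro tendsto_sum tendsto_cmult_ennreal) auto
    then have "err g \<le> (\<Sum>i\<in>L. \<delta> f i * v' i)"
      using le by (intro LIMSEQ_le_const) auto
    also have "\<dots> \<le> dot I (\<delta> f) v'"
      unfolding dot_def by (rule nn_integral_count_space_sum_le[OF L])
    finally show "err f \<le> dot I (\<delta> f) v' + ennreal \<epsilon>"
      using err by (meson add_right_mono order_trans)
  qed
qed

text \<open>
  Applying the estimate \<open>v\<close> to the averaged function \<open>g\<close> instead of \<open>f\<close> amounts to replacing \<open>v\<close> by
  \<open>v + \<theta>(R v + a - W\<^sub>\<K> v)\<close>, the adjoint of the step \<open>\<delta> f \<mapsto> \<delta> g\<close>.
\<close>

lemma estimates_update:
  assumes v: "v \<in> estimates y"
    and y: "C < \<infinity>" "\<And>i. i \<in> I \<Longrightarrow> row_act I y B i \<le> C * y i"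
    and \<K>: "finite \<K>" "\<K> \<subseteq> \<J>" and \<theta>: "0 \<le> \<theta>" "\<theta> * (\<Sum>J\<in>\<K>. w J) \<le> 1"
  shows "(\<lambda>i. ennreal (1 - \<theta> * (\<Sum>J\<in>{J\<in>\<K>. i \<in> J}. w J)) * v i + ennreal \<theta> * (col_act I R v i + a i))
      \<in> estimates y" (is "(\<lambda>i. ?k i * v i + _) \<in> _")
  unfolding estimates_def
proof safe
  fix f assume f: "f \<in> F" "admissible y f"
  then obtain c where c: "c < \<infinity>" "\<And>i. i \<in> I \<Longrightarrow> \<delta> f i \<le> c * y i"
    by (auto simp: admissible_def)
  obtain g where g: "g \<in> F"
    "\<And>j. j \<in> I \<Longrightarrow> \<delta> g j \<le> ?k j * \<delta> f j + ennreal \<theta> * row_act I (\<delta> f) R j"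
    "err f \<le> err g + ennreal \<theta> * dot I (\<delta> f) a"
    using update[OF f(1) \<K> \<theta>] by blast
  have k: "?k j \<le> 1" for j
  proof -
    have "0 \<le> (\<Sum>J\<in>{J\<in>\<K>. j \<in> J}. w J)"
      using \<K>(2) weight_nonneg by (intro sum_nonneg) auto
    then show ?thesis using \<theta>(1) by simp
  qed
  have "\<delta> g j \<le> (c + ennreal \<theta> * (c * C)) * y j" if j: "j \<in> I" for j
  proof -
    have "row_act I (\<delta> f) R j \<le> row_act I (\<lambda>i. c * y i) B j"
      unfolding row_act_eq_dot using c(2) R_le_B by (intro dot_mono) auto
    also have "\<dots> = c * row_act I y B j" by (simp add: row_act_eq_dot dot_cmult_left)
    also have "\<dots> \<le> c * (C * y j)" using y(2)[OF j] by (intro mult_left_mono) auto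
    finally have "?k j * \<delta> f j + ennreal \<theta> * row_act I (\<delta> f) R j
        \<le> 1 * (c * y j) + ennreal \<theta> * (c * (C * y j))"
      using c(2)[OF j] k by (intro add_mono mult_mono) auto
    also have "\<dots> = (c + ennreal \<theta> * (c * C)) * y j" by (simp add: algebra_simps)
    finally show ?thesis using g(2)[OF j] by (rule order_trans[rotated])
  qed
  moreover have "c + ennreal \<theta> * (c * C) < \<infinity>"
    using c(1) y(1) by (simp add: ennreal_mult_less_top)
  ultimately have "admissible y g" unfolding admissible_def by blast
  then have "err g \<le> dot I (\<delta> g) v" using v g(1) by (auto simp: estimates_def)
  also have "\<dots> \<le> dot I (\<lambda>j. ?k j * \<delta> f j + ennreal \<theta> * row_act I (\<delta> f) R j) v"
    using g(2) by (intro dot_mono) auto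
  also have "\<dots> = dot I (\<delta> f) (\<lambda>j. ?k j * v j) + ennreal \<theta> * dot I (\<delta> f) (col_act I R v)"
    unfolding dot_add_left dot_cmult_left dot_row_act[OF countable_sites]
    by (intro arg_cong2[where f="(+)"] dot_cong) (auto simp: mult_ac)
  finally have "err f \<le> dot I (\<delta> f) (\<lambda>j. ?k j * v j) + ennreal \<theta> * dot I (\<delta> f) (col_act I R v)
      + ennreal \<theta> * dot I (\<delta> f) a"
    using g(3) by (meson add_right_mono order_trans)
  also have "\<dots> = dot I (\<delta> f) (\<lambda>i. ?k i * v i + ennreal \<theta> * (col_act I R v i + a i))"
    by (simp add: dot_add_right dot_cmult_right distrib_left add.assoc)
  finally show "err f \<le> \<dots>" .
qed

text \<open>
  The direct method: a minimizing sequence has a pointwise convergent subsequence, its limit is an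
  estimate by \<open>estimates_closed\<close>, and \<open>\<langle>y, \<cdot>\<rangle>\<close> is lower semicontinuous by Fatou's lemma.
\<close>

lemma estimates_minimizer:
  assumes u: "u' \<in> estimates y" "dot I y u' < \<infinity>"
  obtains v where "v \<in> estimates y" "dot I y v \<le> dot I y u'"
    "\<And>v'. v' \<in> estimates y \<Longrightarrow> dot I y v \<le> dot I y v'"
proof -
  let ?A = "{dot I y v | v. v \<in> estimates y \<and> dot I y v \<le> dot I y u'}"
  have "?A \<noteq> {}" using u by auto
  then obtain t :: "nat \<Rightarrow> ennreal" where t: "decseq t" "range t \<subseteq> ?A" "Inf ?A = (INF n. t n)"
    using ennreal_Inf_countable_INF[of ?A] by blast
  have "\<exists>v. v \<in> estimates y \<and> dot I y v \<le> dot I y u' \<and> t n = dot I y v" for n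
    using t(2) unfolding image_subset_iff by auto
  then have "\<exists>v. \<forall>n. v n \<in> estimates y \<and> dot I y (v n) \<le> dot I y u' \<and> t n = dot I y (v n)"
    by (intro choice allI)
  then obtain v where v: "\<And>n. v n \<in> estimates y" "\<And>n. dot I y (v n) \<le> dot I y u'"
    "\<And>n. t n = dot I y (v n)" by blast
  obtain \<sigma> v' where \<sigma>: "strict_mono (\<sigma> :: nat \<Rightarrow> nat)"
    and lim: "\<And>i. i \<in> I \<Longrightarrow> (\<lambda>n. v (\<sigma> n) i) \<longlonglongrightarrow> v' i"
    using diagonal_subsequence_ennreal[OF countable_sites, of v] by blast
  have fin: "dot I y (v n) < \<infinity>" for n using v(2) u(2) by (meson le_less_trans)
  have v': "v' \<in> estimates y"
    by (rule estimates_closed[of "\<lambda>n. v (\<sigma> n)"]) (use v fin lim in auto)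
  have "(\<lambda>n. dot I y (v (\<sigma> n))) \<longlonglongrightarrow> Inf ?A"
    using LIMSEQ_subseq_LIMSEQ[OF LIMSEQ_INF[OF t(1)] \<sigma>] t(3) v(3) by (simp add: comp_def)
  then have liminf: "liminf (\<lambda>n. dot I y (v (\<sigma> n))) = Inf ?A"
    by (intro lim_imp_Liminf) auto
  have "dot I y v' = (\<integral>\<^sup>+i. liminf (\<lambda>n. y i * v (\<sigma> n) i) \<partial>count_space I)"
    unfolding dot_def
  proof (rule nn_integral_cong)
    fix i assume "i \<in> space (count_space I)"
    then have i: "i \<in> I" by simp
    have "v n i = 0" if "y i = \<infinity>" for n
      using dot_point_le[OF i, of y "v n"] fin[of n] that
      by (auto simp: ennreal_top_mult top_unique split: if_splits)
    then have "(\<lambda>n. y i * v (\<sigma> n) i) \<longlonglongrightarrow> y i * v' i"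
      using lim[OF i] by (intro tendsto_cmult_ennreal) auto
    then show "y i * v' i = liminf (\<lambda>n. y i * v (\<sigma> n) i)"
      by (intro lim_imp_Liminf[symmetric]) auto
  qed
  also have "\<dots> \<le> liminf (\<lambda>n. dot I y (v (\<sigma> n)))"
    unfolding dot_def by (rule nn_integral_liminf) auto
  finally have le: "dot I y v' \<le> Inf ?A" by (simp add: liminf)
  show ?thesis
  proof
    show "v' \<in> estimates y" by fact
    show *: "dot I y v' \<le> dot I y u'"
      by (rule order_trans[OF le]) (use u in \<open>auto intro!: Inf_lower\<close>)
    show "dot I y v' \<le> dot I y v''" if "v'' \<in> estimates y" for v''
    proof (cases "dot I y v'' \<le> dot I y u'")
      case True
      then show ?thesis using that by (intro order_trans[OF le] Inf_lower) auto
    next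
      case False
      then show ?thesis using * by simp
    qed
  qed
qed

lemma countable_blocks: "countable \<J>"
  by (rule countable_finite_cover[OF countable_sites cover])

lemma W_eq_nn_integral: "W_mat \<J> w i i = (\<integral>\<^sup>+J. ennreal (w J) * indicator J i \<partial>count_space \<J>)"
proof -
  have "countable {J\<in>\<J>. i \<in> J}" using countable_blocks by (rule countable_subset[rotated]) auto
  then have "W_mat \<J> w i i = (\<integral>\<^sup>+J. ennreal (w J) \<partial>count_space {J\<in>\<J>. i \<in> J})"
    by (simp add: W_mat_def infsum_eq_nn_integral_count_space)
  also have "\<dots> = (\<integral>\<^sup>+J. ennreal (w J) * indicator {J\<in>\<J>. i \<in> J} J \<partial>count_space UNIV)"
    by (rule nn_integral_count_space_indicator) auto
  also have "\<dots> = (\<integral>\<^sup>+J. (ennreal (w J) * indicator J i) * indicator \<J> J \<partial>count_space UNIV)"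
    by (intro nn_integral_cong) (auto simp: indicator_def)
  also have "\<dots> = (\<integral>\<^sup>+J. ennreal (w J) * indicator J i \<partial>count_space \<J>)"
    by (rule nn_integral_count_space_indicator[symmetric]) auto
  finally show ?thesis .
qed

text \<open>
  The first-order condition at a minimizer. The step size \<open>\<theta>\<close> depends on the finite set \<open>\<K>\<close> of blocks,
  but cancels, so the condition extends to the set of all blocks by monotone convergence.
\<close>

lemma minimizer_balance:
  assumes v: "v \<in> estimates y" "\<And>v'. v' \<in> estimates y \<Longrightarrow> dot I y v \<le> dot I y v'"
    and fin: "dot I y v < \<infinity>"
    and y: "C < \<infinity>" "\<And>i. i \<in> I \<Longrightarrow> row_act I y B i \<le> C * y i"
  shows "dot I y v \<le> dot I y (col_act I B v) + dot I y a"
proof -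
  let ?b = "dot I y (col_act I R v) + dot I y a"
  have partial: "dot I y (\<lambda>i. ennreal (\<Sum>J\<in>{J\<in>\<K>. i \<in> J}. w J) * v i) \<le> ?b"
    if \<K>: "finite \<K>" "\<K> \<subseteq> \<J>" for \<K>
  proof -
    let ?q = "\<lambda>i. \<Sum>J\<in>{J\<in>\<K>. i \<in> J}. w J"
    have q: "0 \<le> ?q i" "?q i \<le> (\<Sum>J\<in>\<K>. w J)" for i
      using \<K> weight_nonneg by (auto intro!: sum_nonneg sum_mono2)
    \<comment> \<open>Any positive \<open>\<theta>\<close> with \<open>\<theta> (\<Sum>J\<in>\<K>. w J) \<le> 1\<close> would do; adding 1 covers the empty \<open>\<K>\<close>.\<close>
    define \<theta> where "\<theta> = 1 / (1 + (\<Sum>J\<in>\<K>. w J))"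
    have s: "0 \<le> (\<Sum>J\<in>\<K>. w J)" using q order_trans by blast
    then have \<theta>: "0 < \<theta>" "\<theta> * (\<Sum>J\<in>\<K>. w J) \<le> 1" by (auto simp: \<theta>_def field_simps)
    have \<theta>q: "\<theta> * ?q i \<le> 1" for i
      using q[of i] \<theta> by (meson less_imp_le mult_left_mono order_trans)
    let ?k = "\<lambda>i. ennreal (1 - \<theta> * ?q i)"
    have "dot I y v = dot I y (\<lambda>i. ?k i * v i + ennreal \<theta> * (ennreal (?q i) * v i))"
    proof (rule dot_cong)
      fix i
      have "?k i + ennreal \<theta> * ennreal (?q i) = 1"
        using \<theta> \<theta>q[of i] q[of i] by (simp add: ennreal_mult[symmetric] ennreal_plus[symmetric] del: ennreal_plus)
      then show "y i * v i = y i * (?k i * v i + ennreal \<theta> * (ennreal (?q i) * v i))"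
        by (simp add: mult.assoc[symmetric] distrib_right[symmetric])
    qed
    then have eq: "dot I y v = dot I y (\<lambda>i. ?k i * v i)
        + ennreal \<theta> * dot I y (\<lambda>i. ennreal (?q i) * v i)"
      by (simp add: dot_add_right dot_cmult_right)
    have "dot I y v \<le> dot I y (\<lambda>i. ?k i * v i + ennreal \<theta> * (col_act I R v i + a i))"
      by (intro v(2) estimates_update[OF v(1) y \<K>]) (use \<theta> in auto)
    then have "dot I y v \<le> dot I y (\<lambda>i. ?k i * v i) + ennreal \<theta> * ?b"
      by (simp add: dot_add_right dot_cmult_right)
    moreover have "dot I y (\<lambda>i. ?k i * v i) \<noteq> \<infinity>" using fin by (auto simp: eq)
    ultimately have "ennreal \<theta> * dot I y (\<lambda>i. ennreal (?q i) * v i) \<le> ennreal \<theta> * ?b"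
      unfolding eq by (simp add: ennreal_add_left_cancel_le)
    then show ?thesis using \<theta>(1) by (subst (asm) ennreal_mult_le_mult_iff) auto
  qed
  have "dot I y (\<lambda>i. W_mat \<J> w i i * v i)
      = (\<integral>\<^sup>+i. \<integral>\<^sup>+J. y i * (ennreal (w J) * indicator J i * v i) \<partial>count_space \<J> \<partial>count_space I)"
    unfolding dot_def W_eq_nn_integral
    by (intro nn_integral_cong) (simp add: nn_integral_cmult nn_integral_multc)
  also have "\<dots> = (\<integral>\<^sup>+J. dot I y (\<lambda>i. ennreal (w J) * indicator J i * v i) \<partial>count_space \<J>)"
    unfolding dot_def by (rule nn_integral_count_space_nn_integral) (use countable_blocks in auto)
  also have "\<dots> \<le> ?b"
  proof (rule nn_integral_count_space_le_finite_sums[OF countable_blocks])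
    fix \<K> assume \<K>: "finite \<K>" "\<K> \<subseteq> \<J>"
    have "(\<Sum>J\<in>\<K>. dot I y (\<lambda>i. ennreal (w J) * indicator J i * v i))
        = dot I y (\<lambda>i. \<Sum>J\<in>\<K>. ennreal (w J) * indicator J i * v i)"
      unfolding dot_def by (subst nn_integral_sum[symmetric]) (auto simp: sum_distrib_left)
    also have "\<dots> = dot I y (\<lambda>i. ennreal (\<Sum>J\<in>{J\<in>\<K>. i \<in> J}. w J) * v i)"
    proof (rule dot_cong)
      fix i
      have "(\<Sum>J\<in>\<K>. ennreal (w J) * indicator J i) = ennreal (\<Sum>J\<in>{J\<in>\<K>. i \<in> J}. w J)"
      proof -
        have "ennreal (\<Sum>J\<in>{J\<in>\<K>. i \<in> J}. w J) = (\<Sum>J\<in>{J\<in>\<K>. i \<in> J}. ennreal (w J))"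
          using \<K> weight_nonneg by (intro sum_ennreal[symmetric]) auto
        also have "\<dots> = (\<Sum>J\<in>\<K>. if i \<in> J then ennreal (w J) else 0)"
          using \<K>(1) by (rule sum.inter_filter)
        also have "\<dots> = (\<Sum>J\<in>\<K>. ennreal (w J) * indicator J i)"
          by (intro sum.cong) (auto simp: indicator_def)
        finally show ?thesis by simp
      qed
      then show "y i * (\<Sum>J\<in>\<K>. ennreal (w J) * indicator J i * v i)
          = y i * (ennreal (\<Sum>J\<in>{J\<in>\<K>. i \<in> J}. w J) * v i)"
        by (simp add: sum_distrib_right[symmetric])
    qed
    also have "\<dots> \<le> ?b" by (rule partial[OF \<K>])
    finally show "(\<Sum>J\<in>\<K>. dot I y (\<lambda>i. ennreal (w J) * indicator J i * v i)) \<le> ?b" .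
  qed
  finally have W: "dot I y (\<lambda>i. W_mat \<J> w i i * v i) \<le> ?b" .
  have "dot I y v = dot I y (\<lambda>i. (1 - W_mat \<J> w i i) * v i + W_mat \<J> w i i * v i)"
  proof (rule dot_cong)
    fix i assume "i \<in> I"
    then have "(1 - W_mat \<J> w i i) + W_mat \<J> w i i = 1"
      using site_weight_le_1 by (intro diff_add_cancel_ennreal) auto
    then show "y i * v i = y i * ((1 - W_mat \<J> w i i) * v i + W_mat \<J> w i i * v i)"
      by (simp add: distrib_right[symmetric])
  qed
  also have "\<dots> \<le> dot I y (\<lambda>i. (1 - W_mat \<J> w i i) * v i) + ?b"
    using W by (simp add: dot_add_right add_left_mono)
  also have "\<dots> = dot I y (\<lambda>i. (1 - W_mat \<J> w i i) * v i + col_act I R v i) + dot I y a"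
    by (simp add: dot_add_right add.assoc)
  also have "dot I y (\<lambda>i. (1 - W_mat \<J> w i i) * v i + col_act I R v i) = dot I y (col_act I B v)"
    by (intro dot_cong) (simp add: col_act_B)
  finally show ?thesis .
qed

text \<open>
  For the minimizer \<open>v\<close> and \<open>b = \<langle>y, B v\<rangle>\<close>, the balance inequality and \<open>y = x + r y B\<close> read
  \<open>\<langle>x, v\<rangle> + r b \<le> b + \<langle>y, a\<rangle>\<close>. Since \<open>r b \<le> \<langle>y, v\<rangle> \<le> \<langle>y, u'\<rangle>\<close>, the term \<open>(1 - r) b\<close> is small when
  \<open>\<langle>y, u'\<rangle>\<close> grows more slowly than \<open>1/(1 - r)\<close>.
\<close>

lemma resolvent_bound:
  assumes r: "0 < r" "r < 1"
    and u': "u' \<in> estimates (discounted r x)" "dot I (discounted r x) u' < \<infinity>"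
    and f: "f \<in> F" "\<And>i. i \<in> I \<Longrightarrow> \<delta> f i \<le> x i"
  shows "err f \<le> ennreal ((1 - r) / r) * dot I (discounted r x) u' + dot I x S"
proof -
  let ?y = "discounted r x"
  have unfold: "?y i = x i + ennreal r * row_act I ?y B i" for i
    by (rule discounted_unfold[OF r(1)])
  have y_B: "row_act I ?y B i \<le> ennreal (1 / r) * ?y i" for i
  proof -
    have "row_act I ?y B i = ennreal (1 / r) * (ennreal r * row_act I ?y B i)"
      using r by (simp add: mult.assoc[symmetric] ennreal_mult[symmetric])
    also have "\<dots> \<le> ennreal (1 / r) * (x i + ennreal r * row_act I ?y B i)"
      by (intro mult_left_mono) auto
    finally show ?thesis by (simp only: unfold[symmetric])
  qed
  obtain v where v: "v \<in> estimates ?y" "dot I ?y v \<le> dot I ?y u'"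
    "\<And>v'. v' \<in> estimates ?y \<Longrightarrow> dot I ?y v \<le> dot I ?y v'"
    using estimates_minimizer[OF u'] by blast
  have fin: "dot I ?y v < \<infinity>" using v(2) u'(2) by (rule le_less_trans)
  let ?b = "dot I ?y (col_act I B v)"
  have balance: "dot I ?y v \<le> ?b + dot I ?y a"
    by (rule minimizer_balance[OF v(1,3) fin, of "ennreal (1 / r)"]) (use y_B in auto)
  have split: "dot I ?y v = dot I x v + ennreal r * ?b"
  proof -
    have "dot I ?y v = dot I (\<lambda>i. x i + ennreal r * row_act I ?y B i) v"
      using unfold by (intro dot_cong) metis
    also have "\<dots> = dot I x v + ennreal r * ?b"
      by (simp add: dot_add_left dot_cmult_left dot_row_act[OF countable_sites])
    finally show ?thesis .
  qed
  have rb: "ennreal r * ?b \<le> dot I ?y v" by (simp add: split)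
  then have b: "?b \<le> ennreal (1 / r) * dot I ?y v"
  proof -
    have "?b = ennreal (1 / r) * (ennreal r * ?b)"
      using r by (simp add: mult.assoc[symmetric] ennreal_mult[symmetric])
    also have "\<dots> \<le> ennreal (1 / r) * dot I ?y v" using rb by (intro mult_left_mono) auto
    finally show ?thesis .
  qed
  have "?b = ennreal r * ?b + ennreal (1 - r) * ?b"
    using r by (simp add: distrib_right[symmetric] ennreal_plus[symmetric] del: ennreal_plus)
  then have "ennreal r * ?b + dot I x v \<le> ennreal r * ?b + (ennreal (1 - r) * ?b + dot I ?y a)"
    using balance unfolding split by (simp add: ac_simps)
  moreover have "ennreal r * ?b \<noteq> \<infinity>" using rb fin by (auto simp: top_unique)
  ultimately have "dot I x v \<le> ennreal (1 - r) * ?b + dot I ?y a"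
    by (simp add: ennreal_add_left_cancel_le)
  also have "ennreal (1 - r) * ?b \<le> ennreal (1 - r) * (ennreal (1 / r) * dot I ?y u')"
    using b v(2) by (intro mult_left_mono order_trans[OF b]) auto
  also have "\<dots> = ennreal ((1 - r) / r) * dot I ?y u'"
    using r by (simp add: mult.assoc[symmetric] ennreal_mult[symmetric])
  also have "dot I ?y a \<le> dot I x S"
  proof -
    have "dot I ?y a \<le> (\<Sum>k. dot I (row_pow I B k x) a)"
      unfolding dot_discounted
    proof (intro suminf_le allI)
      fix k
      have "ennreal (r ^ k) \<le> 1" using r by (simp add: power_le_one)
      then show "ennreal (r ^ k) * dot I (row_pow I B k x) a \<le> dot I (row_pow I B k x) a"
        using mult_right_mono[of "ennreal (r ^ k)" 1 "dot I (row_pow I B k x) a"] by simp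
    qed auto
    then show ?thesis by (simp add: dot_S dot_row_pow[OF countable_sites])
  qed
  finally have v_le: "dot I x v \<le> ennreal ((1 - r) / r) * dot I ?y u' + dot I x S"
    by (simp add: add_mono)
  have "admissible ?y f" unfolding admissible_def
  proof (intro exI[of _ 1] conjI ballI)
    fix i assume "i \<in> I"
    have "x i \<le> ?y i" by (subst unfold) simp
    with f(2)[OF \<open>i \<in> I\<close>] show "\<delta> f i \<le> 1 * ?y i" by simp
  qed simp
  then have "err f \<le> dot I (\<delta> f) v" using v(1) f(1) by (auto simp: estimates_def)
  also have "\<dots> \<le> dot I x v" using f(2) by (intro dot_mono) auto
  finally show ?thesis using v_le by (rule order_trans)
qed

lemma err_le_dot_S_of_estimates:
  assumes u': "\<And>r. 0 < r \<Longrightarrow> r < 1 \<Longrightarrow> u' \<in> estimates (discounted r x)"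
    and fin: "\<And>k. dot I (row_pow I B k x) u' < \<infinity>"
    and lim: "(\<lambda>k. dot I (row_pow I B k x) u') \<longlonglongrightarrow> 0"
    and f: "f \<in> F" "\<And>i. i \<in> I \<Longrightarrow> \<delta> f i \<le> x i"
  shows "err f \<le> dot I x S"
proof (rule ennreal_le_epsilon)
  fix \<epsilon> :: real assume "0 < \<epsilon>"
  then obtain r where r: "0 < r" "r < 1"
    "(\<Sum>k. ennreal (r ^ k) * dot I (row_pow I B k x) u') < \<infinity>"
    "ennreal ((1 - r) / r) * (\<Sum>k. ennreal (r ^ k) * dot I (row_pow I B k x) u') \<le> ennreal \<epsilon>"
    using abel_mean_small[OF fin lim] by blast
  have "err f \<le> ennreal ((1 - r) / r) * dot I (discounted r x) u' + dot I x S"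
    using r by (intro resolvent_bound u' f) (auto simp: dot_discounted)
  also have "\<dots> \<le> ennreal \<epsilon> + dot I x S"
    using r(4) by (intro add_right_mono) (simp add: dot_discounted)
  finally show "err f \<le> dot I x S + ennreal \<epsilon>" by (simp add: add.commute)
qed

text \<open>
  Think of \<open>x\<close> as masses at the sites, which \<open>B\<close> moves to other sites. Then \<open>offspring N x\<close> collects
  the masses that have made between 1 and \<open>N\<close> moves.
\<close>

definition offspring :: "nat \<Rightarrow> ('i \<Rightarrow> ennreal) \<Rightarrow> 'i \<Rightarrow> ennreal" where
  "offspring N x j = (\<Sum>k<N. row_pow I B (Suc k) x j)"

lemma dot_offspring: "dot I (offspring N x) v = (\<Sum>k<N. dot I x (col_pow I B (Suc k) v))"
  unfolding offspring_def by (simp add: dot_sum_left dot_row_pow[OF countable_sites])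

lemma dot_offspring_S_le: "dot I (offspring N x) S \<le> of_nat N * dot I x S"
proof -
  have "dot I (offspring N x) S = (\<Sum>k<N. dot I (row_pow I B (Suc k) x) S)"
    unfolding offspring_def by (rule dot_sum_left)
  also have "\<dots> \<le> (\<Sum>k<N. dot I x S)" by (intro sum_mono dot_row_pow_S_le)
  finally show ?thesis by simp
qed

lemma offspring_mono_left: "M \<le> N \<Longrightarrow> offspring M x j \<le> offspring N x j"
  unfolding offspring_def by (intro sum_mono2) auto

lemma row_act_le_offspring: "row_act I x B j \<le> offspring (Suc N) x j"
  using offspring_mono_left[of 1 "Suc N" x j] by (simp add: offspring_def row_pow_Suc)

lemma row_act_offspring_le: "row_act I (offspring N x) B j \<le> offspring (Suc N) x j"
proof -
  have "row_act I (offspring N x) B j = (\<Sum>k<N. row_pow I B (Suc (Suc k)) x j)"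
    unfolding row_act_eq_dot offspring_def by (simp add: dot_sum_left row_pow_Suc[of _ _ "Suc _"] row_act_eq_dot)
  also have "\<dots> \<le> offspring (Suc N) x j"
    unfolding offspring_def by (subst sum.lessThan_Suc_shift) simp
  finally show ?thesis .
qed

text \<open>
  Updating a single block \<open>J\<close> with weight 1, that is with \<open>\<theta> = 1/w\<^sub>J\<close>, erases the oscillation in
  \<open>J\<close> and passes it on through \<open>\<theta>R \<le> \<theta>B\<close>. Doing this for one block at each site of \<open>K\<close> leaves in \<open>K\<close>
  only oscillation that has moved. Since \<open>\<langle>x B, S\<rangle> \<le> \<langle>x, S\<rangle>\<close>, the cost is controlled by \<open>\<langle>\<delta> f, S\<rangle>\<close>.
  The constant \<open>C\<close> may be large, because updating blocks one after another does not respect the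
  proportions \<open>w\<close>; what matters is that it does not depend on \<open>f\<close>.
\<close>

lemma fire_sites:
  assumes "finite K" "K \<subseteq> I"
  shows "\<exists>C N. 0 \<le> C \<and> (\<forall>f\<in>F. \<exists>g\<in>F.
    (\<forall>j\<in>I. \<delta> g j \<le> (if j \<in> K then 0 else \<delta> f j) + ennreal C * offspring N (\<delta> f) j) \<and>
    err f \<le> err g + ennreal C * dot I (\<delta> f) S)"
  using assms
proof (induction K rule: finite_induct)
  case empty
  show ?case by (intro exI[of _ 0]) auto
next
  case (insert i K)
  then obtain C N where C: "0 \<le> C" and CN: "\<forall>f\<in>F. \<exists>g\<in>F.
    (\<forall>j\<in>I. \<delta> g j \<le> (if j \<in> K then 0 else \<delta> f j) + ennreal C * offspring N (\<delta> f) j) \<and>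
    err f \<le> err g + ennreal C * dot I (\<delta> f) S"
    by auto
  obtain J where J: "J \<in> \<J>" "i \<in> J"
    using cover insert.prems by (auto simp: finite_cover_def)
  define \<theta> where "\<theta> = 1 / w J"
  have \<theta>: "0 < \<theta>" "\<theta> * w J = 1" using weight_pos[OF J(1)] by (auto simp: \<theta>_def)
  \<comment> \<open>The second term accounts for the oscillation passed on by \<open>J\<close>, the third for the cost.\<close>
  define C' where "C' = C + \<theta> * (1 + C) + \<theta> * (1 + C * real N)"
  have C': "0 \<le> C'" "C + \<theta> * (1 + C) \<le> C'" "\<theta> * (1 + C * real N) + C \<le> C'"
    using C \<theta> by (auto simp: C'_def intro!: add_nonneg_nonneg)
  show ?case
  proof (intro exI[of _ C'] exI[of _ "Suc N"] conjI ballI C'(1))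
    fix f assume f: "f \<in> F"
    let ?x = "\<delta> f" and ?D = "dot I (\<delta> f) S"
    obtain g where g: "g \<in> F"
      and g_le: "\<And>j. j \<in> I \<Longrightarrow> \<delta> g j \<le> (if j \<in> K then 0 else ?x j) + ennreal C * offspring N ?x j"
      and err_f: "err f \<le> err g + ennreal C * ?D"
      using CN f by blast
    obtain h where h: "h \<in> F"
      and h_le: "\<And>j. j \<in> I \<Longrightarrow> \<delta> h j \<le> ennreal (1 - \<theta> * (\<Sum>J\<in>{J'\<in>{J}. j \<in> J'}. w J)) * \<delta> g j
                            + ennreal \<theta> * row_act I (\<delta> g) R j"
      and err_g: "err g \<le> err h + ennreal \<theta> * dot I (\<delta> g) a"
      using update[OF g, of "{J}" \<theta>] J \<theta> by auto
    have g_le': "\<delta> g j \<le> ?x j + ennreal C * offspring N ?x j" if "j \<in> I" for j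
      using g_le[OF that] by (rule order_trans) (auto intro: add_right_mono)
    show "\<exists>g\<in>F. (\<forall>j\<in>I. \<delta> g j \<le> (if j \<in> insert i K then 0 else \<delta> f j)
              + ennreal C' * offspring (Suc N) (\<delta> f) j) \<and> err f \<le> err g + ennreal C' * ?D"
    proof (intro bexI[of _ h] conjI ballI h)
      fix j assume j: "j \<in> I"
      let ?T = "offspring (Suc N) ?x j"
      have "row_act I (\<delta> g) R j \<le> dot I (\<lambda>i. ?x i + ennreal C * offspring N ?x i) (\<lambda>i. B i j)"
        unfolding row_act_eq_dot using g_le' R_le_B by (intro dot_mono) auto
      also have "\<dots> = row_act I ?x B j + ennreal C * row_act I (offspring N ?x) B j"
        by (simp add: dot_add_left dot_cmult_left row_act_eq_dot)
      also have "\<dots> \<le> ?T + ennreal C * ?T"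
        by (intro add_mono mult_left_mono row_act_le_offspring row_act_offspring_le) auto
      also have "\<dots> = ennreal (1 + C) * ?T"
        using C by (simp add: distrib_right ennreal_plus)
      finally have R_le: "row_act I (\<delta> g) R j \<le> ennreal (1 + C) * ?T" .
      have "ennreal (1 - \<theta> * (\<Sum>J\<in>{J'\<in>{J}. j \<in> J'}. w J)) * \<delta> g j \<le> (if j \<in> J then 0 else \<delta> g j)"
      proof (cases "j \<in> J")
        case True
        then have "{J'\<in>{J}. j \<in> J'} = {J}" by auto
        then show ?thesis using True \<theta> by simp
      next
        case False
        then have "{J'\<in>{J}. j \<in> J'} = {}" by auto
        then show ?thesis using False by (simp only:) simp
      qed
      also have "\<dots> \<le> (if j \<in> insert i K then 0 else ?x j) + ennreal C * ?T"
        using g_le[OF j] J(2) offspring_mono_left[of N "Suc N" ?x j]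
        by (auto intro!: order_trans[OF g_le[OF j]] add_mono mult_left_mono)
      finally have "\<delta> h j \<le> ((if j \<in> insert i K then 0 else ?x j) + ennreal C * ?T)
          + ennreal \<theta> * (ennreal (1 + C) * ?T)"
        using h_le[OF j] R_le by (meson add_mono mult_left_mono order_trans zero_le)
      also have "\<dots> = (if j \<in> insert i K then 0 else ?x j) + ennreal (C + \<theta> * (1 + C)) * ?T"
        using C \<theta> by (simp add: ennreal_plus ennreal_mult distrib_right mult.assoc add.assoc)
      also have "\<dots> \<le> (if j \<in> insert i K then 0 else ?x j) + ennreal C' * ?T"
        using C' by (intro add_left_mono mult_right_mono ennreal_leI) auto
      finally show "\<delta> h j \<le> (if j \<in> insert i K then 0 else ?x j) + ennreal C' * ?T" .
    next
      have "dot I (\<delta> g) a \<le> dot I (\<delta> g) S" by (rule dot_a_le_dot_S)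
      also have "\<dots> \<le> dot I (\<lambda>j. ?x j + ennreal C * offspring N ?x j) S"
        using g_le' by (intro dot_mono) auto
      also have "\<dots> \<le> ?D + ennreal C * (of_nat N * ?D)"
        unfolding dot_add_left dot_cmult_left
        by (intro add_left_mono mult_left_mono dot_offspring_S_le) auto
      also have "\<dots> = ennreal (1 + C * real N) * ?D"
        using C by (simp add: ennreal_plus ennreal_mult distrib_right mult.assoc ennreal_of_nat_eq_real_of_nat)
      finally have "err f \<le> err h + ennreal \<theta> * (ennreal (1 + C * real N) * ?D) + ennreal C * ?D"
        using err_f err_g by (meson add_mono mult_left_mono order_refl order_trans zero_le)
      also have "\<dots> = err h + ennreal (\<theta> * (1 + C * real N) + C) * ?D"
        using C \<theta> by (simp add: ennreal_plus ennreal_mult distrib_right mult.assoc add.assoc)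
      also have "\<dots> \<le> err h + ennreal C' * ?D"
        using C' by (intro add_left_mono mult_right_mono ennreal_leI) auto
      finally show "err f \<le> err h + ennreal C' * ?D" .
    qed
  qed
qed


text \<open>
  Induction on an index from which \<open>\<langle>x, B\<^sup>k u\<rangle>\<close> is finite. In the step, \<open>x'\<close> is the part of \<open>x\<close>
  in a finite set \<open>L\<close> and \<open>y\<close> its resolvent row. Firing the sites of \<open>L\<close> turns any \<open>h\<close> that is
  admissible for \<open>y\<close> into a \<open>g\<close> whose oscillations are bounded by a multiple of
  \<open>offspring (N + 1) y\<close>: outside \<open>L\<close> the row \<open>x'\<close> vanishes, so there \<open>y = r y B\<close>. One move by \<open>B\<close> lowers
  the index by one, and the induction hypothesis bounds \<open>err g\<close>. Hence a multiple of \<open>S\<close> is an estimate.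
\<close>

lemma err_le_dot_S_level:
  assumes fin: "\<And>k. l \<le> k \<Longrightarrow> dot I x (col_pow I B k u) < \<infinity>"
    and lim: "(\<lambda>k. dot I x (col_pow I B k u)) \<longlonglongrightarrow> 0"
    and S: "dot I x S < \<infinity>"
    and f: "f \<in> F" "\<And>i. i \<in> I \<Longrightarrow> \<delta> f i \<le> x i"
  shows "err f \<le> dot I x S"
  using assms
proof (induction l arbitrary: x f)
  case 0
  show ?case
  proof (rule err_le_dot_S_of_estimates[where u' = u])
    show "u \<in> estimates (discounted r x)" for r
      using err_le_dot by (auto simp: estimates_def)
  qed (use 0 in \<open>auto simp: dot_row_pow[OF countable_sites]\<close>)
next
  case (Suc l)
  show ?case
  proof (rule ennreal_le_epsilon)
    fix \<epsilon> :: real assume "0 < \<epsilon>"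
    then obtain L g0 where L: "finite L" "L \<subseteq> I" and g0: "g0 \<in> F"
      "\<And>i. i \<in> I \<Longrightarrow> \<delta> g0 i \<le> (if i \<in> L then \<delta> f i else 0)" and err_f: "err f \<le> err g0 + ennreal \<epsilon>"
      using localize[OF Suc.prems(4)] by metis
    define x' where "x' i = (if i \<in> L then x i else 0)" for i
    define e where "e k = dot I x' (col_pow I B k u)" for k
    have x': "dot I x' v \<le> dot I x v" for v
      by (intro dot_mono) (auto simp: x'_def)
    have e_fin: "e k < \<infinity>" if "Suc l \<le> k" for k
      using x' Suc.prems(1)[OF that] unfolding e_def by (rule le_less_trans)
    have e_lim: "e \<longlonglongrightarrow> 0"
      by (rule tendsto_sandwich[OF _ _ tendsto_const Suc.prems(2)]) (auto simp: e_def x')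
    have S': "dot I x' S < \<infinity>" using x' Suc.prems(3) by (rule le_less_trans)
    obtain C N where C: "0 \<le> C" and fire: "\<forall>f\<in>F. \<exists>g\<in>F.
      (\<forall>j\<in>I. \<delta> g j \<le> (if j \<in> L then 0 else \<delta> f j) + ennreal C * offspring N (\<delta> f) j) \<and>
      err f \<le> err g + ennreal C * dot I (\<delta> f) S"
      using fire_sites[OF L] by blast
    \<comment> \<open>\<open>1 + C N\<close> from the induction hypothesis for the fired function, \<open>C\<close> from the cost of firing.\<close>
    define C' where "C' = 1 + ennreal C * of_nat N + ennreal C"
    have C': "C' < \<infinity>" by (simp add: C'_def ennreal_mult_less_top of_nat_less_top)
    have "err g0 \<le> dot I x' S"
    proof (rule err_le_dot_S_of_estimates[where u' = "\<lambda>i. C' * S i"])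
      fix r :: real assume r: "0 < r" "r < 1"
      let ?y = "discounted r x'"
      have y_S: "dot I ?y S < \<infinity>"
      proof -
        have "dot I ?y S \<le> ennreal (enn2real (dot I x' S) / (1 - r))"
          unfolding dot_discounted using S' dot_row_pow_S_le[of _ x']
          by (intro suminf_discounted_le[OF r]) auto
        then show ?thesis by (rule le_less_trans) simp
      qed
      have y_u: "dot I ?y (col_pow I B m u) = (\<Sum>k. ennreal (r ^ k) * e (k + m))" for m
        by (simp add: dot_discounted dot_row_pow[OF countable_sites] col_pow_add e_def)
      have y_u_lim: "(\<lambda>m. dot I ?y (col_pow I B m u)) \<longlonglongrightarrow> 0"
        unfolding y_u by (rule discounted_tail_tendsto_0[OF r e_lim])
      have y_u_fin: "dot I ?y (col_pow I B m u) < \<infinity>" if m: "Suc l \<le> m" for m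
      proof -
        obtain D where D: "0 \<le> D" "\<And>k. Suc l \<le> k \<Longrightarrow> e k \<le> ennreal D"
          using eventually_finite_bound[OF e_fin e_lim] by blast
        have "dot I ?y (col_pow I B m u) \<le> ennreal (D / (1 - r))"
          unfolding y_u using D m by (intro suminf_discounted_le[OF r]) auto
        then show ?thesis by (rule le_less_trans) simp
      qed
      show "(\<lambda>i. C' * S i) \<in> estimates ?y"
        unfolding estimates_def
      proof safe
        fix h assume h: "h \<in> F" "admissible ?y h"
        then obtain c where c: "c < \<infinity>" "\<And>i. i \<in> I \<Longrightarrow> \<delta> h i \<le> c * ?y i"
          by (auto simp: admissible_def)
        obtain g where g: "g \<in> F"
          "\<And>j. j \<in> I \<Longrightarrow> \<delta> g j \<le> (if j \<in> L then 0 else \<delta> h j) + ennreal C * offspring N (\<delta> h) j"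
          and err_h: "err h \<le> err g + ennreal C * dot I (\<delta> h) S"
          using fire h(1) by blast
        define z where "z j = (if j \<in> L then 0 else \<delta> h j) + ennreal C * offspring N (\<delta> h) j" for j
        define D where "D = c + ennreal C * c"
        have D: "D < \<infinity>" using c(1) by (simp add: D_def ennreal_mult_less_top)
        have z_le: "z j \<le> D * offspring (Suc N) ?y j" if j: "j \<in> I" for j
        proof -
          have "(if j \<in> L then 0 else \<delta> h j) \<le> c * offspring (Suc N) ?y j"
          proof (cases "j \<in> L")
            case False
            have "?y j = ennreal r * row_act I ?y B j"
              using False by (subst discounted_unfold[OF r(1)]) (simp add: x'_def)
            also have "\<dots> \<le> 1 * offspring (Suc N) ?y j"
              using r by (intro mult_mono row_act_le_offspring) auto
            finally have "c * ?y j \<le> c * offspring (Suc N) ?y j"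
              by (intro mult_left_mono) simp_all
            with c(2)[OF j] have "\<delta> h j \<le> c * offspring (Suc N) ?y j"
              by (rule order_trans)
            then show ?thesis by (simp only: False if_False)
          qed simp
          moreover have "offspring N (\<delta> h) j \<le> c * offspring (Suc N) ?y j"
          proof -
            have "offspring N (\<delta> h) j \<le> offspring N (\<lambda>i. c * ?y i) j"
              unfolding offspring_def using c(2) j by (intro sum_mono row_pow_mono)
            also have "\<dots> = c * offspring N ?y j"
              by (simp add: offspring_def row_pow_cmult sum_distrib_left)
            also have "\<dots> \<le> c * offspring (Suc N) ?y j"
              by (intro mult_left_mono offspring_mono_left) auto
            finally show ?thesis .
          qed
          ultimately have "z j \<le> c * offspring (Suc N) ?y j + ennreal C * (c * offspring (Suc N) ?y j)"
            unfolding z_def by (intro add_mono mult_left_mono) auto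
          then show ?thesis by (simp add: D_def distrib_right mult.assoc)
        qed
        have dot_z: "dot I z v \<le> D * dot I (offspring (Suc N) ?y) v" for v
          unfolding dot_cmult_left[symmetric] using z_le by (intro dot_mono) auto
        have o_u: "dot I (offspring (Suc N) ?y) (col_pow I B m u)
            = (\<Sum>k<Suc N. dot I ?y (col_pow I B (Suc k + m) u))" for m
          unfolding dot_offspring by (simp only: col_pow_add)
        have "err g \<le> dot I z S"
        proof (rule Suc.IH[OF _ _ _ g(1)])
          show "dot I z (col_pow I B m u) < \<infinity>" if "l \<le> m" for m
          proof (rule le_less_trans[OF dot_z])
            have "dot I (offspring (Suc N) ?y) (col_pow I B m u) < \<infinity>"
              unfolding o_u infinity_ennreal_def
              using y_u_fin[unfolded infinity_ennreal_def] that
              by (subst ennreal_sum_less_top) auto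
            then show "D * dot I (offspring (Suc N) ?y) (col_pow I B m u) < \<infinity>"
              using D by (simp add: ennreal_mult_less_top)
          qed
          have "(\<lambda>m. dot I (offspring (Suc N) ?y) (col_pow I B m u)) \<longlonglongrightarrow> (\<Sum>k<Suc N. 0)"
            unfolding o_u
          proof (rule tendsto_sum)
            show "(\<lambda>m. dot I ?y (col_pow I B (Suc k + m) u)) \<longlonglongrightarrow> 0" for k
              using LIMSEQ_ignore_initial_segment[OF y_u_lim, of "Suc k"]
              by (simp only: add.commute[of _ "Suc k"])
          qed
          then have "(\<lambda>m. D * dot I (offspring (Suc N) ?y) (col_pow I B m u)) \<longlonglongrightarrow> D * 0"
            using D by (intro ennreal_tendsto_cmult) auto
          then have bound_lim: "(\<lambda>m. D * dot I (offspring (Suc N) ?y) (col_pow I B m u)) \<longlonglongrightarrow> 0"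
            by (simp only: mult_zero_right)
          show "(\<lambda>m. dot I z (col_pow I B m u)) \<longlonglongrightarrow> 0"
            by (rule tendsto_sandwich[OF _ _ tendsto_const bound_lim])
               (auto simp only: zero_le dot_z intro!: always_eventually)
          have "dot I (offspring (Suc N) ?y) S < \<infinity>"
            using y_S by (intro le_less_trans[OF dot_offspring_S_le])
              (simp add: ennreal_mult_less_top of_nat_less_top del: of_nat_Suc)
          then show "dot I z S < \<infinity>"
            using D by (intro le_less_trans[OF dot_z]) (simp add: ennreal_mult_less_top)
          show "\<delta> g i \<le> z i" if "i \<in> I" for i using g(2)[OF that] by (simp add: z_def)
        qed
        also have "\<dots> \<le> dot I (\<delta> h) S + ennreal C * (of_nat N * dot I (\<delta> h) S)"
        proof -
          have "dot I z S \<le> dot I (\<lambda>j. \<delta> h j + ennreal C * offspring N (\<delta> h) j) S"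
            unfolding z_def by (intro dot_mono add_right_mono) auto
          also have "\<dots> \<le> dot I (\<delta> h) S + ennreal C * (of_nat N * dot I (\<delta> h) S)"
            unfolding dot_add_left dot_cmult_left
            by (intro add_left_mono mult_left_mono dot_offspring_S_le) auto
          finally show ?thesis .
        qed
        finally have "err h \<le> dot I (\<delta> h) S + ennreal C * (of_nat N * dot I (\<delta> h) S)
            + ennreal C * dot I (\<delta> h) S"
          using err_h by (meson add_right_mono order_trans)
        also have "\<dots> = C' * dot I (\<delta> h) S"
          by (simp add: C'_def distrib_right mult.assoc)
        finally show "err h \<le> dot I (\<delta> h) (\<lambda>i. C' * S i)" by (simp add: dot_cmult_right)
      qed
    next
      show "dot I (row_pow I B k x') (\<lambda>i. C' * S i) < \<infinity>" for k
        using C' le_less_trans[OF dot_row_pow_S_le S'] by (simp add: dot_cmult_right ennreal_mult_less_top)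
      have "(\<lambda>k. C' * dot I (row_pow I B k x') S) \<longlonglongrightarrow> C' * 0"
        using C' by (intro ennreal_tendsto_cmult dot_row_pow_S_tendsto_0 S') auto
      then show "(\<lambda>k. dot I (row_pow I B k x') (\<lambda>i. C' * S i)) \<longlonglongrightarrow> 0"
        by (simp add: dot_cmult_right)
      show "\<delta> g0 i \<le> x' i" if "i \<in> I" for i
        using g0(2)[OF that] Suc.prems(5)[OF that] by (auto simp: x'_def intro: order_trans)
    qed (rule g0)
    then show "err f \<le> dot I x S + ennreal \<epsilon>"
      using err_f x'[of S] by (meson add_right_mono order_trans)
  qed
qed

text \<open>
  A function with oscillations in a finite set meets the hypotheses of the previous lemma, because a
  finite linear combination of null sequences is a null sequence, eventually finite.
\<close>

lemma err_le_dot_S: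
  assumes lim: "\<And>i. i \<in> I \<Longrightarrow> (\<lambda>k. col_pow I B k u i) \<longlonglongrightarrow> 0"
    and f: "f \<in> F" "\<And>i. i \<in> I \<Longrightarrow> \<delta> f i < \<infinity>"
  shows "err f \<le> dot I (\<delta> f) S"
proof (cases "dot I (\<delta> f) S < \<infinity>")
  case True
  show ?thesis
  proof (rule ennreal_le_epsilon)
    fix \<epsilon> :: real assume "0 < \<epsilon>"
    then obtain L g where L: "finite L" "L \<subseteq> I" and g: "g \<in> F"
      "\<And>i. i \<in> I \<Longrightarrow> \<delta> g i \<le> (if i \<in> L then \<delta> f i else 0)" and err_f: "err f \<le> err g + ennreal \<epsilon>"
      using localize[OF f(1)] by metis
    define x where "x i = (if i \<in> L then \<delta> f i else 0)" for i
    have x: "dot I x v \<le> dot I (\<delta> f) v" for v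
      by (intro dot_mono) (auto simp: x_def)
    have "dot I x v = (\<Sum>i\<in>L. \<delta> f i * v i)" for v
      using L by (subst dot_finite_support[of L]) (auto simp: x_def)
    moreover have "(\<lambda>k. \<Sum>i\<in>L. \<delta> f i * col_pow I B k u i) \<longlonglongrightarrow> (\<Sum>i\<in>L. \<delta> f i * 0)"
      using L f(2) lim by (intro tendsto_sum ennreal_tendsto_cmult) auto
    ultimately have lim_x: "(\<lambda>k. dot I x (col_pow I B k u)) \<longlonglongrightarrow> 0" by simp
    then have "\<forall>\<^sub>F k in sequentially. dot I x (col_pow I B k u) < \<infinity>"
      by (rule order_tendstoD) simp
    then obtain l where l: "\<And>k. l \<le> k \<Longrightarrow> dot I x (col_pow I B k u) < \<infinity>"
      by (auto simp: eventually_sequentially)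
    have "err g \<le> dot I x S"
      by (rule err_le_dot_S_level[OF l lim_x _ g(1)])
         (use g(2) True in \<open>auto simp: x_def intro: le_less_trans[OF x]\<close>)
    then show "err f \<le> dot I (\<delta> f) S + ennreal \<epsilon>"
      using err_f x[of S] by (meson add_right_mono order_trans)
  qed
qed (simp add: less_top[symmetric])

lemma S_le_of_fixed_point:
  assumes s: "\<And>i. i \<in> I \<Longrightarrow> s i = a i + col_act I B s i" and "i \<in> I"
  shows "S i \<le> s i"
proof -
  have partial: "(\<Sum>k<n. col_pow I B k a i) \<le> s i" if "i \<in> I" for n i
    using that
  proof (induction n arbitrary: i)
    case (Suc n)
    have "(\<Sum>k<Suc n. col_pow I B k a i) = a i + (\<Sum>k<n. col_act I B (col_pow I B k a) i)"
      by (subst sum.lessThan_Suc_shift) (simp add: col_pow_Suc)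
    also have "(\<Sum>k<n. col_act I B (col_pow I B k a) i) = col_act I B (\<lambda>j. \<Sum>k<n. col_pow I B k a j) i"
      unfolding col_act_def by (subst nn_integral_sum[symmetric]) (auto simp: sum_distrib_left)
    also have "\<dots> \<le> col_act I B s i" using Suc.IH by (intro col_act_mono)
    finally show ?case using s[OF Suc.prems] by (simp add: add_left_mono)
  qed simp
  show ?thesis unfolding S_def
    by (rule suminf_le_const) (use partial[OF assms(2)] in auto)
qed

lemma site_weight_pos: "i \<in> I \<Longrightarrow> 0 < W_mat \<J> w i i"
proof -
  assume "i \<in> I"
  then obtain J where J: "J \<in> \<J>" "i \<in> J" using cover by (auto simp: finite_cover_def)
  have "0 < ennreal (w J)" using weight_pos[OF J(1)] by simp
  also have "\<dots> \<le> W_mat \<J> w i i"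
    unfolding W_eq_nn_integral
    using nn_integral_count_space_sum_le[of "{J}" \<J> "\<lambda>J. ennreal (w J) * indicator J i"] J by simp
  finally show ?thesis .
qed

text \<open>
  \<open>s = D W\<^sup>-\<^sup>1 a\<close> satisfies \<open>s = W\<^sup>-\<^sup>1 (R s + a)\<close>, that is \<open>W s = R s + a\<close>. Adding \<open>(1 - W) s\<close> gives
  \<open>s = a + B s\<close>.
\<close>

lemma S_le_D:
  assumes "i \<in> I"
  shows "S i \<le> dot I (D_mat I (W_mat \<J> w) R i) (\<lambda>j. inverse (W_mat \<J> w j j) * a j)"
proof -
  let ?W = "\<lambda>i. W_mat \<J> w i i"
  let ?T = "mat_mult I (diag_inverse (W_mat \<J> w)) R" and ?b = "\<lambda>j. inverse (?W j) * a j"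
  let ?s = "\<lambda>i. \<Sum>n. col_pow I ?T n ?b i"
  have T: "?T i j = inverse (?W i) * R i j" if "i \<in> I" for i j
    using that unfolding mat_mult_def infsum_eq_nn_integral_count_space[OF countable_sites]
    by (subst nn_integral_count_space'[of "{i}"]) (auto simp: diag_inverse_def)
  have cancel: "?W i * (inverse (?W i) * c) = c" if "i \<in> I" for i c
  proof -
    have "?W i \<noteq> 0" "?W i \<noteq> \<top>"
      using site_weight_pos[OF that] site_weight_le_1[OF that] by (auto simp: top_unique)
    then have "?W i * inverse (?W i) = 1"
      by (metis ennreal_divide_self divide_ennreal_def less_top)
    then show ?thesis by (simp add: mult.assoc[symmetric])
  qed
  have fixed: "?s i = a i + col_act I B ?s i" if i: "i \<in> I" for i
  proof -
    have "?s i = (\<Sum>n. col_pow I ?T (Suc n) ?b i) + ?b i"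
      by (subst suminf_offset[where i=1]) auto
    also have "(\<Sum>n. col_pow I ?T (Suc n) ?b i) = col_act I ?T ?s i"
      by (simp add: col_pow_Suc col_act_eq_dot dot_suminf_right)
    also have "\<dots> = inverse (?W i) * col_act I R ?s i"
      unfolding col_act_eq_dot by (subst dot_cmult_left[symmetric], intro dot_cong) (simp add: T[OF i])
    finally have s: "?s i = inverse (?W i) * col_act I R ?s i + ?b i" .
    then have "?W i * ?s i = col_act I R ?s i + a i"
      by (simp add: distrib_left cancel[OF i])
    moreover have "(1 - ?W i) + ?W i = 1"
      using site_weight_le_1[OF i] by (intro diff_add_cancel_ennreal)
    then have "?s i = (1 - ?W i) * ?s i + ?W i * ?s i"
      by (simp add: distrib_right[symmetric])
    ultimately show ?thesis by (simp add: col_act_B[OF i] ac_simps)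
  qed
  have "S i \<le> ?s i" using fixed assms by (rule S_le_of_fixed_point)
  also have "?s i = dot I (D_mat I (W_mat \<J> w) R i) ?b"
    unfolding D_mat_def dot_suminf_left dot_mat_pow[OF countable_sites assms] ..
  finally show ?thesis .
qed

lemma err_le_dot_D:
  assumes "\<And>i. i \<in> I \<Longrightarrow> (\<lambda>n. \<Sum>\<^sub>\<infinity>j\<in>I. mat_pow I (iter_mat (W_mat \<J> w) R) n i j * u j) \<longlonglongrightarrow> 0"
    and f: "f \<in> F" "\<And>i. i \<in> I \<Longrightarrow> \<delta> f i < \<infinity>"
  shows "err f \<le> (\<Sum>\<^sub>\<infinity>(i, j)\<in>I \<times> I. \<delta> f i * D_mat I (W_mat \<J> w) R i j * inverse (W_mat \<J> w j j) * a j)"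
proof -
  let ?D = "D_mat I (W_mat \<J> w) R" and ?b = "\<lambda>j. inverse (W_mat \<J> w j j) * a j"
  have "(\<lambda>n. col_pow I B n u i) \<longlonglongrightarrow> 0" if "i \<in> I" for i
    using assms(1)[OF that]
    unfolding B_def[symmetric] infsum_eq_nn_integral_count_space[OF countable_sites] dot_def[symmetric]
      dot_mat_pow[OF countable_sites that] .
  then have "err f \<le> dot I (\<delta> f) S" by (intro err_le_dot_S f)
  also have "\<dots> \<le> dot I (\<delta> f) (\<lambda>i. dot I (?D i) ?b)"
    by (intro dot_mono S_le_D) auto
  also have "\<dots> = (\<integral>\<^sup>+i. \<integral>\<^sup>+j. \<delta> f i * ?D i j * inverse (W_mat \<J> w j j) * a j \<partial>count_space I \<partial>count_space I)"
    unfolding dot_def by (subst nn_integral_cmult[symmetric]) (auto simp: mult.assoc)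
  also have "\<dots> = (\<Sum>\<^sub>\<infinity>(i, j)\<in>I \<times> I. \<delta> f i * ?D i j * inverse (W_mat \<J> w j j) * a j)"
    using countable_sites
    by (subst infsum_eq_nn_integral_count_space) (auto simp: nn_integral_count_space_Times)
  finally show ?thesis .
qed

end

section \<open>Couplings, oscillations and localization\<close>

lemma merge_in_space_PiM:
  assumes "J \<subseteq> I" "z \<in> space (PiM J M)" "x \<in> space (PiM I M)"
  shows "merge J (I - J) (z, x) \<in> space (PiM I M)"
  using assms by (auto simp: space_PiM merge_def PiE_def Pi_def extensional_def)

lemma merge_restrict_in_space_PiM:
  assumes "z \<in> space (PiM I M)" "x \<in> space (PiM I M)"
  shows "merge J (I - J) (z, x) \<in> space (PiM I M)"
  using assms by (auto simp: space_PiM merge_def PiE_def Pi_def extensional_def)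

text \<open>
  The measurability of \<open>merge\<close> is known for configurations on \<open>I - J\<close>; restricting the second
  argument to \<open>I - J\<close> does not change the result.
\<close>

lemma measurable_merge_block:
  assumes "J \<subseteq> I"
  shows "merge J (I - J) \<in> PiM J M \<Otimes>\<^sub>M PiM I M \<rightarrow>\<^sub>M PiM I M"
proof -
  have "(\<lambda>q. merge J (I - J) (fst q, restrict (snd q) (I - J))) \<in> PiM J M \<Otimes>\<^sub>M PiM I M \<rightarrow>\<^sub>M PiM (J \<union> (I - J)) M"
    by (rule measurable_compose[OF _ measurable_merge], intro measurable_Pair measurable_fst
        measurable_compose[OF measurable_snd measurable_restrict_subset]) auto
  also have "(\<lambda>q. merge J (I - J) (fst q, restrict (snd q) (I - J))) = merge J (I - J)"
    by (auto simp: fun_eq_iff merge_def split: prod.splits)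
  also have "J \<union> (I - J) = I" using assms by auto
  finally show ?thesis .
qed

lemma bounded_measurable_bound:
  assumes "bounded_measurable N f"
  obtains C where "0 \<le> C" "\<And>x. x \<in> space N \<Longrightarrow> \<bar>f x\<bar> \<le> C"
proof -
  obtain C where C: "\<And>x. x \<in> space N \<Longrightarrow> \<bar>f x\<bar> \<le> C"
    using assms by (auto simp: bounded_measurable_def bounded_real)
  have "\<bar>f x\<bar> \<le> max 0 C" if "x \<in> space N" for x using C[OF that] by simp
  then show ?thesis by (intro that[of "max 0 C"]) auto
qed

lemma bounded_measurableI:
  assumes "f \<in> borel_measurable N" "\<And>x. x \<in> space N \<Longrightarrow> \<bar>f x\<bar> \<le> C"
  shows "bounded_measurable N f"
  using assms by (auto simp: bounded_measurable_def bounded_real)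

lemma bounded_measurable_integrable:
  assumes "bounded_measurable N f" "prob_space P" "sets P = sets N"
  shows "integrable P f"
proof -
  interpret prob_space P by fact
  obtain C where C: "\<And>x. x \<in> space N \<Longrightarrow> \<bar>f x\<bar> \<le> C"
    using bounded_measurable_bound[OF assms(1)] by blast
  have sp: "space P = space N" using assms(3) by (rule sets_eq_imp_space_eq)
  show ?thesis
    by (rule integrable_const_bound[where B=C])
       (use C sp assms in \<open>auto simp: bounded_measurable_def measurable_cong_sets[OF assms(3) refl]\<close>)
qed

lemma abs_integral_le_of_bound:
  fixes f :: "'b \<Rightarrow> real"
  assumes "prob_space P" "f \<in> borel_measurable P" "\<And>x. x \<in> space P \<Longrightarrow> \<bar>f x\<bar> \<le> C"
  shows "\<bar>\<integral>x. f x \<partial>P\<bar> \<le> C"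
proof -
  interpret prob_space P by fact
  have int: "integrable P f"
    by (rule integrable_const_bound[where B=C]) (use assms in auto)
  have "\<bar>\<integral>x. f x \<partial>P\<bar> \<le> (\<integral>x. \<bar>f x\<bar> \<partial>P)" by (rule integral_abs_bound)
  also have "\<dots> \<le> (\<integral>x. C \<partial>P)" using int assms(3) by (intro integral_mono) auto
  finally show ?thesis by (simp add: prob_space)
qed

lemma coupling_integral_diff_le:
  assumes Q: "is_coupling Q \<mu> \<nu>" and "prob_space \<mu>" "prob_space \<nu>"
    and g: "bounded_measurable \<mu> g" and h: "bounded_measurable \<nu> h"
  shows "ennreal \<bar>(\<integral>x. g x \<partial>\<mu>) - (\<integral>x. h x \<partial>\<nu>)\<bar> \<le> (\<integral>\<^sup>+(x, y). ennreal \<bar>g x - h y\<bar> \<partial>Q)"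
proof -
  have sets_Q: "sets Q = sets (\<mu> \<Otimes>\<^sub>M \<nu>)" and "prob_space Q"
    and d: "distr Q \<mu> fst = \<mu>" "distr Q \<nu> snd = \<nu>"
    using Q by (auto simp: is_coupling_def)
  have [measurable_cong]: "sets Q = sets (\<mu> \<Otimes>\<^sub>M \<nu>)" by fact
  have [measurable]: "g \<in> borel_measurable \<mu>" "h \<in> borel_measurable \<nu>"
    using g h by (auto simp: bounded_measurable_def)
  have fs: "fst \<in> Q \<rightarrow>\<^sub>M \<mu>" "snd \<in> Q \<rightarrow>\<^sub>M \<nu>" by measurable
  have "integrable (distr Q \<mu> fst) g" "integrable (distr Q \<nu> snd) h"
    unfolding d using bounded_measurable_integrable[OF g] bounded_measurable_integrable[OF h] assms by auto
  then have int: "integrable Q (\<lambda>q. g (fst q))" "integrable Q (\<lambda>q. h (snd q))"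
    by (auto simp: integrable_distr_eq fs)
  have "(\<integral>x. g x \<partial>\<mu>) = (\<integral>q. g (fst q) \<partial>Q)"
    using integral_distr[OF fs(1), of g] by (simp add: d)
  moreover have "(\<integral>x. h x \<partial>\<nu>) = (\<integral>q. h (snd q) \<partial>Q)"
    using integral_distr[OF fs(2), of h] by (simp add: d)
  ultimately have "(\<integral>x. g x \<partial>\<mu>) - (\<integral>x. h x \<partial>\<nu>) = (\<integral>q. g (fst q) - h (snd q) \<partial>Q)"
    using int by simp
  also have "ennreal (norm \<dots>) \<le> (\<integral>\<^sup>+q. ennreal (norm (g (fst q) - h (snd q))) \<partial>Q)"
    using int by (intro integral_norm_bound_ennreal) auto
  finally show ?thesis by (simp add: split_beta')
qed

lemma is_coupling_pair_measure:
  assumes "prob_space \<mu>" "prob_space \<nu>"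
  shows "is_coupling (\<mu> \<Otimes>\<^sub>M \<nu>) \<mu> \<nu>"
proof -
  interpret \<mu>: prob_space \<mu> by fact
  interpret \<nu>: prob_space \<nu> by fact
  interpret pair_prob_space \<mu> \<nu> ..
  have "distr (\<mu> \<Otimes>\<^sub>M \<nu>) \<nu> snd = \<nu>"
  proof (rule measure_eqI)
    fix A assume "A \<in> sets (distr (\<mu> \<Otimes>\<^sub>M \<nu>) \<nu> snd)"
    then have A: "A \<in> sets \<nu>" by simp
    have "emeasure (distr (\<mu> \<Otimes>\<^sub>M \<nu>) \<nu> snd) A = emeasure (\<mu> \<Otimes>\<^sub>M \<nu>) (space \<mu> \<times> A)"
      using A sets.sets_into_space[OF A]
      by (subst emeasure_distr) (auto simp: space_pair_measure intro!: arg_cong2[where f=emeasure])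
    also have "\<dots> = emeasure \<nu> A"
      using A by (subst \<nu>.emeasure_pair_measure_Times) (auto simp: \<mu>.emeasure_space_1)
    finally show "emeasure (distr (\<mu> \<Otimes>\<^sub>M \<nu>) \<nu> snd) A = emeasure \<nu> A" .
  qed simp
  then show ?thesis
    using \<nu>.distr_pair_fst[of \<mu>] prob_space_axioms by (auto simp: is_coupling_def)
qed

lemma differ_only_at_agree:
  assumes "(x, z) \<in> differ_only_at I M j" "i \<in> I - {j}"
  shows "x i = z i"
proof -
  have "restrict x (I - {j}) i = restrict z (I - {j}) i"
    using assms(1) by (simp add: differ_only_at_def)
  then show ?thesis using assms(2) by simp
qed

lemma delta_ge:
  assumes "Metric_space (space (M i)) (\<eta> i)" "i \<in> I" "(x, z) \<in> differ_only_at I M i"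
  shows "ennreal \<bar>f x - f z\<bar> \<le> delta I M \<eta> i f * ennreal (\<eta> i (x i) (z i))"
proof -
  interpret Metric_space "space (M i)" "\<eta> i" by fact
  have "x i \<in> space (M i)" "z i \<in> space (M i)" "x i \<noteq> z i"
    using assms(2,3) by (auto simp: differ_only_at_def space_PiM)
  then have pos: "0 < \<eta> i (x i) (z i)" by simp
  have "ennreal \<bar>f x - f z\<bar> = ennreal (\<bar>f x - f z\<bar> / \<eta> i (x i) (z i)) * ennreal (\<eta> i (x i) (z i))"
    using pos by (subst ennreal_mult[symmetric]) auto
  also have "\<dots> \<le> delta I M \<eta> i f * ennreal (\<eta> i (x i) (z i))"
    unfolding delta_def using assms(3)
    by (intro mult_right_mono SUP_upper2[of "(x, z)"]) auto
  finally show ?thesis .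
qed

lemma delta_leI:
  assumes "Metric_space (space (M i)) (\<eta> i)" "i \<in> I"
    and "\<And>x z. (x, z) \<in> differ_only_at I M i \<Longrightarrow> ennreal \<bar>f x - f z\<bar> \<le> c * ennreal (\<eta> i (x i) (z i))"
  shows "delta I M \<eta> i f \<le> c"
  unfolding delta_def
proof (safe intro!: SUP_least)
  interpret Metric_space "space (M i)" "\<eta> i" by fact
  fix x z assume xz: "(x, z) \<in> differ_only_at I M i"
  then have "x i \<in> space (M i)" "z i \<in> space (M i)" "x i \<noteq> z i"
    using assms(2) by (auto simp: differ_only_at_def space_PiM)
  then have pos: "0 < \<eta> i (x i) (z i)" by simp
  then have "ennreal (\<bar>f x - f z\<bar> / \<eta> i (x i) (z i)) = ennreal (1 / \<eta> i (x i) (z i)) * ennreal \<bar>f x - f z\<bar>"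
    by (subst ennreal_mult[symmetric]) auto
  also have "\<dots> \<le> ennreal (1 / \<eta> i (x i) (z i)) * (c * ennreal (\<eta> i (x i) (z i)))"
    using assms(3)[OF xz] by (intro mult_left_mono) auto
  also have "\<dots> = c * (ennreal (1 / \<eta> i (x i) (z i)) * ennreal (\<eta> i (x i) (z i)))"
    by (simp add: mult_ac)
  also have "ennreal (1 / \<eta> i (x i) (z i)) * ennreal (\<eta> i (x i) (z i)) = 1"
    using pos by (subst ennreal_mult[symmetric]) auto
  finally show "ennreal (\<bar>f x - f z\<bar> / \<eta> i (x i) (z i)) \<le> c" by simp
qed

text \<open>
  The sites of \<open>L\<close> are changed one at a time; each step costs the oscillation at one site.
\<close>

lemma abs_diff_le_sum_delta:
  assumes "\<And>i. i \<in> I \<Longrightarrow> Metric_space (space (M i)) (\<eta> i)"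
    and "finite L" "L \<subseteq> I" "x \<in> space (PiM I M)" "z \<in> space (PiM I M)"
    and "\<And>i. i \<in> I - L \<Longrightarrow> x i = z i"
  shows "ennreal \<bar>f x - f z\<bar> \<le> (\<Sum>i\<in>L. delta I M \<eta> i f * ennreal (\<eta> i (x i) (z i)))"
  using assms(2-)
proof (induction L arbitrary: x rule: finite_induct)
  case empty
  then have "x = z" by (intro extensionalityI[of _ I]) (auto simp: space_PiM PiE_def)
  then show ?case by simp
next
  case (insert i L)
  let ?x = "x(i := z i)"
  have i: "i \<in> I" using insert.prems by auto
  have x': "?x \<in> space (PiM I M)" using insert.prems i by (auto simp: space_PiM PiE_def extensional_def)
  have 1: "ennreal \<bar>f x - f ?x\<bar> \<le> delta I M \<eta> i f * ennreal (\<eta> i (x i) (z i))"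
  proof (cases "x i = z i")
    case True
    then have "?x = x" by auto
    then show ?thesis by simp
  next
    case False
    then have "(x, ?x) \<in> differ_only_at I M i"
      using insert.prems x' by (auto simp: differ_only_at_def)
    from delta_ge[of M i \<eta>, OF assms(1)[OF i] i this, of f] show ?thesis by simp
  qed
  have "ennreal \<bar>f ?x - f z\<bar> \<le> (\<Sum>j\<in>L. delta I M \<eta> j f * ennreal (\<eta> j (?x j) (z j)))"
    using insert.prems by (intro insert.IH x') auto
  also have "\<dots> = (\<Sum>j\<in>L. delta I M \<eta> j f * ennreal (\<eta> j (x j) (z j)))"
    using insert.hyps by (intro sum.cong) auto
  finally have 2: "ennreal \<bar>f ?x - f z\<bar> \<le> (\<Sum>j\<in>L. delta I M \<eta> j f * ennreal (\<eta> j (x j) (z j)))" .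
  have "ennreal \<bar>f x - f z\<bar> \<le> ennreal (\<bar>f x - f ?x\<bar> + \<bar>f ?x - f z\<bar>)"
    by (intro ennreal_leI) linarith
  also have "\<dots> = ennreal \<bar>f x - f ?x\<bar> + ennreal \<bar>f ?x - f z\<bar>" by (simp add: ennreal_plus)
  also have "\<dots> \<le> delta I M \<eta> i f * ennreal (\<eta> i (x i) (z i))
      + (\<Sum>j\<in>L. delta I M \<eta> j f * ennreal (\<eta> j (x j) (z j)))"
    by (intro add_mono 1 2)
  finally show ?case using insert.hyps by simp
qed

text \<open>
  By quasilocality \<open>z\<close> may be replaced by a configuration that differs from \<open>x\<close> at finitely many sites.
\<close>

lemma quasilocal_abs_diff_le:
  assumes "\<And>i. i \<in> I \<Longrightarrow> Metric_space (space (M i)) (\<eta> i)"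
    and f: "quasilocal I M f" and x: "x \<in> space (PiM I M)" and z: "z \<in> space (PiM I M)"
  shows "ennreal \<bar>f x - f z\<bar> \<le> dot I (\<lambda>i. delta I M \<eta> i f) (\<lambda>i. ennreal (\<eta> i (x i) (z i)))"
proof (rule ennreal_le_epsilon)
  fix \<epsilon> :: real assume "0 < \<epsilon>"
  have "((\<lambda>J. \<bar>f (merge J (I - J) (z, x)) - f z\<bar>) \<longlongrightarrow> 0) (finite_subsets_at_top I)"
    using f x z by (auto simp: quasilocal_def)
  then have "\<forall>\<^sub>F J in finite_subsets_at_top I. \<bar>f (merge J (I - J) (z, x)) - f z\<bar> < \<epsilon>"
    using \<open>0 < \<epsilon>\<close> by (rule order_tendstoD)
  then obtain J where J: "finite J" "J \<subseteq> I" "\<bar>f (merge J (I - J) (z, x)) - f z\<bar> < \<epsilon>"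
    by (auto simp: eventually_finite_subsets_at_top)
  let ?m = "merge J (I - J) (z, x)"
  have "ennreal \<bar>f x - f ?m\<bar> \<le> (\<Sum>i\<in>J. delta I M \<eta> i f * ennreal (\<eta> i (x i) (?m i)))"
    by (intro abs_diff_le_sum_delta assms(1) J x merge_restrict_in_space_PiM z) auto
  also have "\<dots> = (\<Sum>i\<in>J. delta I M \<eta> i f * ennreal (\<eta> i (x i) (z i)))"
    by (intro sum.cong) auto
  also have "\<dots> \<le> dot I (\<lambda>i. delta I M \<eta> i f) (\<lambda>i. ennreal (\<eta> i (x i) (z i)))"
    unfolding dot_def by (rule nn_integral_count_space_sum_le[OF J(1,2)])
  finally have 1: "ennreal \<bar>f x - f ?m\<bar> \<le> dot I (\<lambda>i. delta I M \<eta> i f) (\<lambda>i. ennreal (\<eta> i (x i) (z i)))" .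
  have "ennreal \<bar>f x - f z\<bar> \<le> ennreal (\<bar>f x - f ?m\<bar> + \<bar>f ?m - f z\<bar>)"
    by (intro ennreal_leI) linarith
  also have "\<dots> = ennreal \<bar>f x - f ?m\<bar> + ennreal \<bar>f ?m - f z\<bar>" by (simp add: ennreal_plus)
  also have "\<dots> \<le> dot I (\<lambda>i. delta I M \<eta> i f) (\<lambda>i. ennreal (\<eta> i (x i) (z i))) + ennreal \<epsilon>"
    using J(3) by (intro add_mono 1 ennreal_leI) auto
  finally show "ennreal \<bar>f x - f z\<bar>
    \<le> dot I (\<lambda>i. delta I M \<eta> i f) (\<lambda>i. ennreal (\<eta> i (x i) (z i))) + ennreal \<epsilon>" .
qed

lemma integral_diff_le_dot_mean_dist:
  assumes I: "countable I" and met: "\<And>i. i \<in> I \<Longrightarrow> Metric_space (space (M i)) (\<eta> i)"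
    and \<eta>: "\<And>i. i \<in> I \<Longrightarrow> (\<lambda>(s, t). \<eta> i s t) \<in> borel_measurable (M i \<Otimes>\<^sub>M M i)"
    and \<rho>: "prob_space \<rho>" "sets \<rho> = sets (PiM I M)" and \<rho>': "prob_space \<rho>'" "sets \<rho>' = sets (PiM I M)"
    and f: "bounded_measurable (PiM I M) f" "quasilocal I M f"
  shows "ennreal \<bar>(\<integral>x. f x \<partial>\<rho>) - (\<integral>x. f x \<partial>\<rho>')\<bar>
    \<le> dot I (\<lambda>i. delta I M \<eta> i f) (\<lambda>i. mean_dist \<eta> i (\<rho> \<Otimes>\<^sub>M \<rho>'))"
proof -
  have sp: "space \<rho> = space (PiM I M)" "space \<rho>' = space (PiM I M)"
    using \<rho> \<rho>' by (auto dest: sets_eq_imp_space_eq)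
  have [measurable_cong]: "sets \<rho> = sets (PiM I M)" "sets \<rho>' = sets (PiM I M)" by fact+
  have bm: "bounded_measurable \<rho> f" "bounded_measurable \<rho>' f"
    using f(1) sp \<rho>(2) \<rho>'(2) by (auto simp: bounded_measurable_def cong: measurable_cong_sets)
  have m: "(\<lambda>q. ennreal (\<eta> i (fst q i) (snd q i))) \<in> borel_measurable (\<rho> \<Otimes>\<^sub>M \<rho>')" if i: "i \<in> I" for i
  proof -
    note \<eta>[OF i, measurable]
    have "(\<lambda>q. (\<lambda>(s, t). \<eta> i s t) (fst q i, snd q i)) \<in> borel_measurable (\<rho> \<Otimes>\<^sub>M \<rho>')"
      using i by measurable
    then show ?thesis by simp
  qed
  have "ennreal \<bar>(\<integral>x. f x \<partial>\<rho>) - (\<integral>x. f x \<partial>\<rho>')\<bar> \<le> (\<integral>\<^sup>+(x, z). ennreal \<bar>f x - f z\<bar> \<partial>(\<rho> \<Otimes>\<^sub>M \<rho>'))"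
    by (intro coupling_integral_diff_le is_coupling_pair_measure bm \<rho> \<rho>')
  also have "\<dots> \<le> (\<integral>\<^sup>+q. (\<integral>\<^sup>+i. delta I M \<eta> i f * ennreal (\<eta> i (fst q i) (snd q i)) \<partial>count_space I) \<partial>(\<rho> \<Otimes>\<^sub>M \<rho>'))"
    using quasilocal_abs_diff_le[OF met f(2)]
    by (intro nn_integral_mono) (auto simp: space_pair_measure sp dot_def)
  also have "\<dots> = (\<integral>\<^sup>+i. (\<integral>\<^sup>+q. delta I M \<eta> i f * ennreal (\<eta> i (fst q i) (snd q i)) \<partial>(\<rho> \<Otimes>\<^sub>M \<rho>')) \<partial>count_space I)"
    using m by (intro nn_integral_count_space_nn_integral I) auto
  also have "\<dots> = dot I (\<lambda>i. delta I M \<eta> i f) (\<lambda>i. mean_dist \<eta> i (\<rho> \<Otimes>\<^sub>M \<rho>'))"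
    unfolding dot_def mean_dist_def using m
    by (intro nn_integral_cong) (auto simp: nn_integral_cmult split_beta')
  finally show ?thesis .
qed

lemma filterlim_finite_exhaustion:
  assumes L: "\<And>n. finite (L n)" "\<And>n. L n \<subseteq> I" "incseq L" "(\<Union>n. L n) = I"
  shows "filterlim L (finite_subsets_at_top I) sequentially"
  unfolding filterlim_iff eventually_finite_subsets_at_top
proof safe
  fix P X assume X: "finite X" "X \<subseteq> I" "\<forall>Y. finite Y \<and> X \<subseteq> Y \<and> Y \<subseteq> I \<longrightarrow> P Y"
  have "\<exists>n. X \<subseteq> L n" using X(1,2)
  proof (induction X rule: finite_induct)
    case (insert i X)
    then obtain n m where "X \<subseteq> L n" "i \<in> L m" using L(4) by auto
    then have "insert i X \<subseteq> L (max n m)"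
      using monoD[OF L(3), of n "max n m"] monoD[OF L(3), of m "max n m"] by auto
    then show ?case by blast
  qed auto
  then obtain n where n: "X \<subseteq> L n" by blast
  have "P (L m)" if "n \<le> m" for m
    using X(3) L n monoD[OF L(3) that] by (auto)
  then show "\<forall>\<^sub>F n in sequentially. P (L n)" by (auto simp: eventually_sequentially)
qed

lemma quasilocal_finite:
  assumes "finite J"
  shows "quasilocal J M f"
proof -
  have "merge J (J - J) (z, x) = z" if "z \<in> space (PiM J M)" for x z
    using that by (auto simp: space_PiM PiE_def extensional_def merge_def fun_eq_iff)
  then show ?thesis
    using assms unfolding quasilocal_def
    by (intro ballI tendsto_eventually) (simp add: eventually_finite_subsets_at_top_finite)
qed

lemma measurable_merge_fixed:
  assumes "L \<subseteq> I" "z0 \<in> space (PiM I M)"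
  shows "(\<lambda>x. merge L (I - L) (x, z0)) \<in> PiM I M \<rightarrow>\<^sub>M PiM I M"
proof -
  have "(\<lambda>x. merge L (I - L) (restrict x L, z0)) \<in> PiM I M \<rightarrow>\<^sub>M PiM I M"
    using assms
    by (intro measurable_compose[OF _ measurable_merge_block] measurable_Pair measurable_const
        measurable_restrict_subset) auto
  moreover have "merge L (I - L) (restrict x L, z0) = merge L (I - L) (x, z0)" for x
    by (auto simp: merge_def fun_eq_iff)
  ultimately show ?thesis by simp
qed

text \<open>
  The function \<open>g\<close> is \<open>f\<close> with the coordinates outside \<open>L\<close> frozen at a reference configuration. It
  converges to \<open>f\<close> pointwise as \<open>L\<close> exhausts \<open>I\<close>, because \<open>f\<close> is quasilocal, and boundedly, so its
  expectations converge.
\<close>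

lemma localization:
  assumes I: "countable I" and met: "\<And>i. i \<in> I \<Longrightarrow> Metric_space (space (M i)) (\<eta> i)"
    and \<rho>: "prob_space \<rho>" "sets \<rho> = sets (PiM I M)" and \<rho>': "prob_space \<rho>'" "sets \<rho>' = sets (PiM I M)"
    and f: "bounded_measurable (PiM I M) f" "quasilocal I M f" and \<epsilon>: "0 < \<epsilon>"
  obtains L g where "finite L" "L \<subseteq> I" "bounded_measurable (PiM I M) g" "quasilocal I M g"
    "\<And>i. i \<in> I \<Longrightarrow> delta I M \<eta> i g \<le> (if i \<in> L then delta I M \<eta> i f else 0)"
    "ennreal \<bar>(\<integral>x. f x \<partial>\<rho>) - (\<integral>x. f x \<partial>\<rho>')\<bar> \<le> ennreal \<bar>(\<integral>x. g x \<partial>\<rho>) - (\<integral>x. g x \<partial>\<rho>')\<bar> + ennreal \<epsilon>"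
proof -
  interpret \<rho>: prob_space \<rho> by fact
  have sp: "space \<rho> = space (PiM I M)" "space \<rho>' = space (PiM I M)"
    using \<rho> \<rho>' by (auto dest: sets_eq_imp_space_eq)
  obtain z0 where z0: "z0 \<in> space (PiM I M)" using \<rho>.not_empty unfolding sp by blast
  obtain C where C: "0 \<le> C" "\<And>x. x \<in> space (PiM I M) \<Longrightarrow> \<bar>f x\<bar> \<le> C"
    using bounded_measurable_bound[OF f(1)] by blast
  obtain L where L: "\<And>n. finite (L n)" "\<And>n. L n \<subseteq> I" "incseq L" "(\<Union>n. L n) = I"
    using finite_exhaustion[OF I] by metis
  define g where "g n x = f (merge (L n) (I - L n) (x, z0))" for n x
  have f_meas: "f \<in> borel_measurable (PiM I M)" using f(1) by (simp add: bounded_measurable_def)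
  have g_meas: "g n \<in> borel_measurable (PiM I M)" for n
    unfolding g_def by (rule measurable_compose[OF measurable_merge_fixed[OF L(2) z0] f_meas])
  have g_bound: "\<bar>g n x\<bar> \<le> C" if "x \<in> space (PiM I M)" for n x
    unfolding g_def by (intro C merge_restrict_in_space_PiM that z0)
  have g_bm: "bounded_measurable (PiM I M) (g n)" for n
    by (rule bounded_measurableI[OF g_meas g_bound])
  have g_lim: "(\<lambda>n. g n x) \<longlonglongrightarrow> f x" if x: "x \<in> space (PiM I M)" for x
  proof -
    have "((\<lambda>J. \<bar>f (merge J (I - J) (x, z0)) - f x\<bar>) \<longlongrightarrow> 0) (finite_subsets_at_top I)"
      using f(2) x z0 by (auto simp: quasilocal_def)
    from filterlim_compose[OF this filterlim_finite_exhaustion[OF L]]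
    have "(\<lambda>n. \<bar>g n x - f x\<bar>) \<longlonglongrightarrow> 0" by (simp add: g_def)
    then show ?thesis by (simp add: LIM_zero_iff tendsto_rabs_zero_iff)
  qed
  have int_lim: "(\<lambda>n. \<integral>x. g n x \<partial>P) \<longlonglongrightarrow> (\<integral>x. f x \<partial>P)"
    if P: "prob_space P" "sets P = sets (PiM I M)" for P
  proof (rule integral_dominated_convergence[where w = "\<lambda>_. C"])
    interpret P: prob_space P by fact
    have spP: "space P = space (PiM I M)" using P(2) by (rule sets_eq_imp_space_eq)
    show "f \<in> borel_measurable P" "g n \<in> borel_measurable P" for n
      using f_meas g_meas by (auto simp: measurable_cong_sets[OF P(2) refl])
    show "integrable P (\<lambda>_. C)" by simp
    show "AE x in P. (\<lambda>n. g n x) \<longlonglongrightarrow> f x" "AE x in P. norm (g n x) \<le> C" for n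
      using g_lim g_bound by (auto simp: spP intro!: AE_I2)
  qed
  let ?d = "\<lambda>h. (\<integral>x. h x \<partial>\<rho>) - (\<integral>x. h x \<partial>\<rho>')"
  have "(\<lambda>n. ?d (g n)) \<longlonglongrightarrow> ?d f"
    by (intro tendsto_diff int_lim \<rho> \<rho>')
  then have "\<forall>\<^sub>F n in sequentially. dist (?d (g n)) (?d f) < \<epsilon>"
    using \<epsilon> by (rule tendstoD)
  then obtain n where n: "dist (?d (g n)) (?d f) < \<epsilon>"
    by (auto simp: eventually_sequentially)
  show ?thesis
  proof (rule that[OF L(1) L(2) g_bm[of n]])
    show "quasilocal I M (g n)"
      unfolding quasilocal_def
    proof safe
      fix x z assume "x \<in> space (PiM I M)" "z \<in> space (PiM I M)"
      have "\<forall>\<^sub>F J in finite_subsets_at_top I. \<bar>g n (merge J (I - J) (z, x)) - g n z\<bar> = 0"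
        unfolding eventually_finite_subsets_at_top
      proof (intro exI[of _ "L n"] conjI allI impI L)
        fix J assume "finite J \<and> L n \<subseteq> J \<and> J \<subseteq> I"
        then have "merge (L n) (I - L n) (merge J (I - J) (z, x), z0) = merge (L n) (I - L n) (z, z0)"
          by (auto simp: merge_def fun_eq_iff)
        then show "\<bar>g n (merge J (I - J) (z, x)) - g n z\<bar> = 0" by (simp add: g_def)
      qed
      then show "((\<lambda>J. \<bar>g n (merge J (I - J) (z, x)) - g n z\<bar>) \<longlongrightarrow> 0) (finite_subsets_at_top I)"
        by (rule tendsto_eventually)
    qed
    show "delta I M \<eta> i (g n) \<le> (if i \<in> L n then delta I M \<eta> i f else 0)" if i: "i \<in> I" for i
    proof (rule delta_leI[of M i \<eta>, OF met[OF i] i])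
      fix x z assume xz: "(x, z) \<in> differ_only_at I M i"
      then have sp: "x \<in> space (PiM I M)" "z \<in> space (PiM I M)" "x i \<noteq> z i"
        and eq: "\<And>j. j \<in> I \<Longrightarrow> j \<noteq> i \<Longrightarrow> x j = z j"
        using differ_only_at_agree[OF xz] by (auto simp: differ_only_at_def)
      let ?m = "\<lambda>x. merge (L n) (I - L n) (x, z0)"
      show "ennreal \<bar>g n x - g n z\<bar> \<le> (if i \<in> L n then delta I M \<eta> i f else 0) * ennreal (\<eta> i (x i) (z i))"
      proof (cases "i \<in> L n")
        case True
        then have "(?m x, ?m z) \<in> differ_only_at I M i"
          using sp eq L(2)[of n] merge_restrict_in_space_PiM[OF _ z0]
          by (auto simp: differ_only_at_def restrict_def fun_eq_iff merge_def)
        from delta_ge[of M i \<eta>, OF met[OF i] i this, of f] True show ?thesis by (simp add: g_def)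
      next
        case False
        then have "?m x = ?m z" using eq L(2)[of n] by (auto simp: merge_def fun_eq_iff)
        then show ?thesis by (simp add: g_def)
      qed
    qed
    have "\<bar>?d f\<bar> \<le> \<bar>?d (g n)\<bar> + \<epsilon>" using n by (auto simp: dist_real_def)
    then have "ennreal \<bar>?d f\<bar> \<le> ennreal (\<bar>?d (g n)\<bar> + \<epsilon>)" by (rule ennreal_leI)
    then show "ennreal \<bar>?d f\<bar> \<le> ennreal \<bar>?d (g n)\<bar> + ennreal \<epsilon>" using \<epsilon> by (simp add: ennreal_plus)
  qed
qed

section \<open>Block updates\<close>

definition block_update ::
    "'i set \<Rightarrow> 'i set \<Rightarrow> (('i \<Rightarrow> 'a) \<Rightarrow> ('i \<Rightarrow> 'a) measure) \<Rightarrow> (('i \<Rightarrow> 'a) \<Rightarrow> real) \<Rightarrow> ('i \<Rightarrow> 'a) \<Rightarrow> real" where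
  "block_update I J \<kappa> f x = (\<integral>z. f (merge J (I - J) (z, x)) \<partial>\<kappa> x)"

lemma kernel_at:
  assumes "\<kappa> \<in> N \<rightarrow>\<^sub>M prob_algebra N'" "x \<in> space N"
  shows "prob_space (\<kappa> x)" "sets (\<kappa> x) = sets N'" "space (\<kappa> x) = space N'"
  using measurable_space[OF assms] by (auto simp: space_prob_algebra dest: sets_eq_imp_space_eq)

lemma bounded_measurable_section:
  assumes "bounded_measurable (PiM I M) f" "J \<subseteq> I" "x \<in> space (PiM I M)"
  shows "bounded_measurable (PiM J M) (\<lambda>z. f (merge J (I - J) (z, x)))"
proof -
  obtain C where C: "0 \<le> C" "\<And>x. x \<in> space (PiM I M) \<Longrightarrow> \<bar>f x\<bar> \<le> C"
    using bounded_measurable_bound[OF assms(1)] by blast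
  have "(\<lambda>z. merge J (I - J) (z, x)) \<in> PiM J M \<rightarrow>\<^sub>M PiM I M"
    using assms by (intro measurable_compose[OF _ measurable_merge_block] measurable_Pair) auto
  moreover have "f \<in> borel_measurable (PiM I M)" using assms(1) by (simp add: bounded_measurable_def)
  ultimately have "(\<lambda>z. f (merge J (I - J) (z, x))) \<in> borel_measurable (PiM J M)"
    by (rule measurable_compose)
  then show ?thesis
    by (rule bounded_measurableI[of _ _ C]) (intro C(2) merge_in_space_PiM assms)
qed

lemma abs_block_update_le:
  assumes \<kappa>: "\<kappa> \<in> PiM I M \<rightarrow>\<^sub>M prob_algebra (PiM J M)" and J: "J \<subseteq> I"
    and f: "bounded_measurable (PiM I M) f" "\<And>x. x \<in> space (PiM I M) \<Longrightarrow> \<bar>f x\<bar> \<le> C"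
    and x: "x \<in> space (PiM I M)"
  shows "\<bar>block_update I J \<kappa> f x\<bar> \<le> C"
  unfolding block_update_def
proof (rule abs_integral_le_of_bound)
  show "prob_space (\<kappa> x)" by (rule kernel_at[OF \<kappa> x])
  show "(\<lambda>z. f (merge J (I - J) (z, x))) \<in> borel_measurable (\<kappa> x)"
    using bounded_measurable_section[OF f(1) J x]
    by (auto simp: bounded_measurable_def measurable_cong_sets[OF kernel_at(2)[OF \<kappa> x] refl])
  show "\<bar>f (merge J (I - J) (z, x))\<bar> \<le> C" if "z \<in> space (\<kappa> x)" for z
    using that by (intro f merge_in_space_PiM J x) (simp add: kernel_at[OF \<kappa> x])
qed

text \<open>
  Adding a bound \<open>C\<close> of \<open>\<bar>f\<bar>\<close> makes the integrand nonnegative, so that measurability follows from the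
  corresponding fact for \<open>\<integral>\<^sup>+\<close>.
\<close>

lemma bounded_measurable_block_update:
  assumes \<kappa>: "\<kappa> \<in> PiM I M \<rightarrow>\<^sub>M prob_algebra (PiM J M)" and J: "J \<subseteq> I"
    and f: "bounded_measurable (PiM I M) f"
  shows "bounded_measurable (PiM I M) (block_update I J \<kappa> f)"
proof -
  obtain C where C: "0 \<le> C" "\<And>x. x \<in> space (PiM I M) \<Longrightarrow> \<bar>f x\<bar> \<le> C"
    using bounded_measurable_bound[OF f] by blast
  have f_meas: "f \<in> borel_measurable (PiM I M)" using f by (simp add: bounded_measurable_def)
  have "(\<lambda>q. merge J (I - J) (snd q, fst q)) \<in> PiM I M \<Otimes>\<^sub>M PiM J M \<rightarrow>\<^sub>M PiM I M"
    by (rule measurable_compose[OF _ measurable_merge_block[OF J]]) (intro measurable_Pair measurable_fst measurable_snd)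
  from measurable_compose[OF this f_meas]
  have "(\<lambda>(x, z). ennreal (f (merge J (I - J) (z, x)) + C)) \<in> borel_measurable (PiM I M \<Otimes>\<^sub>M PiM J M)"
    by (simp add: split_beta')
  from nn_integral_measurable_subprob_algebra2[OF this measurable_prob_algebraD[OF \<kappa>]]
  have "(\<lambda>x. enn2real (\<integral>\<^sup>+z. ennreal (f (merge J (I - J) (z, x)) + C) \<partial>\<kappa> x) - C) \<in> borel_measurable (PiM I M)"
    by simp
  also have "?this \<longleftrightarrow> block_update I J \<kappa> f \<in> borel_measurable (PiM I M)"
  proof (rule measurable_cong)
    fix x assume x: "x \<in> space (PiM I M)"
    interpret prob_space "\<kappa> x" by (rule kernel_at[OF \<kappa> x])
    let ?g = "\<lambda>z. f (merge J (I - J) (z, x))"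
    have int: "integrable (\<kappa> x) ?g"
      by (rule bounded_measurable_integrable[OF bounded_measurable_section[OF f J x]])
         (use kernel_at[OF \<kappa> x] in auto)
    have nonneg: "0 \<le> ?g z + C" if "z \<in> space (\<kappa> x)" for z
    proof -
      have "\<bar>?g z\<bar> \<le> C"
        using that by (intro C merge_in_space_PiM J x) (simp add: kernel_at[OF \<kappa> x])
      then show ?thesis by linarith
    qed
    have "(\<integral>\<^sup>+z. ennreal (?g z + C) \<partial>\<kappa> x) = ennreal (\<integral>z. ?g z + C \<partial>\<kappa> x)"
      using int nonneg by (intro nn_integral_eq_integral) auto
    moreover have "0 \<le> (\<integral>z. ?g z + C \<partial>\<kappa> x)"
      using nonneg by (intro integral_nonneg_AE AE_I2) auto
    moreover have "(\<integral>z. ?g z + C \<partial>\<kappa> x) = block_update I J \<kappa> f x + C"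
      using int by (simp add: block_update_def prob_space)
    ultimately show "enn2real (\<integral>\<^sup>+z. ennreal (?g z + C) \<partial>\<kappa> x) - C = block_update I J \<kappa> f x"
      by simp
  qed
  finally show ?thesis
    by (rule bounded_measurableI) (rule abs_block_update_le[OF \<kappa> J f C(2)])
qed

lemma quasilocal_kernel_tendsto:
  assumes "quasilocal_kernel I J M \<kappa>" "finite J" "bounded_measurable (PiM J M) h"
    and "x \<in> space (PiM I M)" "z \<in> space (PiM I M)"
  shows "((\<lambda>K. \<integral>y. h y \<partial>\<kappa> (merge K (I - K) (z, x))) \<longlongrightarrow> (\<integral>y. h y \<partial>\<kappa> z)) (finite_subsets_at_top I)"
proof -
  have "quasilocal I M (\<lambda>x. \<integral>y. h y \<partial>\<kappa> x)"
    using assms(1,3) quasilocal_finite[OF assms(2)] by (auto simp: quasilocal_kernel_def)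
  then have "((\<lambda>K. \<bar>(\<integral>y. h y \<partial>\<kappa> (merge K (I - K) (z, x))) - (\<integral>y. h y \<partial>\<kappa> z)\<bar>) \<longlongrightarrow> 0)
      (finite_subsets_at_top I)"
    using assms(4,5) by (auto simp: quasilocal_def)
  then show ?thesis by (simp add: tendsto_rabs_zero_iff LIM_zero_iff)
qed

text \<open>
  In \<open>block_update I J \<kappa> f\<close> both the integrand and the measure depend on the configuration. For a
  fixed bounded integrand the convergence is the quasilocality of \<open>\<kappa>\<close>, since every function of finitely
  many coordinates is quasilocal. The change \<open>d K\<close> of the integrand tends to 0 pointwise, but it is
  integrated against a measure that varies with \<open>K\<close>. It is therefore dominated by
  \<open>h n = sup {d K | K \<supseteq> L n}\<close>, which is measurable as a countable supremum and independent of \<open>K\<close>. Its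
  integral against the limit measure tends to 0 by dominated convergence, and for a fixed \<open>n\<close> the
  quasilocality of \<open>\<kappa>\<close> transfers this smallness to the measures with \<open>K\<close> large.
\<close>

lemma quasilocal_block_update:
  assumes I: "countable I" and \<kappa>: "\<kappa> \<in> PiM I M \<rightarrow>\<^sub>M prob_algebra (PiM J M)"
    and J: "finite J" "J \<subseteq> I" and ql: "quasilocal_kernel I J M \<kappa>"
    and f: "bounded_measurable (PiM I M) f" "quasilocal I M f"
  shows "quasilocal I M (block_update I J \<kappa> f)"
  unfolding quasilocal_def
proof (intro ballI)
  fix x z assume x: "x \<in> space (PiM I M)" and z: "z \<in> space (PiM I M)"
  let ?F = "finite_subsets_at_top I" and ?m = "\<lambda>K. merge K (I - K) (z, x)"
  have m: "?m K \<in> space (PiM I M)" for K by (rule merge_restrict_in_space_PiM[OF z x])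
  obtain C where C: "0 \<le> C" "\<And>x. x \<in> space (PiM I M) \<Longrightarrow> \<bar>f x\<bar> \<le> C"
    using bounded_measurable_bound[OF f(1)] by blast
  obtain L where L: "\<And>n. finite (L n)" "\<And>n. L n \<subseteq> I" "incseq L" "(\<Union>n. L n) = I"
    using finite_exhaustion[OF I] by metis
  define g where "g y \<omega> = f (merge J (I - J) (\<omega>, y))" for y \<omega>
  define d where "d K \<omega> = \<bar>g (?m K) \<omega> - g z \<omega>\<bar>" for K \<omega>
  define \<K> where "\<K> n = {K. finite K \<and> L n \<subseteq> K \<and> K \<subseteq> I}" for n
  define h where "h n \<omega> = (SUP K\<in>\<K> n. d K \<omega>)" for n \<omega>
  have g_bm: "bounded_measurable (PiM J M) (g y)" if "y \<in> space (PiM I M)" for y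
    unfolding g_def by (rule bounded_measurable_section[OF f(1) J(2) that])
  have g_meas: "g y \<in> borel_measurable (PiM J M)" if "y \<in> space (PiM I M)" for y
    using g_bm[OF that] by (simp add: bounded_measurable_def)
  have g_bound: "\<bar>g y \<omega>\<bar> \<le> C" if "y \<in> space (PiM I M)" "\<omega> \<in> space (PiM J M)" for y \<omega>
    unfolding g_def by (intro C merge_in_space_PiM J that)
  have d_bound: "d K \<omega> \<le> 2 * C" if "\<omega> \<in> space (PiM J M)" for K \<omega>
    using g_bound[OF m that, of K] g_bound[OF z that] by (simp add: d_def)
  have bdd: "bdd_above ((\<lambda>K. d K \<omega>) ` \<K> n)" if "\<omega> \<in> space (PiM J M)" for n \<omega>
    using d_bound[OF that] by (auto intro!: bdd_aboveI2)
  have countable_\<K>: "countable (\<K> n)" for n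
    by (rule countable_subset[OF _ countable_Collect_finite_subset[OF I]]) (auto simp: \<K>_def)
  have L_in: "L n \<in> \<K> n" for n using L by (auto simp: \<K>_def)
  have d_le_h: "d K \<omega> \<le> h n \<omega>" if "\<omega> \<in> space (PiM J M)" "K \<in> \<K> n" for K n \<omega>
    unfolding h_def by (intro cSUP_upper bdd that)
  have h_nonneg: "0 \<le> h n \<omega>" if "\<omega> \<in> space (PiM J M)" for n \<omega>
    by (rule order_trans[OF _ d_le_h[OF that L_in]]) (simp add: d_def)
  have h_bound: "h n \<omega> \<le> 2 * C" if "\<omega> \<in> space (PiM J M)" for n \<omega>
    unfolding h_def using L_in by (intro cSUP_least d_bound that) auto
  have h_meas: "h n \<in> borel_measurable (PiM J M)" for n
    unfolding h_def d_def
    by (intro borel_measurable_cSUP countable_\<K> borel_measurable_abs borel_measurable_diff g_meas m z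
        bdd[unfolded d_def])
  have h_bm: "bounded_measurable (PiM J M) (h n)" for n
    by (rule bounded_measurableI[OF h_meas, of _ "2 * C"]) (use h_nonneg h_bound in simp)
  have h_lim: "(\<lambda>n. h n \<omega>) \<longlonglongrightarrow> 0" if \<omega>: "\<omega> \<in> space (PiM J M)" for \<omega>
  proof (rule tendstoI)
    fix \<epsilon> :: real assume \<epsilon>: "0 < \<epsilon>"
    let ?x = "merge J (I - J) (\<omega>, x)" and ?z = "merge J (I - J) (\<omega>, z)"
    have eq: "merge J (I - J) (\<omega>, ?m K) = merge K (I - K) (?z, ?x)" if "K \<subseteq> I" for K
      using that J by (auto simp: merge_def fun_eq_iff)
    have "((\<lambda>K. \<bar>f (merge K (I - K) (?z, ?x)) - f ?z\<bar>) \<longlongrightarrow> 0) ?F"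
      using f(2) merge_in_space_PiM[OF J(2) \<omega> x] merge_in_space_PiM[OF J(2) \<omega> z]
      by (auto simp: quasilocal_def)
    then have "\<forall>\<^sub>F K in ?F. \<bar>f (merge K (I - K) (?z, ?x)) - f ?z\<bar> < \<epsilon> / 2"
      using \<epsilon> by (intro order_tendstoD) auto
    then obtain X where X: "finite X" "X \<subseteq> I"
      "\<And>K. finite K \<Longrightarrow> X \<subseteq> K \<Longrightarrow> K \<subseteq> I \<Longrightarrow> \<bar>f (merge K (I - K) (?z, ?x)) - f ?z\<bar> < \<epsilon> / 2"
      by (auto simp: eventually_finite_subsets_at_top)
    have "\<forall>\<^sub>F K in ?F. X \<subseteq> K"
      using X by (auto simp: eventually_finite_subsets_at_top)
    then have "\<forall>\<^sub>F n in sequentially. X \<subseteq> L n"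
      using filterlim_finite_exhaustion[OF L] by (auto simp: filterlim_iff)
    then show "\<forall>\<^sub>F n in sequentially. dist (h n \<omega>) 0 < \<epsilon>"
    proof eventually_elim
      case (elim n)
      have "h n \<omega> \<le> \<epsilon> / 2"
        unfolding h_def
      proof (rule cSUP_least)
        fix K assume "K \<in> \<K> n"
        then have K: "finite K" "X \<subseteq> K" "K \<subseteq> I" using elim by (auto simp: \<K>_def)
        show "d K \<omega> \<le> \<epsilon> / 2"
          using X(3)[OF K] eq[OF K(3)] by (simp add: d_def g_def)
      qed (use L_in in auto)
      then show ?case using h_nonneg[OF \<omega>, of n] \<epsilon> by simp
    qed
  qed
  interpret \<kappa>z: prob_space "\<kappa> z" by (rule kernel_at[OF \<kappa> z])
  have "(\<lambda>n. \<integral>\<omega>. h n \<omega> \<partial>\<kappa> z) \<longlonglongrightarrow> (\<integral>\<omega>. 0 \<partial>\<kappa> z)"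
  proof (rule integral_dominated_convergence[where w = "\<lambda>_. 2 * C"])
    show "h n \<in> borel_measurable (\<kappa> z)" for n
      using h_meas by (simp add: measurable_cong_sets[OF kernel_at(2)[OF \<kappa> z] refl])
    show "AE \<omega> in \<kappa> z. (\<lambda>n. h n \<omega>) \<longlonglongrightarrow> 0" "AE \<omega> in \<kappa> z. norm (h n \<omega>) \<le> 2 * C" for n
      using h_lim h_nonneg h_bound by (auto simp: kernel_at[OF \<kappa> z] intro!: AE_I2)
  qed auto
  then have int_h: "(\<lambda>n. \<integral>\<omega>. h n \<omega> \<partial>\<kappa> z) \<longlonglongrightarrow> 0" by simp
  show "((\<lambda>K. \<bar>block_update I J \<kappa> f (?m K) - block_update I J \<kappa> f z\<bar>) \<longlongrightarrow> 0) ?F"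
  proof (rule tendstoI)
    fix \<epsilon> :: real assume \<epsilon>: "0 < \<epsilon>"
    have "\<forall>\<^sub>F n in sequentially. (\<integral>\<omega>. h n \<omega> \<partial>\<kappa> z) < \<epsilon> / 2"
      using int_h \<epsilon> by (intro order_tendstoD) auto
    then obtain n where n: "(\<integral>\<omega>. h n \<omega> \<partial>\<kappa> z) < \<epsilon> / 2" by (auto simp: eventually_sequentially)
    have 1: "\<forall>\<^sub>F K in ?F. (\<integral>\<omega>. h n \<omega> \<partial>\<kappa> (?m K)) < \<epsilon> / 2"
      using quasilocal_kernel_tendsto[OF ql J(1) h_bm x z] n by (rule order_tendstoD(2))
    have "((\<lambda>K. \<integral>\<omega>. g z \<omega> \<partial>\<kappa> (?m K)) \<longlongrightarrow> (\<integral>\<omega>. g z \<omega> \<partial>\<kappa> z)) ?F"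
      by (rule quasilocal_kernel_tendsto[OF ql J(1) g_bm[OF z] x z])
    then have 2: "\<forall>\<^sub>F K in ?F. dist (\<integral>\<omega>. g z \<omega> \<partial>\<kappa> (?m K)) (\<integral>\<omega>. g z \<omega> \<partial>\<kappa> z) < \<epsilon> / 2"
      using \<epsilon> by (intro tendstoD) auto
    have 3: "\<forall>\<^sub>F K in ?F. K \<in> \<K> n"
      using L by (auto simp: eventually_finite_subsets_at_top \<K>_def)
    from 1 2 3 show "\<forall>\<^sub>F K in ?F. dist \<bar>block_update I J \<kappa> f (?m K) - block_update I J \<kappa> f z\<bar> 0 < \<epsilon>"
    proof eventually_elim
      case (elim K)
      interpret prob_space "\<kappa> (?m K)" by (rule kernel_at[OF \<kappa> m])
      note at = kernel_at[OF \<kappa> m, of K]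
      have int: "integrable (\<kappa> (?m K)) (g y)" if "y \<in> space (PiM I M)" for y
        by (rule bounded_measurable_integrable[OF g_bm[OF that] at(1,2)])
      have int_h: "integrable (\<kappa> (?m K)) (h n)"
        by (rule bounded_measurable_integrable[OF h_bm at(1,2)])
      have "\<bar>(\<integral>\<omega>. g (?m K) \<omega> \<partial>\<kappa> (?m K)) - (\<integral>\<omega>. g z \<omega> \<partial>\<kappa> (?m K))\<bar>
          = \<bar>\<integral>\<omega>. g (?m K) \<omega> - g z \<omega> \<partial>\<kappa> (?m K)\<bar>"
        using int m z by simp
      also have "\<dots> \<le> (\<integral>\<omega>. \<bar>g (?m K) \<omega> - g z \<omega>\<bar> \<partial>\<kappa> (?m K))" by (rule integral_abs_bound)
      also have "\<dots> \<le> (\<integral>\<omega>. h n \<omega> \<partial>\<kappa> (?m K))"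
        using int m z int_h d_le_h[OF _ elim(3)] by (intro integral_mono) (auto simp: at d_def)
      finally have "\<bar>(\<integral>\<omega>. g (?m K) \<omega> \<partial>\<kappa> (?m K)) - (\<integral>\<omega>. g z \<omega> \<partial>\<kappa> (?m K))\<bar> < \<epsilon> / 2"
        using elim(1) by linarith
      with elim(2) show ?case
        unfolding block_update_def g_def[symmetric] dist_real_def by linarith
    qed
  qed
qed

text \<open>
  Couple the new values in \<open>J\<close> by \<open>Q\<close>. The two resulting configurations differ at most in \<open>J\<close> and, outside
  \<open>J\<close>, where \<open>x\<close> and \<open>z\<close> did. The lemma serves both for one kernel at two configurations that differ
  at one site and for two kernels at the same configuration.
\<close>

lemma block_update_diff_le:
  assumes met: "\<And>i. i \<in> I \<Longrightarrow> Metric_space (space (M i)) (\<eta> i)"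
    and \<eta>: "\<And>i. i \<in> I \<Longrightarrow> (\<lambda>(s, t). \<eta> i s t) \<in> borel_measurable (M i \<Otimes>\<^sub>M M i)"
    and \<kappa>: "\<kappa> \<in> PiM I M \<rightarrow>\<^sub>M prob_algebra (PiM J M)" "\<kappa>' \<in> PiM I M \<rightarrow>\<^sub>M prob_algebra (PiM J M)"
    and J: "finite J" "J \<subseteq> I" and f: "bounded_measurable (PiM I M) f"
    and x: "x \<in> space (PiM I M)" and z: "z \<in> space (PiM I M)"
    and E: "finite E" "E \<subseteq> I" "\<And>i. i \<in> I - E \<Longrightarrow> x i = z i"
    and Q: "is_coupling Q (\<kappa> x) (\<kappa>' z)"
  shows "ennreal \<bar>block_update I J \<kappa> f x - block_update I J \<kappa>' f z\<bar>
    \<le> (\<Sum>i\<in>J. delta I M \<eta> i f * mean_dist \<eta> i Q)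
      + (\<Sum>i\<in>E - J. delta I M \<eta> i f * ennreal (\<eta> i (x i) (z i)))" (is "_ \<le> _ + ?rest")
proof -
  note at = kernel_at[OF \<kappa>(1) x] kernel_at[OF \<kappa>(2) z]
  have [measurable_cong]: "sets (\<kappa> x) = sets (PiM J M)" "sets (\<kappa>' z) = sets (PiM J M)"
    by (fact at)+
  have "prob_space Q" and sets_Q: "sets Q = sets (\<kappa> x \<Otimes>\<^sub>M \<kappa>' z)"
    using Q by (auto simp: is_coupling_def)
  interpret Q: prob_space Q by fact
  have space_Q: "space Q = space (PiM J M) \<times> space (PiM J M)"
    using sets_eq_imp_space_eq[OF sets_Q] by (simp add: space_pair_measure at)
  have [measurable_cong]: "sets Q = sets (PiM J M \<Otimes>\<^sub>M PiM J M)"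
    unfolding sets_Q by (intro sets_pair_measure_cong at)
  have m: "(\<lambda>q. ennreal (\<eta> i (fst q i) (snd q i))) \<in> borel_measurable Q" if i: "i \<in> J" for i
  proof -
    have "i \<in> I" using i J by auto
    note \<eta>[OF this, measurable]
    have "(\<lambda>q. (\<lambda>(s, t). \<eta> i s t) (fst q i, snd q i)) \<in> borel_measurable Q"
      using i by measurable
    then show ?thesis by simp
  qed
  let ?m = "\<lambda>\<omega> y. merge J (I - J) (\<omega>, y)"
  have bm: "bounded_measurable (\<kappa> x) (\<lambda>\<omega>. f (?m \<omega> x))" "bounded_measurable (\<kappa>' z) (\<lambda>\<omega>. f (?m \<omega> z))"
    using bounded_measurable_section[OF f J(2) x] bounded_measurable_section[OF f J(2) z]
    by (auto simp: bounded_measurable_def at measurable_cong_sets[OF at(2) refl] measurable_cong_sets[OF at(5) refl])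
  have pointwise: "ennreal \<bar>f (?m \<omega> x) - f (?m \<omega>' z)\<bar>
      \<le> (\<Sum>i\<in>J. delta I M \<eta> i f * ennreal (\<eta> i (\<omega> i) (\<omega>' i))) + ?rest"
    if \<omega>: "\<omega> \<in> space (PiM J M)" "\<omega>' \<in> space (PiM J M)" for \<omega> \<omega>'
  proof -
    have "ennreal \<bar>f (?m \<omega> x) - f (?m \<omega>' z)\<bar>
        \<le> (\<Sum>i\<in>J \<union> (E - J). delta I M \<eta> i f * ennreal (\<eta> i (?m \<omega> x i) (?m \<omega>' z i)))"
      using J E \<omega> x z by (intro abs_diff_le_sum_delta met merge_in_space_PiM) auto
    also have "\<dots> = (\<Sum>i\<in>J. delta I M \<eta> i f * ennreal (\<eta> i (?m \<omega> x i) (?m \<omega>' z i)))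
        + (\<Sum>i\<in>E - J. delta I M \<eta> i f * ennreal (\<eta> i (?m \<omega> x i) (?m \<omega>' z i)))"
      using J E by (intro sum.union_disjoint) auto
    also have "\<dots> = (\<Sum>i\<in>J. delta I M \<eta> i f * ennreal (\<eta> i (\<omega> i) (\<omega>' i))) + ?rest"
      using E(2) by (intro arg_cong2[where f="(+)"] sum.cong) auto
    finally show ?thesis .
  qed
  have "ennreal \<bar>block_update I J \<kappa> f x - block_update I J \<kappa>' f z\<bar>
      \<le> (\<integral>\<^sup>+(\<omega>, \<omega>'). ennreal \<bar>f (?m \<omega> x) - f (?m \<omega>' z)\<bar> \<partial>Q)"
    unfolding block_update_def by (intro coupling_integral_diff_le Q bm at)
  also have "\<dots> \<le> (\<integral>\<^sup>+q. (\<Sum>i\<in>J. delta I M \<eta> i f * ennreal (\<eta> i (fst q i) (snd q i))) + ?rest \<partial>Q)"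
    using pointwise by (intro nn_integral_mono) (auto simp: space_Q)
  also have "\<dots> = (\<integral>\<^sup>+q. (\<Sum>i\<in>J. delta I M \<eta> i f * ennreal (\<eta> i (fst q i) (snd q i))) \<partial>Q) + ?rest"
    using m by (subst nn_integral_add) (auto simp: Q.emeasure_space_1)
  also have "(\<integral>\<^sup>+q. (\<Sum>i\<in>J. delta I M \<eta> i f * ennreal (\<eta> i (fst q i) (snd q i))) \<partial>Q)
      = (\<Sum>i\<in>J. delta I M \<eta> i f * mean_dist \<eta> i Q)"
    using m by (subst nn_integral_sum) (auto simp: mean_dist_def split_beta' nn_integral_cmult intro!: sum.cong)
  finally show ?thesis .
qed

text \<open>
  The infimum of countably many measurable majorants is a measurable majorant. A minimizer is needed
  because the outer integral is multiplied by an oscillation that may be infinite.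
\<close>

lemma outer_integral_attained:
  obtains g where "g \<in> borel_measurable N" "\<And>x. x \<in> space N \<Longrightarrow> f x \<le> g x"
    "(\<integral>\<^sup>+x. g x \<partial>N) = outer_integral N f"
proof -
  let ?G = "{g \<in> borel_measurable N. \<forall>x \<in> space N. f x \<le> g x}"
  let ?A = "(\<lambda>g. \<integral>\<^sup>+x. g x \<partial>N) ` ?G"
  have "(\<lambda>_. \<infinity>) \<in> ?G" by simp
  then have "?A \<noteq> {}" by blast
  from ennreal_Inf_countable_INF[OF this]
  obtain t :: "nat \<Rightarrow> ennreal" where t: "range t \<subseteq> ?A" "Inf ?A = (INF n. t n)"
    by blast
  have "\<exists>g. g \<in> ?G \<and> t n = (\<integral>\<^sup>+x. g x \<partial>N)" for n
  proof -
    have "t n \<in> ?A" using t(1) by blast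
    then show ?thesis by blast
  qed
  then have "\<exists>g. \<forall>n. g n \<in> ?G \<and> t n = (\<integral>\<^sup>+x. g n x \<partial>N)" by (intro choice allI)
  then obtain g where g: "\<And>n. g n \<in> ?G" "\<And>n. t n = (\<integral>\<^sup>+x. g n x \<partial>N)" by blast
  let ?g = "\<lambda>x. INF n. g n x"
  have 1: "?g \<in> borel_measurable N" using g(1) by (intro borel_measurable_INF) auto
  have 2: "f x \<le> ?g x" if "x \<in> space N" for x using g(1) that by (intro INF_greatest) auto
  have "(\<integral>\<^sup>+x. ?g x \<partial>N) \<le> outer_integral N f"
    unfolding outer_integral_def t(2) g(2) by (intro INF_greatest nn_integral_mono INF_lower) auto
  moreover have "outer_integral N f \<le> (\<integral>\<^sup>+x. ?g x \<partial>N)"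
    unfolding outer_integral_def using 1 2 by (intro INF_lower) auto
  ultimately show ?thesis using that[OF 1 2] by (auto intro: antisym)
qed

section \<open>Averages of block updates\<close>

lemma sum_blocks_eq_dot:
  assumes "finite \<K>" "\<And>J. J \<in> \<K> \<Longrightarrow> finite J \<and> J \<subseteq> I"
  shows "(\<Sum>J\<in>\<K>. c J * (\<Sum>i\<in>J. d i * m J i)) = dot I d (\<lambda>i. \<Sum>J\<in>{J\<in>\<K>. i \<in> J}. c J * m J i)"
proof -
  have "(\<Sum>J\<in>\<K>. c J * (\<Sum>i\<in>J. d i * m J i))
      = (\<Sum>J\<in>\<K>. \<integral>\<^sup>+i. c J * (d i * m J i * indicator J i) \<partial>count_space I)"
  proof (rule sum.cong)
    fix J assume "J \<in> \<K>"
    then have "(\<integral>\<^sup>+i. d i * m J i * indicator J i \<partial>count_space I) = (\<Sum>i\<in>J. d i * m J i)"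
      using assms(2)[of J] by (subst nn_integral_count_space'[of J]) (auto simp: indicator_def)
    then show "c J * (\<Sum>i\<in>J. d i * m J i) = (\<integral>\<^sup>+i. c J * (d i * m J i * indicator J i) \<partial>count_space I)"
      by (subst nn_integral_cmult) auto
  qed simp
  also have "\<dots> = (\<integral>\<^sup>+i. (\<Sum>J\<in>\<K>. c J * (d i * m J i * indicator J i)) \<partial>count_space I)"
    by (rule nn_integral_sum[symmetric]) auto
  also have "\<dots> = dot I d (\<lambda>i. \<Sum>J\<in>{J\<in>\<K>. i \<in> J}. c J * m J i)"
    unfolding dot_def
  proof (rule nn_integral_cong)
    fix i
    have "(\<Sum>J\<in>\<K>. c J * (d i * m J i * indicator J i)) = (\<Sum>J\<in>\<K>. if i \<in> J then d i * (c J * m J i) else 0)"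
      by (intro sum.cong) (auto simp: indicator_def mult_ac)
    also have "\<dots> = (\<Sum>J\<in>{J\<in>\<K>. i \<in> J}. d i * (c J * m J i))"
      using assms(1) by (rule sum.inter_filter[symmetric])
    finally show "(\<Sum>J\<in>\<K>. c J * (d i * m J i * indicator J i)) = d i * (\<Sum>J\<in>{J\<in>\<K>. i \<in> J}. c J * m J i)"
      by (simp add: sum_distrib_left)
  qed
  finally show ?thesis .
qed

definition block_average ::
    "'i set \<Rightarrow> 'i set set \<Rightarrow> ('i set \<Rightarrow> real) \<Rightarrow> ('i set \<Rightarrow> ('i \<Rightarrow> 'a) \<Rightarrow> ('i \<Rightarrow> 'a) measure) \<Rightarrow>
     (('i \<Rightarrow> 'a) \<Rightarrow> real) \<Rightarrow> ('i \<Rightarrow> 'a) \<Rightarrow> real" where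
  "block_average I \<K> p \<kappa> f x =
    (1 - (\<Sum>J\<in>\<K>. p J)) * f x + (\<Sum>J\<in>\<K>. p J * block_update I J (\<kappa> J) f x)"

lemma bounded_measurable_block_average:
  assumes "finite \<K>" and \<kappa>: "\<And>J. J \<in> \<K> \<Longrightarrow> \<kappa> J \<in> PiM I M \<rightarrow>\<^sub>M prob_algebra (PiM J M)"
    and J: "\<And>J. J \<in> \<K> \<Longrightarrow> J \<subseteq> I"
    and p: "\<And>J. J \<in> \<K> \<Longrightarrow> 0 \<le> p J" "(\<Sum>J\<in>\<K>. p J) \<le> 1"
    and f: "bounded_measurable (PiM I M) f"
  shows "bounded_measurable (PiM I M) (block_average I \<K> p \<kappa> f)"
proof -
  obtain C where C: "0 \<le> C" "\<And>x. x \<in> space (PiM I M) \<Longrightarrow> \<bar>f x\<bar> \<le> C"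
    using bounded_measurable_bound[OF f] by blast
  have "f \<in> borel_measurable (PiM I M)" "\<And>J. J \<in> \<K> \<Longrightarrow> block_update I J (\<kappa> J) f \<in> borel_measurable (PiM I M)"
    using f bounded_measurable_block_update[OF \<kappa> J f] by (auto simp: bounded_measurable_def)
  then have "block_average I \<K> p \<kappa> f \<in> borel_measurable (PiM I M)"
    unfolding block_average_def[abs_def] by measurable
  then show ?thesis
  proof (rule bounded_measurableI)
    fix x assume x: "x \<in> space (PiM I M)"
    have "\<bar>block_average I \<K> p \<kappa> f x\<bar>
        \<le> \<bar>(1 - (\<Sum>J\<in>\<K>. p J)) * f x\<bar> + (\<Sum>J\<in>\<K>. \<bar>p J * block_update I J (\<kappa> J) f x\<bar>)"
      unfolding block_average_def by (intro order_trans[OF abs_triangle_ineq] add_left_mono sum_abs)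
    also have "\<dots> \<le> (1 - (\<Sum>J\<in>\<K>. p J)) * C + (\<Sum>J\<in>\<K>. p J * C)"
      using p C(2)[OF x] abs_block_update_le[OF \<kappa> J f C(2) x]
      by (intro add_mono sum_mono) (auto simp: abs_mult intro!: mult_left_mono)
    also have "\<dots> = C" by (subst sum_distrib_right[symmetric]) (simp add: left_diff_distrib)
    finally show "\<bar>block_average I \<K> p \<kappa> f x\<bar> \<le> C" .
  qed
qed

lemma quasilocal_iff_tendsto:
  "quasilocal I M f \<longleftrightarrow> (\<forall>x \<in> space (PiM I M). \<forall>z \<in> space (PiM I M).
      ((\<lambda>K. f (merge K (I - K) (z, x))) \<longlongrightarrow> f z) (finite_subsets_at_top I))"
  by (simp add: quasilocal_def tendsto_rabs_zero_iff LIM_zero_iff)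

lemma quasilocal_block_average:
  assumes "quasilocal I M f" "\<And>J. J \<in> \<K> \<Longrightarrow> quasilocal I M (block_update I J (\<kappa> J) f)"
  shows "quasilocal I M (block_average I \<K> p \<kappa> f)"
  using assms unfolding quasilocal_iff_tendsto block_average_def
  by (auto intro!: tendsto_intros)

lemma integral_block_average:
  assumes P: "prob_space P" "sets P = sets (PiM I M)"
    and "finite \<K>" and \<kappa>: "\<And>J. J \<in> \<K> \<Longrightarrow> \<kappa> J \<in> PiM I M \<rightarrow>\<^sub>M prob_algebra (PiM J M)"
    and J: "\<And>J. J \<in> \<K> \<Longrightarrow> J \<subseteq> I" and f: "bounded_measurable (PiM I M) f"
  shows "(\<integral>x. block_average I \<K> p \<kappa> f x \<partial>P)
    = (1 - (\<Sum>J\<in>\<K>. p J)) * (\<integral>x. f x \<partial>P) + (\<Sum>J\<in>\<K>. p J * (\<integral>x. block_update I J (\<kappa> J) f x \<partial>P))"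
proof -
  have int: "integrable P f" "\<And>J. J \<in> \<K> \<Longrightarrow> integrable P (block_update I J (\<kappa> J) f)"
    by (auto intro!: bounded_measurable_integrable[OF _ P] bounded_measurable_block_update \<kappa> J f)
  then show ?thesis
    unfolding block_average_def
    by (subst Bochner_Integration.integral_add) (auto simp: Bochner_Integration.integral_sum)
qed

locale coupled_updates =
  fixes I :: "'i set"
    and M :: "'i \<Rightarrow> 'a measure"
    and \<eta> :: "'i \<Rightarrow> 'a \<Rightarrow> 'a \<Rightarrow> real"
    and \<rho> \<rho>' :: "('i \<Rightarrow> 'a) measure"
    and \<J> :: "'i set set"
    and w :: "'i set \<Rightarrow> real"
    and \<gamma> \<gamma>' :: "'i set \<Rightarrow> ('i \<Rightarrow> 'a) \<Rightarrow> ('i \<Rightarrow> 'a) measure"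
    and Q :: "'i set \<Rightarrow> ('i \<Rightarrow> 'a) \<Rightarrow> ('i \<Rightarrow> 'a) \<Rightarrow> (('i \<Rightarrow> 'a) \<times> ('i \<Rightarrow> 'a)) measure"
    and Q' :: "'i set \<Rightarrow> ('i \<Rightarrow> 'a) \<Rightarrow> (('i \<Rightarrow> 'a) \<times> ('i \<Rightarrow> 'a)) measure"
  assumes countable_sites: "countable I"
    and metric: "\<And>i. i \<in> I \<Longrightarrow> Metric_space (space (M i)) (\<eta> i)"
    and metric_measurable: "\<And>i. i \<in> I \<Longrightarrow> (\<lambda>(s, t). \<eta> i s t) \<in> borel_measurable (M i \<Otimes>\<^sub>M M i)"
    and \<rho>: "prob_space \<rho>" "sets \<rho> = sets (PiM I M)"
    and \<rho>': "prob_space \<rho>'" "sets \<rho>' = sets (PiM I M)"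
    and cover: "finite_cover I \<J>"
    and weight_pos: "\<And>J. J \<in> \<J> \<Longrightarrow> 0 < w J"
    and coupled_rule: "coupled_update_rule I M \<J> \<gamma> \<gamma>' Q Q' \<rho> \<rho>'"
    and ql: "\<And>J. J \<in> \<J> \<Longrightarrow> quasilocal_kernel I J M (\<gamma> J)"
begin

lemma block: "J \<in> \<J> \<Longrightarrow> finite J" "J \<in> \<J> \<Longrightarrow> J \<subseteq> I"
  using cover by (auto simp: finite_cover_def)

lemma kernel:
  assumes "J \<in> \<J>"
  shows "\<gamma> J \<in> PiM I M \<rightarrow>\<^sub>M prob_algebra (PiM J M)" "\<gamma>' J \<in> PiM I M \<rightarrow>\<^sub>M prob_algebra (PiM J M)"
  using coupled_rule assms by (auto simp: coupled_update_rule_def local_update_rule_def)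

lemma invariance:
  assumes "J \<in> \<J>" "bounded_measurable (PiM I M) f"
  shows "(\<integral>x. block_update I J (\<gamma> J) f x \<partial>\<rho>) = (\<integral>x. f x \<partial>\<rho>)"
    "(\<integral>x. block_update I J (\<gamma>' J) f x \<partial>\<rho>') = (\<integral>x. f x \<partial>\<rho>')"
  using coupled_rule assms
  by (auto simp: coupled_update_rule_def local_update_rule_def kernel_invariant_def block_update_def)

lemma coupling_Q:
  assumes "J \<in> \<J>" "j \<in> I" "(x, z) \<in> differ_only_at I M j"
  shows "is_coupling (Q J x z) (\<gamma> J x) (\<gamma> J z)"
proof -
  have "{i \<in> I. x i \<noteq> z i} = {j}"
    using assms(2,3) differ_only_at_agree[OF assms(3)] by (auto simp: differ_only_at_def)
  then have "card {i \<in> I. x i \<noteq> z i} = 1" by simp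
  then show ?thesis
    using coupled_rule assms by (auto simp: coupled_update_rule_def differ_only_at_def)
qed

lemma coupling_Q':
  assumes "J \<in> \<J>" "x \<in> space (PiM I M)"
  shows "is_coupling (Q' J x) (\<gamma> J x) (\<gamma>' J x)"
  using coupled_rule assms by (auto simp: coupled_update_rule_def)

lemma countable_blocks_at: "countable {J\<in>\<J>. i \<in> J}"
  by (rule countable_subset[OF _ countable_finite_cover[OF countable_sites cover]]) auto

lemma block_sum_le_R_mat:
  assumes "finite \<K>" "\<K> \<subseteq> \<J>" "j \<in> I" "(x, z) \<in> differ_only_at I M j"
  shows "(\<Sum>J\<in>{J\<in>\<K>. i \<in> J}. ennreal (w J) * mean_dist \<eta> i (Q J x z))
    \<le> R_mat I M \<eta> \<J> w Q i j * ennreal (\<eta> j (x j) (z j))" (is "?s \<le> _")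
proof -
  interpret Metric_space "space (M j)" "\<eta> j" by (rule metric[OF assms(3)])
  have "x j \<in> space (M j)" "z j \<in> space (M j)" "x j \<noteq> z j"
    using assms(3,4) by (auto simp: differ_only_at_def space_PiM)
  then have pos: "0 < \<eta> j (x j) (z j)" by simp
  have "?s \<le> (\<Sum>\<^sub>\<infinity>J\<in>{J\<in>\<J>. i \<in> J}. ennreal (w J) * mean_dist \<eta> i (Q J x z))"
    using assms by (intro sum_le_infsum_ennreal countable_blocks_at) auto
  then have "ennreal (1 / \<eta> j (x j) (z j)) * ?s \<le> R_mat I M \<eta> \<J> w Q i j"
    unfolding R_mat_def using assms(4)
    by (intro SUP_upper2[of "(x, z)"]) (auto intro: mult_left_mono)
  then have "ennreal (1 / \<eta> j (x j) (z j)) * ?s * ennreal (\<eta> j (x j) (z j))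
      \<le> R_mat I M \<eta> \<J> w Q i j * ennreal (\<eta> j (x j) (z j))"
    by (rule mult_right_mono) simp
  also have "ennreal (1 / \<eta> j (x j) (z j)) * ?s * ennreal (\<eta> j (x j) (z j))
      = (ennreal (1 / \<eta> j (x j) (z j)) * ennreal (\<eta> j (x j) (z j))) * ?s"
    by (simp add: mult_ac)
  also have "ennreal (1 / \<eta> j (x j) (z j)) * ennreal (\<eta> j (x j) (z j)) = 1"
    using pos by (subst ennreal_mult[symmetric]) auto
  finally show ?thesis by simp
qed

text \<open>
  The weight not spent on blocks that contain \<open>j\<close> leaves the discrepancy at \<open>j\<close> in place; this gives the
  diagonal term. The updated sites contribute the mean distances under \<open>Q\<close>. They are summed over blocks
  before the supremum over \<open>x, z\<close> is taken, as in the definition of \<open>R\<close>, and this is why the blocks have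
  to be averaged jointly and not one by one.
\<close>

lemma delta_block_average_le:
  assumes f: "bounded_measurable (PiM I M) f"
    and \<K>: "finite \<K>" "\<K> \<subseteq> \<J>" and \<theta>: "0 \<le> \<theta>" "\<theta> * (\<Sum>J\<in>\<K>. w J) \<le> 1" and j: "j \<in> I"
  shows "delta I M \<eta> j (block_average I \<K> (\<lambda>J. \<theta> * w J) \<gamma> f)
    \<le> ennreal (1 - \<theta> * (\<Sum>J\<in>{J\<in>\<K>. j \<in> J}. w J)) * delta I M \<eta> j f
      + ennreal \<theta> * row_act I (\<lambda>i. delta I M \<eta> i f) (R_mat I M \<eta> \<J> w Q) j"
proof (rule delta_leI[of M j \<eta>, OF metric[OF j] j])
  fix x z assume xz: "(x, z) \<in> differ_only_at I M j"
  let ?d = "\<lambda>i. delta I M \<eta> i f" and ?p = "\<lambda>J. \<theta> * w J" and ?e = "ennreal (\<eta> j (x j) (z j))"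
  let ?u = "\<lambda>J. block_update I J (\<gamma> J) f"
  have sp: "x \<in> space (PiM I M)" "z \<in> space (PiM I M)"
    using xz by (auto simp: differ_only_at_def)
  note eq = differ_only_at_agree[OF xz]
  have p: "0 \<le> ?p J" if "J \<in> \<K>" for J
    using that \<K> \<theta> weight_pos[of J] by auto
  have abs_p: "\<bar>?p J * t\<bar> = ?p J * \<bar>t\<bar>" if "J \<in> \<K>" for J t
    using p[OF that] by (simp only: abs_mult[of "?p J"] abs_of_nonneg)
  have s: "0 \<le> 1 - (\<Sum>J\<in>\<K>. ?p J)" using \<theta> by (simp add: sum_distrib_left)
  have u: "ennreal \<bar>?u J x - ?u J z\<bar>
      \<le> (\<Sum>i\<in>J. ?d i * mean_dist \<eta> i (Q J x z)) + (if j \<in> J then 0 else ?d j * ?e)" if "J \<in> \<K>" for J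
  proof -
    have J: "J \<in> \<J>" using that \<K> by auto
    have "ennreal \<bar>?u J x - ?u J z\<bar>
        \<le> (\<Sum>i\<in>J. ?d i * mean_dist \<eta> i (Q J x z)) + (\<Sum>i\<in>{j} - J. ?d i * ennreal (\<eta> i (x i) (z i)))"
      using block_update_diff_le[where E="{j}" and Q="Q J x z", OF metric metric_measurable
          kernel(1)[OF J] kernel(1)[OF J] block[OF J] f sp _ _ eq coupling_Q[OF J j xz]] j by simp
    then show ?thesis by (cases "j \<in> J") (simp_all add: insert_Diff_if)
  qed
  have "\<bar>block_average I \<K> ?p \<gamma> f x - block_average I \<K> ?p \<gamma> f z\<bar>
      = \<bar>(1 - (\<Sum>J\<in>\<K>. ?p J)) * (f x - f z) + (\<Sum>J\<in>\<K>. ?p J * (?u J x - ?u J z))\<bar>"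
    unfolding block_average_def by (simp add: algebra_simps sum_subtractf)
  also have "\<dots> \<le> \<bar>(1 - (\<Sum>J\<in>\<K>. ?p J)) * (f x - f z)\<bar> + (\<Sum>J\<in>\<K>. \<bar>?p J * (?u J x - ?u J z)\<bar>)"
    by (intro order_trans[OF abs_triangle_ineq] add_left_mono sum_abs)
  also have "\<dots> = (1 - (\<Sum>J\<in>\<K>. ?p J)) * \<bar>f x - f z\<bar> + (\<Sum>J\<in>\<K>. ?p J * \<bar>?u J x - ?u J z\<bar>)"
    using s abs_p by (intro arg_cong2[where f="(+)"] sum.cong)
      (simp_all only: abs_mult[of "1 - (\<Sum>J\<in>\<K>. ?p J)"] abs_of_nonneg)
  finally have "ennreal \<bar>block_average I \<K> ?p \<gamma> f x - block_average I \<K> ?p \<gamma> f z\<bar>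
      \<le> ennreal ((1 - (\<Sum>J\<in>\<K>. ?p J)) * \<bar>f x - f z\<bar> + (\<Sum>J\<in>\<K>. ?p J * \<bar>?u J x - ?u J z\<bar>))"
    by (rule ennreal_leI)
  also have "\<dots> = ennreal (1 - (\<Sum>J\<in>\<K>. ?p J)) * ennreal \<bar>f x - f z\<bar>
      + (\<Sum>J\<in>\<K>. ennreal (?p J) * ennreal \<bar>?u J x - ?u J z\<bar>)"
    using s p by (subst ennreal_plus) (auto simp: ennreal_mult sum_ennreal[symmetric] intro!: sum_nonneg)
  also have "\<dots> \<le> ennreal (1 - (\<Sum>J\<in>\<K>. ?p J)) * (?d j * ?e)
      + (\<Sum>J\<in>\<K>. ennreal (?p J) * ((\<Sum>i\<in>J. ?d i * mean_dist \<eta> i (Q J x z)) + (if j \<in> J then 0 else ?d j * ?e)))"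
    using delta_ge[of M j \<eta>, OF metric[OF j] j xz, of f] u
    by (intro add_mono sum_mono mult_left_mono) auto
  also have "\<dots> = (ennreal (1 - (\<Sum>J\<in>\<K>. ?p J)) + (\<Sum>J\<in>\<K>. ennreal (if j \<in> J then 0 else ?p J))) * (?d j * ?e)
      + (\<Sum>J\<in>\<K>. ennreal (?p J) * (\<Sum>i\<in>J. ?d i * mean_dist \<eta> i (Q J x z)))"
  proof -
    have "(\<Sum>J\<in>\<K>. ennreal (?p J) * (if j \<in> J then 0 else ?d j * ?e))
        = (\<Sum>J\<in>\<K>. ennreal (if j \<in> J then 0 else ?p J)) * (?d j * ?e)"
      unfolding sum_distrib_right by (intro sum.cong) auto
    then show ?thesis by (simp add: distrib_left distrib_right sum.distrib ac_simps)
  qed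
  also have "ennreal (1 - (\<Sum>J\<in>\<K>. ?p J)) + (\<Sum>J\<in>\<K>. ennreal (if j \<in> J then 0 else ?p J))
      = ennreal (1 - \<theta> * (\<Sum>J\<in>{J\<in>\<K>. j \<in> J}. w J))"
  proof -
    have "(\<Sum>J\<in>\<K>. ?p J) = (\<Sum>J\<in>\<K>. (if j \<in> J then ?p J else 0) + (if j \<in> J then 0 else ?p J))"
      by (intro sum.cong) auto
    also have "\<dots> = (\<Sum>J\<in>\<K>. if j \<in> J then ?p J else 0) + (\<Sum>J\<in>\<K>. if j \<in> J then 0 else ?p J)"
      by (rule sum.distrib)
    also have "(\<Sum>J\<in>\<K>. if j \<in> J then ?p J else 0) = (\<Sum>J\<in>{J\<in>\<K>. j \<in> J}. ?p J)"
      using \<K>(1) by (rule sum.inter_filter[symmetric])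
    finally have "1 - (\<Sum>J\<in>\<K>. ?p J) + (\<Sum>J\<in>\<K>. if j \<in> J then 0 else ?p J)
        = 1 - \<theta> * (\<Sum>J\<in>{J\<in>\<K>. j \<in> J}. w J)"
      by (simp add: sum_distrib_left)
    moreover have "(\<Sum>J\<in>\<K>. ennreal (if j \<in> J then 0 else ?p J)) = ennreal (\<Sum>J\<in>\<K>. if j \<in> J then 0 else ?p J)"
      using p by (intro sum_ennreal) auto
    moreover have "0 \<le> (\<Sum>J\<in>\<K>. if j \<in> J then 0 else ?p J)" using p by (intro sum_nonneg) auto
    ultimately show ?thesis using s by (simp add: ennreal_plus[symmetric] del: ennreal_plus)
  qed
  also have "(\<Sum>J\<in>\<K>. ennreal (?p J) * (\<Sum>i\<in>J. ?d i * mean_dist \<eta> i (Q J x z)))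
      = ennreal \<theta> * (\<Sum>J\<in>\<K>. ennreal (w J) * (\<Sum>i\<in>J. ?d i * mean_dist \<eta> i (Q J x z)))"
    using \<theta>(1) \<K> weight_pos
    by (subst sum_distrib_left, intro sum.cong) (auto simp: ennreal_mult' mult.assoc)
  also have "(\<Sum>J\<in>\<K>. ennreal (w J) * (\<Sum>i\<in>J. ?d i * mean_dist \<eta> i (Q J x z)))
      = dot I ?d (\<lambda>i. \<Sum>J\<in>{J\<in>\<K>. i \<in> J}. ennreal (w J) * mean_dist \<eta> i (Q J x z))"
    using \<K> block by (intro sum_blocks_eq_dot) auto
  finally have "ennreal \<bar>block_average I \<K> ?p \<gamma> f x - block_average I \<K> ?p \<gamma> f z\<bar>
      \<le> ennreal (1 - \<theta> * (\<Sum>J\<in>{J\<in>\<K>. j \<in> J}. w J)) * (?d j * ?e)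
        + ennreal \<theta> * dot I ?d (\<lambda>i. \<Sum>J\<in>{J\<in>\<K>. i \<in> J}. ennreal (w J) * mean_dist \<eta> i (Q J x z))" .
  also have "\<dots> \<le> ennreal (1 - \<theta> * (\<Sum>J\<in>{J\<in>\<K>. j \<in> J}. w J)) * (?d j * ?e)
        + ennreal \<theta> * dot I ?d (\<lambda>i. ?e * R_mat I M \<eta> \<J> w Q i j)"
    using block_sum_le_R_mat[OF \<K> j xz]
    by (intro add_left_mono mult_left_mono dot_mono) (auto simp: mult.commute)
  also have "\<dots> = (ennreal (1 - \<theta> * (\<Sum>J\<in>{J\<in>\<K>. j \<in> J}. w J)) * ?d j
        + ennreal \<theta> * row_act I ?d (R_mat I M \<eta> \<J> w Q) j) * ?e"
    by (simp add: dot_cmult_right row_act_eq_dot distrib_left mult_ac)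
  finally show "ennreal \<bar>block_average I \<K> ?p \<gamma> f x - block_average I \<K> ?p \<gamma> f z\<bar> \<le> \<dots>" .
qed

text \<open>
  By invariance of \<open>\<rho>'\<close>, \<open>\<rho>'f\<close> is the expectation of the update with \<open>\<gamma>'\<close>, which \<open>Q'\<close> compares with
  the update with \<open>\<gamma>\<close>. Mean distances under \<open>Q'\<close> need not be measurable in \<open>x\<close>; measurable majorants
  replace them.
\<close>

lemma update_discrepancy_le:
  assumes f: "bounded_measurable (PiM I M) f" and J: "J \<in> \<J>"
  shows "ennreal \<bar>(\<integral>x. block_update I J (\<gamma> J) f x \<partial>\<rho>') - (\<integral>x. f x \<partial>\<rho>')\<bar>
    \<le> (\<Sum>i\<in>J. delta I M \<eta> i f * outer_integral \<rho>' (\<lambda>x. mean_dist \<eta> i (Q' J x)))"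
proof -
  let ?u = "block_update I J (\<gamma> J) f" and ?u' = "block_update I J (\<gamma>' J) f"
  let ?d = "\<lambda>i. delta I M \<eta> i f"
  have space: "space \<rho>' = space (PiM I M)" using \<rho>'(2) by (rule sets_eq_imp_space_eq)
  have "\<exists>g. g \<in> borel_measurable \<rho>' \<and> (\<forall>x \<in> space \<rho>'. mean_dist \<eta> i (Q' J x) \<le> g x) \<and>
      (\<integral>\<^sup>+x. g x \<partial>\<rho>') = outer_integral \<rho>' (\<lambda>x. mean_dist \<eta> i (Q' J x))" for i
    by (rule outer_integral_attained[of \<rho>' "\<lambda>x. mean_dist \<eta> i (Q' J x)"]) blast
  then have "\<exists>g. \<forall>i. g i \<in> borel_measurable \<rho>' \<and> (\<forall>x \<in> space \<rho>'. mean_dist \<eta> i (Q' J x) \<le> g i x) \<and>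
      (\<integral>\<^sup>+x. g i x \<partial>\<rho>') = outer_integral \<rho>' (\<lambda>x. mean_dist \<eta> i (Q' J x))"
    by (intro choice allI)
  then obtain g where g: "\<And>i. g i \<in> borel_measurable \<rho>'"
    "\<And>i x. x \<in> space \<rho>' \<Longrightarrow> mean_dist \<eta> i (Q' J x) \<le> g i x"
    "\<And>i. (\<integral>\<^sup>+x. g i x \<partial>\<rho>') = outer_integral \<rho>' (\<lambda>x. mean_dist \<eta> i (Q' J x))"
    by blast
  have int: "integrable \<rho>' ?u" "integrable \<rho>' ?u'"
    by (auto intro!: bounded_measurable_integrable[OF _ \<rho>'] bounded_measurable_block_update f kernel block J)
  have "(\<integral>x. ?u x \<partial>\<rho>') - (\<integral>x. f x \<partial>\<rho>') = (\<integral>x. ?u x - ?u' x \<partial>\<rho>')"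
    using int invariance(2)[OF J f] by simp
  also have "ennreal (norm \<dots>) \<le> (\<integral>\<^sup>+x. ennreal (norm (?u x - ?u' x)) \<partial>\<rho>')"
    using int by (intro integral_norm_bound_ennreal) auto
  also have "\<dots> \<le> (\<integral>\<^sup>+x. (\<Sum>i\<in>J. ?d i * g i x) \<partial>\<rho>')"
  proof (rule nn_integral_mono)
    fix x assume x: "x \<in> space \<rho>'"
    then have x': "x \<in> space (PiM I M)" by (simp add: space)
    have "ennreal \<bar>?u x - ?u' x\<bar> \<le> (\<Sum>i\<in>J. ?d i * mean_dist \<eta> i (Q' J x))"
      using block_update_diff_le[where E="{}" and Q="Q' J x", OF metric metric_measurable
          kernel[OF J] block[OF J] f x' x' _ _ _ coupling_Q'[OF J x']] by simp
    also have "\<dots> \<le> (\<Sum>i\<in>J. ?d i * g i x)"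
      using g(2)[OF x] by (intro sum_mono mult_left_mono) auto
    finally show "ennreal (norm (?u x - ?u' x)) \<le> (\<Sum>i\<in>J. ?d i * g i x)" by simp
  qed
  also have "\<dots> = (\<Sum>i\<in>J. ?d i * outer_integral \<rho>' (\<lambda>x. mean_dist \<eta> i (Q' J x)))"
    using g(1,3) by (subst nn_integral_sum) (auto simp: nn_integral_cmult)
  finally show ?thesis by simp
qed

text \<open>
  Averaging preserves \<open>\<rho>f\<close> by invariance; only the expectation under \<open>\<rho>'\<close> moves.
\<close>

lemma integral_diff_block_average_le:
  assumes f: "bounded_measurable (PiM I M) f"
    and \<K>: "finite \<K>" "\<K> \<subseteq> \<J>" and \<theta>: "0 \<le> \<theta>" "\<theta> * (\<Sum>J\<in>\<K>. w J) \<le> 1"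
  defines "g \<equiv> block_average I \<K> (\<lambda>J. \<theta> * w J) \<gamma> f"
  shows "ennreal \<bar>(\<integral>x. f x \<partial>\<rho>) - (\<integral>x. f x \<partial>\<rho>')\<bar>
    \<le> ennreal \<bar>(\<integral>x. g x \<partial>\<rho>) - (\<integral>x. g x \<partial>\<rho>')\<bar>
      + ennreal \<theta> * dot I (\<lambda>i. delta I M \<eta> i f) (a_vec \<eta> \<J> w Q' \<rho>')"
proof -
  let ?p = "\<lambda>J. \<theta> * w J" and ?u = "\<lambda>J. block_update I J (\<gamma> J) f" and ?d = "\<lambda>i. delta I M \<eta> i f"
  let ?o = "\<lambda>J i. outer_integral \<rho>' (\<lambda>x. mean_dist \<eta> i (Q' J x))"
  have p: "0 \<le> ?p J" if "J \<in> \<K>" for J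
    using that \<K> \<theta> weight_pos[of J] by auto
  have abs_p: "\<bar>?p J * t\<bar> = ?p J * \<bar>t\<bar>" if "J \<in> \<K>" for J t
    using p[OF that] by (simp only: abs_mult[of "?p J"] abs_of_nonneg)
  have in_\<J>: "J \<in> \<J>" if "J \<in> \<K>" for J using that \<K> by auto
  have avg: "(\<integral>x. g x \<partial>P) = (1 - (\<Sum>J\<in>\<K>. ?p J)) * (\<integral>x. f x \<partial>P) + (\<Sum>J\<in>\<K>. ?p J * (\<integral>x. ?u J x \<partial>P))"
    if "prob_space P" "sets P = sets (PiM I M)" for P
    unfolding g_def by (intro integral_block_average[where M = M] that \<K> kernel block f in_\<J>)
  have "(\<integral>x. g x \<partial>\<rho>) = (1 - (\<Sum>J\<in>\<K>. ?p J)) * (\<integral>x. f x \<partial>\<rho>) + (\<Sum>J\<in>\<K>. ?p J * (\<integral>x. f x \<partial>\<rho>))"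
    unfolding avg[OF \<rho>] using invariance(1)[OF in_\<J> f] by simp
  also have "\<dots> = (\<integral>x. f x \<partial>\<rho>)"
    by (subst sum_distrib_right[symmetric]) (simp add: left_diff_distrib)
  finally have g_\<rho>: "(\<integral>x. g x \<partial>\<rho>) = (\<integral>x. f x \<partial>\<rho>)" .
  have g_\<rho>': "(\<integral>x. g x \<partial>\<rho>') - (\<integral>x. f x \<partial>\<rho>') = (\<Sum>J\<in>\<K>. ?p J * ((\<integral>x. ?u J x \<partial>\<rho>') - (\<integral>x. f x \<partial>\<rho>')))"
    unfolding avg[OF \<rho>'] by (simp add: algebra_simps sum_subtractf sum_distrib_left sum_distrib_right)
  have "ennreal \<bar>(\<integral>x. g x \<partial>\<rho>') - (\<integral>x. f x \<partial>\<rho>')\<bar>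
      \<le> ennreal (\<Sum>J\<in>\<K>. ?p J * \<bar>(\<integral>x. ?u J x \<partial>\<rho>') - (\<integral>x. f x \<partial>\<rho>')\<bar>)"
    unfolding g_\<rho>' using abs_p by (intro ennreal_leI order_trans[OF sum_abs] sum_mono) (simp only: order_refl)
  also have "\<dots> = (\<Sum>J\<in>\<K>. ennreal (?p J) * ennreal \<bar>(\<integral>x. ?u J x \<partial>\<rho>') - (\<integral>x. f x \<partial>\<rho>')\<bar>)"
    using p by (subst sum_ennreal[symmetric]) (auto simp: ennreal_mult)
  also have "\<dots> \<le> (\<Sum>J\<in>\<K>. ennreal (?p J) * (\<Sum>i\<in>J. ?d i * ?o J i))"
    using update_discrepancy_le[OF f in_\<J>] by (intro sum_mono mult_left_mono) auto
  also have "\<dots> = ennreal \<theta> * (\<Sum>J\<in>\<K>. ennreal (w J) * (\<Sum>i\<in>J. ?d i * ?o J i))"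
    using \<theta>(1) by (subst sum_distrib_left, intro sum.cong) (auto simp: ennreal_mult' mult.assoc)
  also have "(\<Sum>J\<in>\<K>. ennreal (w J) * (\<Sum>i\<in>J. ?d i * ?o J i))
      = dot I ?d (\<lambda>i. \<Sum>J\<in>{J\<in>\<K>. i \<in> J}. ennreal (w J) * ?o J i)"
    using \<K> block by (intro sum_blocks_eq_dot) auto
  also have "\<dots> \<le> dot I ?d (a_vec \<eta> \<J> w Q' \<rho>')"
    unfolding a_vec_def using \<K>
    by (intro dot_mono sum_le_infsum_ennreal countable_blocks_at) auto
  finally have cost: "ennreal \<bar>(\<integral>x. g x \<partial>\<rho>') - (\<integral>x. f x \<partial>\<rho>')\<bar>
      \<le> ennreal \<theta> * dot I ?d (a_vec \<eta> \<J> w Q' \<rho>')" by (simp add: mult_left_mono)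
  have "ennreal \<bar>(\<integral>x. f x \<partial>\<rho>) - (\<integral>x. f x \<partial>\<rho>')\<bar>
      \<le> ennreal (\<bar>(\<integral>x. g x \<partial>\<rho>) - (\<integral>x. g x \<partial>\<rho>')\<bar> + \<bar>(\<integral>x. g x \<partial>\<rho>') - (\<integral>x. f x \<partial>\<rho>')\<bar>)"
    using g_\<rho> by (intro ennreal_leI) linarith
  also have "\<dots> = ennreal \<bar>(\<integral>x. g x \<partial>\<rho>) - (\<integral>x. g x \<partial>\<rho>')\<bar> + ennreal \<bar>(\<integral>x. g x \<partial>\<rho>') - (\<integral>x. f x \<partial>\<rho>')\<bar>"
    by (simp add: ennreal_plus)
  finally show ?thesis using cost by (meson add_left_mono order_trans)
qed

lemma is_comparison_system:
  assumes W: "\<And>i. i \<in> I \<Longrightarrow> W_mat \<J> w i i \<le> 1"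
  shows "comparison_system I \<J> w (R_mat I M \<eta> \<J> w Q) (a_vec \<eta> \<J> w Q' \<rho>')
    (\<lambda>i. mean_dist \<eta> i (\<rho> \<Otimes>\<^sub>M \<rho>')) {f. bounded_measurable (PiM I M) f \<and> quasilocal I M f}
    (\<lambda>f i. delta I M \<eta> i f) (\<lambda>f. ennreal \<bar>(\<integral>x. f x \<partial>\<rho>) - (\<integral>x. f x \<partial>\<rho>')\<bar>)"
proof (unfold_locales, goal_cases)
  case (5 f)
  then show ?case
    by (intro integral_diff_le_dot_mean_dist countable_sites metric metric_measurable \<rho> \<rho>') auto
next
  case (6 f \<K> \<theta>)
  then have f: "bounded_measurable (PiM I M) f" "quasilocal I M f" by auto
  let ?g = "block_average I \<K> (\<lambda>J. \<theta> * w J) \<gamma> f"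
  have J: "J \<in> \<J>" "0 \<le> \<theta> * w J" if "J \<in> \<K>" for J
    using that 6 weight_pos[of J] by auto
  have "bounded_measurable (PiM I M) ?g"
    using 6 J by (intro bounded_measurable_block_average kernel block f) (auto simp: sum_distrib_left)
  moreover have "quasilocal I M ?g"
    using J by (intro quasilocal_block_average quasilocal_block_update countable_sites kernel block ql f) auto
  ultimately show ?case
    using delta_block_average_le[OF f(1) 6(2-5)] integral_diff_block_average_le[OF f(1) 6(2-5)]
    by (intro bexI[of _ ?g]) auto
next
  case (7 f \<epsilon>)
  then have f: "bounded_measurable (PiM I M) f" "quasilocal I M f" by auto
  show ?case
  proof (rule localization[OF countable_sites metric \<rho> \<rho>' f 7(2)])
    fix L g
    assume "finite L" "L \<subseteq> I" "bounded_measurable (PiM I M) g" "quasilocal I M g"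
      "\<And>i. i \<in> I \<Longrightarrow> delta I M \<eta> i g \<le> (if i \<in> L then delta I M \<eta> i f else 0)"
      "ennreal \<bar>(\<integral>x. f x \<partial>\<rho>) - (\<integral>x. f x \<partial>\<rho>')\<bar>
        \<le> ennreal \<bar>(\<integral>x. g x \<partial>\<rho>) - (\<integral>x. g x \<partial>\<rho>')\<bar> + ennreal \<epsilon>"
    then show ?case by (intro exI[of _ L] exI[of _ g]) auto
  qed
qed (use countable_sites cover weight_pos W in auto)

end

theorem theorem2p4:
  fixes I :: "'i set"
    and M :: "'i \<Rightarrow> 'a measure"
    and \<eta> :: "'i \<Rightarrow> 'a \<Rightarrow> 'a \<Rightarrow> real"
    and \<rho> \<rho>' :: "('i \<Rightarrow> 'a) measure"
    and \<J> :: "'i set set"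
    and w :: "'i set \<Rightarrow> real"
    and \<gamma> \<gamma>' :: "'i set \<Rightarrow> ('i \<Rightarrow> 'a) \<Rightarrow> ('i \<Rightarrow> 'a) measure"
    and Q :: "'i set \<Rightarrow> ('i \<Rightarrow> 'a) \<Rightarrow> ('i \<Rightarrow> 'a) \<Rightarrow> (('i \<Rightarrow> 'a) \<times> ('i \<Rightarrow> 'a)) measure"
    and Q' :: "'i set \<Rightarrow> ('i \<Rightarrow> 'a) \<Rightarrow> (('i \<Rightarrow> 'a) \<times> ('i \<Rightarrow> 'a)) measure"
    and f :: "('i \<Rightarrow> 'a) \<Rightarrow> real"
  assumes "countable I"
    and "\<And>i. i \<in> I \<Longrightarrow> Metric_space (space (M i)) (\<eta> i)"
    and "\<And>i. i \<in> I \<Longrightarrow> (\<lambda>(s, t). \<eta> i s t) \<in> borel_measurable (M i \<Otimes>\<^sub>M M i)"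
    and "prob_space \<rho>" and "sets \<rho> = sets (PiM I M)"
    and "prob_space \<rho>'" and "sets \<rho>' = sets (PiM I M)"
    and "finite_cover I \<J>"
    and "\<And>J. J \<in> \<J> \<Longrightarrow> 0 < w J"
    and "coupled_update_rule I M \<J> \<gamma> \<gamma>' Q Q' \<rho> \<rho>'"
    and "\<And>J. J \<in> \<J> \<Longrightarrow> quasilocal_kernel I J M (\<gamma> J)"
    and "\<And>i. i \<in> I \<Longrightarrow> W_mat \<J> w i i \<le> 1"
    and "\<And>i. i \<in> I \<Longrightarrow>
      (\<lambda>n. \<Sum>\<^sub>\<infinity>j\<in>I. mat_pow I (iter_mat (W_mat \<J> w) (R_mat I M \<eta> \<J> w Q)) n i j *
              mean_dist \<eta> j (\<rho> \<Otimes>\<^sub>M \<rho>')) \<longlonglongrightarrow> 0"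
    and "bounded_measurable (PiM I M) f"
    and "quasilocal I M f"
    and "\<And>i. i \<in> I \<Longrightarrow> delta I M \<eta> i f < \<infinity>"
  shows "ennreal \<bar>(\<integral>x. f x \<partial>\<rho>) - (\<integral>x. f x \<partial>\<rho>')\<bar> \<le>
    (\<Sum>\<^sub>\<infinity>(i, j)\<in>I \<times> I. delta I M \<eta> i f * D_mat I (W_mat \<J> w) (R_mat I M \<eta> \<J> w Q) i j *
       inverse (W_mat \<J> w j j) * a_vec \<eta> \<J> w Q' \<rho>' j)"
proof -
  interpret coupled_updates I M \<eta> \<rho> \<rho>' \<J> w \<gamma> \<gamma>' Q Q'
    by (rule coupled_updates.intro) (fact assms)+
  interpret comparison_system I \<J> w "R_mat I M \<eta> \<J> w Q" "a_vec \<eta> \<J> w Q' \<rho>'"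
    "\<lambda>i. mean_dist \<eta> i (\<rho> \<Otimes>\<^sub>M \<rho>')" "{f. bounded_measurable (PiM I M) f \<and> quasilocal I M f}"
    "\<lambda>f i. delta I M \<eta> i f" "\<lambda>f. ennreal \<bar>(\<integral>x. f x \<partial>\<rho>) - (\<integral>x. f x \<partial>\<rho>')\<bar>"
    by (rule is_comparison_system) (fact assms)
  show ?thesis
    by (rule err_le_dot_D[of f]) (use assms in auto)
qed

end
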